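(* Let $n=1$, $a>1$, $0\le \delta<1$, and $s\in\mathbb{R}$. If $$(a-1)\delta+\max\left\{\delta,\tfrac14\right\}<s,$$ then for every $f\in H^s(\mathbb{R})$, $$S^af(x,t)-f(x)=o(|t|^\delta)\quad\text{as } t\to 0,\qquad \text{for a.e. } x\in\mathbb{R}. \tag{$*$}$$ Conversely, if $( * )$ holds for all $f\in H^s(\mathbb{R})$, then $(a-1)\delta+\max\{\delta,\tfrac14\}\le s$.
   Context: $H^s(\mathbb{R})$ is the inhomogeneous $L^2$-based Sobolev space of order $s$. With $\hat f(\xi)=\int_{\mathbb{R}}e^{-ix\xi}f(x)\,dx$, the Schrödinger type operator is (formally) defined by $$S^af(x,t)=e^{it(-\Delta)^{a/2}}f(x)=\frac{1}{2\pi}\int_{\mathbb{R}}e^{i(x\xi+t|\xi|^a)}\hat f(\xi)\,d\xi ,$$ where for general $f\in H^s(\mathbb{R})$ the integral is understood as an inverse Fourier transform in the usual extended sense. The statement $S^af(x,t)-f(x)=o(|t|^\delta)$ as $t\to0$ means $\lim_{t\to0}|t|^{-\delta}\,(S^af(x,t)-f(x))=0$. *)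

theory Defs
  imports "HOL-Analysis.Analysis"
begin

section \<open>Schwartz functions and tempered distributions on the real line\<close>

definition nth_deriv :: "nat \<Rightarrow> (real \<Rightarrow> complex) \<Rightarrow> real \<Rightarrow> complex" where
  "nth_deriv n \<phi> = ((\<lambda>\<psi> x. vector_derivative \<psi> (at x)) ^^ n) \<phi>"

definition schwartz :: "(real \<Rightarrow> complex) set" where
  "schwartz = {\<phi>. (\<forall>n x. nth_deriv n \<phi> differentiable (at x)) \<and>
                  (\<forall>k n. bounded (range (\<lambda>x. \<bar>x\<bar> ^ k *\<^sub>R nth_deriv n \<phi> x)))}"

definition schwartz_seminorm :: "nat \<Rightarrow> nat \<Rightarrow> (real \<Rightarrow> complex) \<Rightarrow> real" where
  "schwartz_seminorm k n \<phi> = (SUP x. \<bar>x\<bar> ^ k * norm (nth_deriv n \<phi> x))"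

text \<open>A distribution is a functional on all functions, of which only the values on Schwartz
  functions are meaningful; the values elsewhere are arbitrary and are never used.\<close>

type_synonym distribution = "(real \<Rightarrow> complex) \<Rightarrow> complex"

definition tempered :: "distribution \<Rightarrow> bool" where
  "tempered T \<longleftrightarrow>
     (\<forall>\<phi>\<in>schwartz. \<forall>\<psi>\<in>schwartz. T (\<lambda>x. \<phi> x + \<psi> x) = T \<phi> + T \<psi>) \<and>
     (\<forall>c. \<forall>\<phi>\<in>schwartz. T (\<lambda>x. c * \<phi> x) = c * T \<phi>) \<and>
     (\<exists>C N. \<forall>\<phi>\<in>schwartz. norm (T \<phi>) \<le> C * (\<Sum>k\<le>N. \<Sum>n\<le>N. schwartz_seminorm k n \<phi>))"

definition dist_of_fun :: "(real \<Rightarrow> complex) \<Rightarrow> distribution" where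
  "dist_of_fun g \<phi> = (LINT x|lborel. g x * \<phi> x)"

text \<open>The tempered distribution \<open>T\<close> is (integration against) the function \<open>g\<close>. Such a \<open>g\<close> is
  determined by \<open>T\<close> up to a null set.\<close>

definition represents :: "(real \<Rightarrow> complex) \<Rightarrow> distribution \<Rightarrow> bool" where
  "represents g T \<longleftrightarrow> g \<in> borel_measurable borel \<and>
     (\<forall>\<phi>\<in>schwartz. integrable lborel (\<lambda>x. g x * \<phi> x) \<and> T \<phi> = dist_of_fun g \<phi>)"


section \<open>Fourier transform\<close>

definition fourier :: "(real \<Rightarrow> complex) \<Rightarrow> real \<Rightarrow> complex" where
  "fourier \<phi> \<xi> = (LINT x|lborel. cis (- (x * \<xi>)) * \<phi> x)"

definition inv_fourier :: "(real \<Rightarrow> complex) \<Rightarrow> real \<Rightarrow> complex" where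
  "inv_fourier \<phi> x = 1 / (2 * of_real pi) * (LINT \<xi>|lborel. cis (x * \<xi>) * \<phi> \<xi>)"

text \<open>The extensions to tempered distributions, by transposition.\<close>

definition fourier_dist :: "distribution \<Rightarrow> distribution" where
  "fourier_dist T = (\<lambda>\<phi>. T (fourier \<phi>))"

definition inv_fourier_dist :: "distribution \<Rightarrow> distribution" where
  "inv_fourier_dist T = (\<lambda>\<phi>. T (inv_fourier \<phi>))"


section \<open>Sobolev spaces and the Schroedinger type operator\<close>

definition sobolev :: "real \<Rightarrow> distribution set" where
  "sobolev s = {f. tempered f \<and>
     (\<exists>g. represents g (fourier_dist f) \<and>
          integrable lborel (\<lambda>\<xi>. (1 + \<xi>\<^sup>2) powr s * (norm (g \<xi>))\<^sup>2))}"

text \<open>The Fourier transform as a function, for those distributions for which it is one (in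
  particular on every Sobolev space); being unique up to a null set, the choice is immaterial.\<close>

definition fourier_fun :: "distribution \<Rightarrow> real \<Rightarrow> complex" where
  "fourier_fun f = (SOME g. represents g (fourier_dist f))"

definition schroedinger :: "real \<Rightarrow> real \<Rightarrow> distribution \<Rightarrow> distribution" where
  "schroedinger a t f =
     inv_fourier_dist (dist_of_fun (\<lambda>\<xi>. cis (t * \<bar>\<xi>\<bar> powr a) * fourier_fun f \<xi>))"

text \<open>\<open>S\<^sup>a f(x,t) - f(x) = o(|t|\<^sup>\<delta>)\<close> as \<open>t \<rightarrow> 0\<close>, for a.e. \<open>x\<close>. The distributions \<open>f\<close> and
  \<open>S\<^sup>a f(\<cdot>,t)\<close> determine functions of \<open>x\<close> only up to null sets, which for the second one may depend
  on \<open>t\<close>, so that the assertion is about a suitable choice \<open>u t\<close> of representatives of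
  \<open>S\<^sup>a f(\<cdot>,t)\<close>. The values of \<open>u t x\<close> for \<open>t\<close> in a countable set are independent of this choice for
  a.e. \<open>x\<close>. Hence, if there is a choice which for a.e. \<open>x\<close> is continuous in \<open>t\<close>, then the
  assertion holds for that choice as soon as it holds for any other one.\<close>

definition ae_convergence_rate :: "real \<Rightarrow> real \<Rightarrow> distribution \<Rightarrow> bool" where
  "ae_convergence_rate a \<delta> f \<longleftrightarrow>
     (\<exists>f\<^sub>0 u. represents f\<^sub>0 f \<and> (\<forall>t. represents (u t) (schroedinger a t f)) \<and>
       (AE x in lborel. ((\<lambda>t. \<bar>t\<bar> powr (- \<delta>) *\<^sub>R (u t x - f\<^sub>0 x)) \<longlongrightarrow> 0) (at 0)))"

end

theory Submission
  imports Defs "HOL-Probability.Probability" "HOL-Real_Asymp.Real_Asymp"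
begin

text \<open>
  Sufficiency: decompose the frequencies into the dyadic annuli \<open>2\<^sup>j \<le> \<bar>\<xi>\<bar> < 2\<^sup>j\<^sup>+\<^sup>1\<close>. On an annulus of
  size \<open>N\<close> and for \<open>x\<close> in a unit interval, the maximal function over \<open>\<bar>t\<bar> \<le> T\<close> is linearized, by
  making the time a function of \<open>x\<close>, and estimated by the \<open>TT\<^sup>*\<close> method. Van der Corput's lemmas bound
  the kernel by \<open>N\<^sup>\<epsilon> \<bar>x\<bar>\<^sup>\<epsilon>\<^sup>-\<^sup>1\<close> plus a term \<open>(N / \<bar>x\<bar>)\<^sup>1\<^sup>/\<^sup>2\<close> which is only present for \<open>\<bar>x\<bar>\<close> up to a multiple of
  \<open>T N\<^sup>a\<^sup>-\<^sup>1\<close>, so that the square of the operator norm is of order \<open>N\<^sup>\<epsilon> + min(N, T N\<^sup>a)\<^sup>1\<^sup>/\<^sup>2\<close>. Used with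
  \<open>T = 2\<^sup>-\<^sup>l\<close> for the times \<open>\<bar>t\<bar> \<approx> T \<ge> N\<^sup>-\<^sup>a\<close>, and on the time derivative for \<open>\<bar>t\<bar> \<le> N\<^sup>-\<^sup>a\<close>, this shows that
  passing from \<open>f\<close> to the maximal function of \<open>\<bar>t\<bar>\<^sup>-\<^sup>\<delta> (S\<^sup>a f(x,t) - f(x))\<close> costs a power of \<open>N\<close> arbitrarily
  close to \<open>(a - 1) \<delta> + max {\<delta>, 1/4}\<close>. The annuli can then be summed, and each of them satisfies
  the claim because \<open>\<delta> < 1\<close>.

  Necessity: superpose, along a sparse sequence of \<open>N = 2\<^sup>n\<close>, multiples of packets whose Fourier transform
  is the indicator function of \<open>[N, N + L]\<close>. For \<open>L = 1/2\<close> the packet changes by a fixed proportion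
  in the time \<open>N\<^sup>-\<^sup>a\<close>, which forces \<open>a \<delta> \<le> s\<close>. For \<open>L\<close> a small multiple of \<open>N\<^sup>1\<^sup>/\<^sup>2\<close> the packet is concentrated near
  \<open>0\<close> initially but moves with speed \<open>a N\<^sup>a\<^sup>-\<^sup>1\<close> without spreading, so that it visits each point of
  \<open>[1/2, 1]\<close> at some time of order \<open>N\<^sup>1\<^sup>-\<^sup>a\<close>; this forces \<open>(a - 1) \<delta> + 1/4 \<le> s\<close>.
\<close>

section \<open>Schwartz functions and the Fourier transform\<close>

text \<open>The exponent comes from one optimization. At the time scale \<open>T\<close> put
  \<open>y = T N^a\<close>, which is at least about 1. The square of the rate then costs
  \<open>T^(-2 \<delta>) (N^\<epsilon> + min(N, y)^(1/2))\<close>, and here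
  \<open>T^(-2 \<delta>) = N^(2 a \<delta>) y^(-2 \<delta>)\<close>. For \<delta> > 1/4 the worst
  case is \<open>y\<close> of order 1, for \<delta> < 1/4 it is \<open>y\<close> of order
  \<open>N\<close>. These are the times \<open>N^(-a)\<close> and \<open>N^(1-a)\<close> of the two
  counterexamples. Two features of the statement shape the rest. Representatives are determined only
  up to null sets that may depend on \<open>t\<close>; so sufficiency constructs representatives
  whose series converges off one null set for all small \<open>t\<close>, and necessity may test
  countably many times only. Moreover \<open>f\<close> is a distribution, and for a transform that
  is merely square integrable the inversion integral may diverge. Cutting the frequencies into
  bounded pieces with summable L2 norms turns it into a series of ordinary integrals that converges
  absolutely a.e.; both directions use this device.\<close>

lemma nth_deriv_0 [simp]: "nth_deriv 0 \<phi> = \<phi>"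
  by (simp add: nth_deriv_def)

lemma nth_deriv_Suc: "nth_deriv (Suc n) \<phi> = (\<lambda>x. vector_derivative (nth_deriv n \<phi>) (at x))"
  by (simp add: nth_deriv_def)

lemma nth_deriv_nth_deriv: "nth_deriv m (nth_deriv n \<phi>) = nth_deriv (m + n) \<phi>"
  by (simp add: nth_deriv_def funpow_add)

lemma schwartz_has_deriv:
  assumes "\<phi> \<in> schwartz"
  shows "(nth_deriv n \<phi> has_vector_derivative nth_deriv (Suc n) \<phi> x) (at x)"
  using assms unfolding nth_deriv_Suc vector_derivative_works[symmetric]
  by (auto simp: schwartz_def)

lemma schwartz_bound:
  assumes "\<phi> \<in> schwartz"
  shows "\<exists>C\<ge>0. \<forall>x. \<bar>x\<bar> ^ k * norm (nth_deriv n \<phi> x) \<le> C"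
proof -
  have "bounded (range (\<lambda>x. \<bar>x\<bar> ^ k *\<^sub>R nth_deriv n \<phi> x))"
    using assms by (auto simp: schwartz_def)
  then obtain C where C: "\<forall>x. norm (\<bar>x\<bar> ^ k *\<^sub>R nth_deriv n \<phi> x) \<le> C"
    by (auto simp: bounded_iff)
  moreover have "C \<ge> 0"
    using order_trans[OF norm_ge_zero C[rule_format]] .
  ultimately show ?thesis
    by (auto simp: abs_mult)
qed

text \<open>\<open>nth_deriv\<close> iterates \<open>vector_derivative\<close>, which is meaningful
  only where the function is differentiable. Closure properties of \<open>schwartz\<close> are
  therefore proved by exhibiting a whole sequence \<open>D\<close> of candidate derivatives, which
  induction identifies with \<open>nth_deriv\<close>.\<close>

lemma schwartzI:
  assumes D0: "D 0 = \<phi>"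
    and deriv: "\<And>n x. (D n has_vector_derivative D (Suc n) x) (at x)"
    and bound: "\<And>k n. \<exists>C. \<forall>x. \<bar>x\<bar> ^ k * norm (D n x) \<le> C"
  shows "\<phi> \<in> schwartz" and "nth_deriv n \<phi> = D n"
proof -
  have D: "nth_deriv n \<phi> = D n" for n
    by (induction n) (auto simp: D0 nth_deriv_Suc vector_derivative_at[OF deriv])
  show "nth_deriv n \<phi> = D n"
    by (rule D)
  have "bounded (range (\<lambda>x. \<bar>x\<bar> ^ k *\<^sub>R D n x))" for k n
    using bound[of k n] by (auto simp: bounded_iff)
  then show "\<phi> \<in> schwartz"
    by (auto simp: schwartz_def D intro: differentiableI_vector[OF deriv])
qed

lemma schwartz_nth_deriv:
  assumes "\<phi> \<in> schwartz"
  shows "nth_deriv n \<phi> \<in> schwartz"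
proof (rule schwartzI(1)[where D = "\<lambda>m. nth_deriv (m + n) \<phi>"])
  show "\<exists>C. \<forall>x. \<bar>x\<bar> ^ k * norm (nth_deriv (m + n) \<phi> x) \<le> C" for k m
    using schwartz_bound[OF assms] by blast
qed (use schwartz_has_deriv[OF assms] in auto)

lemma schwartz_deriv: "\<phi> \<in> schwartz \<Longrightarrow> (\<phi> has_vector_derivative nth_deriv 1 \<phi> x) (at x)"
  using schwartz_has_deriv[of \<phi> 0] by simp

lemma schwartz_cmult:
  assumes "\<phi> \<in> schwartz"
  shows "(\<lambda>x. c * \<phi> x) \<in> schwartz"
proof (rule schwartzI(1)[where D = "\<lambda>m x. c * nth_deriv m \<phi> x"])
  fix k n
  obtain C where "\<forall>x. \<bar>x\<bar> ^ k * norm (nth_deriv n \<phi> x) \<le> C"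
    using schwartz_bound[OF assms] by blast
  then have "\<forall>x. \<bar>x\<bar> ^ k * norm (c * nth_deriv n \<phi> x) \<le> norm c * C"
    by (simp add: norm_mult mult.left_commute mult_left_mono)
  then show "\<exists>C. \<forall>x. \<bar>x\<bar> ^ k * norm (c * nth_deriv n \<phi> x) \<le> C"
    by blast
qed (auto intro!: derivative_eq_intros schwartz_has_deriv[OF assms])

lemma schwartz_uminus_arg:
  assumes "\<phi> \<in> schwartz"
  shows "(\<lambda>x. \<phi> (- x)) \<in> schwartz"
proof (rule schwartzI(1)[where D = "\<lambda>m x. (-1) ^ m * nth_deriv m \<phi> (- x)"])
  fix n x
  have "((nth_deriv n \<phi> \<circ> uminus) has_vector_derivative (-1) *\<^sub>R nth_deriv (Suc n) \<phi> (- x)) (at x)"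
    by (rule vector_diff_chain_at) (auto intro!: derivative_eq_intros schwartz_has_deriv[OF assms])
  then have "((\<lambda>x. (-1) ^ n * nth_deriv n \<phi> (- x)) has_vector_derivative
      (-1) ^ n * ((-1) *\<^sub>R nth_deriv (Suc n) \<phi> (- x))) (at x)"
    by (intro has_vector_derivative_mult_right) (simp add: o_def)
  then show "((\<lambda>x. (-1) ^ n * nth_deriv n \<phi> (- x)) has_vector_derivative
      (-1) ^ Suc n * nth_deriv (Suc n) \<phi> (- x)) (at x)"
    by simp
next
  fix k n
  obtain C where C: "\<forall>x. \<bar>x\<bar> ^ k * norm (nth_deriv n \<phi> x) \<le> C"
    using schwartz_bound[OF assms] by blast
  have "\<bar>x\<bar> ^ k * norm ((-1) ^ n * nth_deriv n \<phi> (- x)) \<le> C" for x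
    using C[rule_format, of "- x"] by (simp add: norm_mult norm_power)
  then show "\<exists>C. \<forall>x. \<bar>x\<bar> ^ k * norm ((-1) ^ n * nth_deriv n \<phi> (- x)) \<le> C"
    by blast
qed auto

lemma schwartz_mult_x:
  assumes "\<phi> \<in> schwartz"
  shows "(\<lambda>x. of_real x * \<phi> x) \<in> schwartz"
\<comment> \<open>Leibniz's rule. At \<open>m = 0\<close> the truncated difference
  \<open>m - 1\<close> is harmless because its coefficient is 0.\<close>
proof (rule schwartzI(1)[where D =
    "\<lambda>m x. of_real x * nth_deriv m \<phi> x + of_nat m * nth_deriv (m - 1) \<phi> x"])
  fix n x
  have 1: "((\<lambda>x. of_nat n * nth_deriv (n - 1) \<phi> x) has_vector_derivative of_nat n
      * nth_deriv n \<phi> x) (at x)"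
    by (cases n) (auto intro!: derivative_eq_intros schwartz_has_deriv[OF assms])
  show "((\<lambda>x. of_real x * nth_deriv n \<phi> x + of_nat n * nth_deriv (n - 1) \<phi> x) has_vector_derivative
      of_real x * nth_deriv (Suc n) \<phi> x + of_nat (Suc n) * nth_deriv (Suc n - 1) \<phi> x) (at x)"
    by (rule derivative_eq_intros 1 schwartz_has_deriv[OF assms] refl)+ (simp add: algebra_simps)
next
  fix k n
  obtain C where C: "\<forall>x. \<bar>x\<bar> ^ Suc k * norm (nth_deriv n \<phi> x) \<le> C"
    using schwartz_bound[OF assms] by blast
  obtain C' where C': "\<forall>x. \<bar>x\<bar> ^ k * norm (nth_deriv (n - 1) \<phi> x) \<le> C'"
    using schwartz_bound[OF assms] by blast
  have "\<bar>x\<bar> ^ k * norm (of_real x * nth_deriv n \<phi> x + of_nat n * nth_deriv (n - 1) \<phi> x)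
      \<le> C + n * C'" for x
  proof -
    have "\<bar>x\<bar> ^ k * norm (of_real x * nth_deriv n \<phi> x + of_nat n * nth_deriv (n - 1) \<phi> x)
      \<le> \<bar>x\<bar> ^ k * (norm (of_real x * nth_deriv n \<phi> x) + norm (of_nat n * nth_deriv (n - 1) \<phi> x))"
      by (intro mult_left_mono norm_triangle_ineq) auto
    also have "\<dots> = \<bar>x\<bar> ^ Suc k * norm (nth_deriv n \<phi> x)
        + n * (\<bar>x\<bar> ^ k * norm (nth_deriv (n - 1) \<phi> x))"
      by (simp add: norm_mult algebra_simps)
    also have "\<dots> \<le> C + n * C'"
      using C C' by (intro add_mono mult_left_mono) auto
    finally show ?thesis .
  qed
  then show "\<exists>C. \<forall>x. \<bar>x\<bar> ^ k * norm (of_real x * nth_deriv n \<phi> x + of_nat n * nth_deriv (n - 1) \<phi> x)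
      \<le> C"
    by blast
qed auto

lemma schwartz_continuous: "\<phi> \<in> schwartz \<Longrightarrow> continuous_on UNIV \<phi>"
  by (intro continuous_at_imp_continuous_on ballI
      has_vector_derivative_continuous[OF schwartz_deriv])

lemma schwartz_measurable: "\<phi> \<in> schwartz \<Longrightarrow> \<phi> \<in> borel_measurable borel"
  by (intro borel_measurable_continuous_onI schwartz_continuous)

text \<open>The integrable weight \<open>inverse (1 + x\<^sup>2)\<close> recurs below as the common
  majorant of test functions.\<close>

lemma schwartz_decay:
  assumes "\<phi> \<in> schwartz"
  shows "\<exists>C\<ge>0. \<forall>x. norm (\<phi> x) \<le> C * inverse (1 + x\<^sup>2)"
proof -
  obtain A where A: "A \<ge> 0" "\<And>x. \<bar>x\<bar> ^ 0 * norm (nth_deriv 0 \<phi> x) \<le> A"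
    using schwartz_bound[OF assms] by blast
  obtain B where B: "B \<ge> 0" "\<And>x. \<bar>x\<bar> ^ 2 * norm (nth_deriv 0 \<phi> x) \<le> B"
    using schwartz_bound[OF assms] by blast
  have "norm (\<phi> x) \<le> (A + B) * inverse (1 + x\<^sup>2)" for x
    using add_mono[OF A(2)[of x] B(2)[of x]]
    by (simp add: add_pos_nonneg field_simps)
  then show ?thesis
    using A(1) B(1) by (intro exI[of _ "A + B"]) auto
qed

lemma integrable_inverse_1_plus_square_UNIV: "integrable lborel (\<lambda>x::real. inverse (1 + x\<^sup>2))"
  using integrable_inverse_1_plus_square by (simp add: set_integrable_def einterval_def)

lemma schwartz_integrable:
  assumes "\<phi> \<in> schwartz"
  shows "integrable lborel \<phi>"
proof -
  obtain C where C: "C \<ge> 0" "\<And>x. norm (\<phi> x) \<le> C * inverse (1 + x\<^sup>2)"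
    using schwartz_decay[OF assms] by blast
  show ?thesis
  proof (rule Bochner_Integration.integrable_bound[of _ "\<lambda>x. C * inverse (1 + x\<^sup>2)"])
    show "AE x in lborel. norm (\<phi> x) \<le> norm (C * inverse (1 + x\<^sup>2))"
      using C order_trans[OF C(2) abs_ge_self] by (intro AE_I2) simp
  qed (use schwartz_measurable[OF assms] integrable_inverse_1_plus_square_UNIV in auto)
qed

lemma schwartz_tendsto:
  assumes "\<phi> \<in> schwartz"
  shows "(\<phi> \<longlongrightarrow> 0) at_top" "(\<phi> \<longlongrightarrow> 0) at_bot"
proof -
  obtain C where C: "\<forall>x. norm (\<phi> x) \<le> C * inverse (1 + x\<^sup>2)"
    using schwartz_decay[OF assms] by blast
  have "((\<lambda>x::real. C * inverse (1 + x\<^sup>2)) \<longlongrightarrow> 0) at_top"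
      "((\<lambda>x::real. C * inverse (1 + x\<^sup>2)) \<longlongrightarrow> 0) at_bot"
    by real_asymp+
  then show "(\<phi> \<longlongrightarrow> 0) at_top" "(\<phi> \<longlongrightarrow> 0) at_bot"
    using Lim_null_comparison[OF always_eventually[OF C]] by blast+
qed

section \<open>Differentiation under the integral sign; the Fourier transform of Schwartz
  functions\<close>

lemma cis_measurable [measurable]: "cis \<in> borel_measurable borel"
  by (intro borel_measurable_continuous_onI continuous_intros)

lemma integrable_cis_mult:
  fixes f :: "'a \<Rightarrow> complex"
  assumes [measurable]: "h \<in> borel_measurable M" and f: "integrable M f"
  shows "integrable M (\<lambda>x. cis (h x) * f x)"
  by (rule Bochner_Integration.integrable_bound[OF f])
     (use borel_measurable_integrable[OF f] in \<open>auto simp: norm_mult\<close>)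

lemma norm_cis_diff_linear: "norm (cis u - 1 - \<i> * of_real u) \<le> u\<^sup>2"
proof -
  have "norm (exp (\<i> * of_real u) - (\<Sum>i\<le>1. (\<i> * of_real u) ^ i / fact i))
      \<le> exp \<bar>Re (\<i> * of_real u)\<bar> * norm (\<i> * complex_of_real u) ^ Suc 1 / fact 1"
    by (rule Taylor_exp[of "\<i> * of_real u" 1, simplified fact_numeral])
  then show ?thesis
    by (simp add: norm_mult cis_conv_exp norm_power power2_eq_square diff_diff_eq)
qed

text \<open>By Taylor's formula the linear approximation of \<open>cis\<close> errs by at most the
  square of the increment, so a finite second moment of \<open>h\<close> against \<open>f\<close>
  bounds the integrated error by a multiple of \<open>(y - t)\<^sup>2\<close>. Used with
  \<open>h = - x\<close> for the Fourier transform and with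
  \<open>h = \<bar>\<xi>\<bar> powr a\<close> for the time derivative of the evolution.\<close>

lemma integral_cis_has_vector_derivative:
  fixes h :: "'a \<Rightarrow> real" and f :: "'a \<Rightarrow> complex"
  assumes h[measurable]: "h \<in> borel_measurable M" and f: "integrable M f"
    and hf: "integrable M (\<lambda>x. of_real (h x) * f x)"
        and hhf: "integrable M (\<lambda>x. of_real (h x) * (of_real (h x) * f x))"
  shows "((\<lambda>t. LINT x|M. cis (t * h x) * f x) has_vector_derivative (LINT x|M. cis (t * h x)
      * (\<i> * (of_real (h x) * f x)))) (at t)"
proof -
  define F where "F t = (LINT x|M. cis (t * h x) * f x)" for t
  define D where "D = (LINT x|M. cis (t * h x) * (\<i> * (of_real (h x) * f x)))"
  define C where "C = (LINT x|M. norm (of_real (h x) * (of_real (h x) * f x)))"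
  have i1: "integrable M (\<lambda>x. cis (y * h x) * f x)" for y
    by (intro integrable_cis_mult f) measurable
  have i2: "integrable M (\<lambda>x. cis (t * h x) * (\<i> * (of_real (h x) * f x)))"
    by (intro integrable_cis_mult integrable_mult_right hf) measurable
  have bound: "norm (F y - F t - (y - t) *\<^sub>R D) \<le> (C * \<bar>y - t\<bar>) * \<bar>y - t\<bar>" for y
  proof -
    have e1: "F y - F t = (LINT x|M. cis (y * h x) * f x - cis (t * h x) * f x)"
      unfolding F_def by (rule Bochner_Integration.integral_diff[symmetric, OF i1 i1])
    have e2: "(y - t) *\<^sub>R D = (LINT x|M. (y - t) *\<^sub>R (cis (t * h x) * (\<i> * (of_real (h x) * f x))))"
      unfolding D_def by (rule integral_scaleR_right[symmetric])
    define d where "d x = cis (y * h x) * f x - cis (t * h x) * f x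
        - (y - t) *\<^sub>R (cis (t * h x) * (\<i> * (of_real (h x) * f x)))" for x
    have d: "integrable M d"
      unfolding d_def[abs_def]
      by (intro Bochner_Integration.integrable_diff i1 integrable_scaleR_right i2)
    have d_le: "norm (d x) \<le> norm (of_real (h x) * (of_real (h x) * f x)) * (y - t)\<^sup>2" for x
    proof -
      define c where "c = cis (t * h x)"
      define r where "r = cis ((y - t) * h x)"
      have "cis (y * h x) = c * r"
        unfolding c_def r_def cis_mult by (simp add: left_diff_distrib)
      then have "d x = c * (r - 1 - \<i> * of_real ((y - t) * h x)) * f x"
        unfolding d_def c_def[symmetric] by (simp add: algebra_simps scaleR_conv_of_real)
      then have "norm (d x) = norm (r - 1 - \<i> * of_real ((y - t) * h x)) * norm (f x)"
        by (simp add: norm_mult c_def)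
      also have "\<dots> \<le> ((y - t) * h x)\<^sup>2 * norm (f x)"
        unfolding r_def by (intro mult_right_mono norm_cis_diff_linear) simp
      also have "\<dots> = norm (of_real (h x) * (of_real (h x) * f x)) * (y - t)\<^sup>2"
      proof -
        have "norm (of_real (h x) * (of_real (h x) * f x)) = (h x)\<^sup>2 * norm (f x)"
          by (simp add: norm_mult power2_eq_square flip: mult.assoc)
        then show ?thesis
          by (simp add: power_mult_distrib)
      qed
      finally show ?thesis .
    qed
    have "F y - F t - (y - t) *\<^sub>R D = (LINT x|M. d x)"
      unfolding e1 e2 d_def
      by (intro Bochner_Integration.integral_diff[symmetric] Bochner_Integration.integrable_diff i1
          integrable_scaleR_right i2)
    then have "norm (F y - F t - (y - t) *\<^sub>R D) \<le> (LINT x|M. norm (d x))"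
      by simp
    also have "\<dots> \<le> (LINT x|M. norm (of_real (h x) * (of_real (h x) * f x)) * (y - t)\<^sup>2)"
      using d hhf d_le by (intro integral_mono) auto
    also have "\<dots> = C * (y - t)\<^sup>2"
      unfolding C_def by simp
    also have "(y - t)\<^sup>2 = \<bar>y - t\<bar> * \<bar>y - t\<bar>"
      by (simp add: power2_eq_square)
    finally show ?thesis
      by (simp add: mult.assoc)
  qed
  have "((\<lambda>y. (F y - F t - (y - t) *\<^sub>R D) /\<^sub>R norm (y - t)) \<longlongrightarrow> 0) (at t)"
  proof (rule Lim_null_comparison)
    show "\<forall>\<^sub>F y in at t. norm ((F y - F t - (y - t) *\<^sub>R D) /\<^sub>R norm (y - t)) \<le> C * \<bar>y - t\<bar>"
      unfolding eventually_at_filter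
    proof (intro always_eventually allI impI)
      fix y :: real assume "y \<noteq> t"
      then show "norm ((F y - F t - (y - t) *\<^sub>R D) /\<^sub>R norm (y - t)) \<le> C * \<bar>y - t\<bar>"
        using bound[of y] by (simp add: divide_simps mult.commute)
    qed
    have "((\<lambda>y. C * \<bar>y - t\<bar>) \<longlongrightarrow> C * \<bar>t - t\<bar>) (at t)"
      by (intro tendsto_intros)
    then show "((\<lambda>y. C * \<bar>y - t\<bar>) \<longlongrightarrow> 0) (at t)" by simp
  qed
  then show ?thesis
    unfolding has_vector_derivative_def has_derivative_at_within F_def[symmetric] D_def[symmetric]
    by (simp add: bounded_linear_scaleR_left algebra_simps)
qed

lemma fourier_has_vector_derivative:
  assumes int: "integrable lborel \<phi>" "integrable lborel (\<lambda>x. of_real x * \<phi> x)"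
    "integrable lborel (\<lambda>x. of_real x * (of_real x * \<phi> x))"
  shows "(fourier \<phi> has_vector_derivative fourier (\<lambda>x. - \<i> * (of_real x * \<phi> x)) \<xi>) (at \<xi>)"
proof -
  have F: "fourier \<psi> = (\<lambda>t. LINT x|lborel. cis (t * - x) * \<psi> x)" for \<psi>
    by (simp add: fourier_def[abs_def] mult.commute)
  have "((\<lambda>t. LINT x|lborel. cis (t * - x) * \<phi> x) has_vector_derivative
      (LINT x|lborel. cis (\<xi> * - x) * (\<i> * (of_real (- x) * \<phi> x)))) (at \<xi>)"
    by (rule integral_cis_has_vector_derivative) (use int in simp_all)
  then show ?thesis
    by (simp add: F)
qed

text \<open>Takes the place of integration by parts: \<open>F\<close> will be an exponential times a
  Schwartz function, which vanishes at infinity.\<close>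

lemma integral_deriv_eq_0:
  fixes F :: "real \<Rightarrow> complex"
  assumes F: "\<And>x. (F has_vector_derivative f x) (at x)" and cont: "continuous_on UNIV f"
    and int: "integrable lborel f" and lim: "(F \<longlongrightarrow> 0) at_top" "(F \<longlongrightarrow> 0) at_bot"
  shows "(LINT x|lborel. f x) = 0"
proof -
  have "interval_lebesgue_integral lborel (-\<infinity>) \<infinity> f = 0 - 0"
  proof (rule interval_integral_FTC_integrable)
    show "((F \<circ> real_of_ereal) \<longlongrightarrow> 0) (at_right (-\<infinity>))" "((F \<circ> real_of_ereal) \<longlongrightarrow> 0) (at_left \<infinity>)"
      using lim by (simp_all add: ereal_tendsto_simps1)
    show "isCont f x" for x
      using cont by (simp add: continuous_on_eq_continuous_at)
  qed (use F int in \<open>auto simp: set_integrable_def einterval_def\<close>)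
  then show ?thesis
    by (simp add: interval_lebesgue_integral_def einterval_def set_lebesgue_integral_def)
qed

lemma has_vector_derivative_cis [derivative_intros]:
  assumes "(f has_vector_derivative f') (at x within A)"
  shows "((\<lambda>x. cis (f x)) has_vector_derivative f' *\<^sub>R (\<i> * cis (f x))) (at x within A)"
  using has_derivative_cis[OF assms[unfolded has_vector_derivative_def]]
  unfolding has_vector_derivative_def by simp

lemma fourier_nth_deriv:
  assumes "\<phi> \<in> schwartz"
  shows "fourier (nth_deriv 1 \<phi>) \<xi> = \<i> * of_real \<xi> * fourier \<phi> \<xi>"
proof -
  have i: "integrable lborel (\<lambda>x. cis (- (x * \<xi>)) * nth_deriv 1 \<phi> x)"
          "integrable lborel (\<lambda>x. cis (- (x * \<xi>)) * \<phi> x)"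
    by (intro integrable_cis_mult schwartz_integrable schwartz_nth_deriv assms; simp)+
  have "(LINT x|lborel. cis (- (x * \<xi>)) * nth_deriv 1 \<phi> x - \<i> * of_real \<xi> * (cis (- (x * \<xi>)) * \<phi> x))
      = 0"
  proof (rule integral_deriv_eq_0[where F = "\<lambda>x. cis (- (x * \<xi>)) * \<phi> x"])
    show "((\<lambda>x. cis (- (x * \<xi>)) * \<phi> x) has_vector_derivative
        cis (- (x * \<xi>)) * nth_deriv 1 \<phi> x - \<i> * of_real \<xi> * (cis (- (x * \<xi>)) * \<phi> x)) (at x)" for x
      by (rule derivative_eq_intros schwartz_deriv[OF assms] refl)+
         (simp add: scaleR_conv_of_real algebra_simps)
    show "continuous_on UNIV (\<lambda>x. cis (- (x * \<xi>)) * nth_deriv 1 \<phi> x - \<i> * of_real \<xi>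
        * (cis (- (x * \<xi>)) * \<phi> x))"
      by (intro continuous_intros schwartz_continuous schwartz_nth_deriv assms)
    show "integrable lborel (\<lambda>x. cis (- (x * \<xi>)) * nth_deriv 1 \<phi> x - \<i> * of_real \<xi>
        * (cis (- (x * \<xi>)) * \<phi> x))"
      using i by auto
    show "((\<lambda>x. cis (- (x * \<xi>)) * \<phi> x) \<longlongrightarrow> 0) at_top" "((\<lambda>x. cis (- (x * \<xi>)) * \<phi> x) \<longlongrightarrow> 0) at_bot"
      by (rule tendsto_norm_zero_cancel, simp add: norm_mult tendsto_norm_zero
          schwartz_tendsto[OF assms])+
  qed
  then show ?thesis
    using i by (simp add: fourier_def)
qed

lemma norm_fourier_le:
  "norm (fourier \<phi> \<xi>) \<le> (LINT x|lborel. norm (\<phi> x))"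
  unfolding fourier_def by (rule order_trans[OF integral_norm_bound]) (simp add: norm_mult)

lemma fourier_nth_deriv_n:
  assumes "\<phi> \<in> schwartz"
  shows "fourier (nth_deriv k \<phi>) \<xi> = (\<i> * of_real \<xi>) ^ k * fourier \<phi> \<xi>"
proof (induction k)
  case (Suc k)
  have "nth_deriv (Suc k) \<phi> = nth_deriv 1 (nth_deriv k \<phi>)"
    by (simp add: nth_deriv_nth_deriv)
  then show ?case
    using Suc fourier_nth_deriv[OF schwartz_nth_deriv[OF assms, of k], of \<xi>] by simp
qed simp

text \<open>Differentiating the transform multiplies the function by \<open>- \<i> x\<close>, which
  stays in \<open>schwartz\<close>. Powers of the frequency correspond to derivatives of the
  function, so each seminorm is bounded by an L1 norm.\<close>

lemma schwartz_fourier: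
  assumes "\<phi> \<in> schwartz"
  shows "fourier \<phi> \<in> schwartz"
proof -
  define \<Psi> where "\<Psi> n = ((\<lambda>\<psi> x. - \<i> * (of_real x * \<psi> x)) ^^ n) \<phi>" for n
  have S: "\<Psi> n \<in> schwartz" for n
    using schwartz_cmult[OF schwartz_mult_x, of _ "- \<i>"]
    by (induction n) (simp_all add: \<Psi>_def assms)
  have S1: "(\<lambda>x. - \<i> * (of_real x * \<Psi> n x)) = \<Psi> (Suc n)" for n
    by (simp add: \<Psi>_def)
  show ?thesis
  proof (rule schwartzI(1)[where D = "\<lambda>n. fourier (\<Psi> n)"])
    show "(fourier (\<Psi> n) has_vector_derivative fourier (\<Psi> (Suc n)) x) (at x)" for n x
      unfolding S1[symmetric]
      by (intro fourier_has_vector_derivative schwartz_integrable schwartz_mult_x S)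
    show "\<exists>C. \<forall>x. \<bar>x\<bar> ^ k * norm (fourier (\<Psi> n) x) \<le> C" for k n
    proof (intro exI allI)
      show "\<bar>x\<bar> ^ k * norm (fourier (\<Psi> n) x) \<le> (LINT x|lborel. norm (nth_deriv k (\<Psi> n) x))" for x
        using norm_fourier_le[of "nth_deriv k (\<Psi> n)" x]
        by (simp add: fourier_nth_deriv_n[OF S] norm_mult norm_power)
    qed
  qed (simp add: \<Psi>_def)
qed

lemma inv_fourier_eq: "inv_fourier \<phi> = (\<lambda>x. 1 / (2 * of_real pi) * fourier \<phi> (- x))"
proof -
  have "(\<lambda>\<xi>. cis (x * \<xi>) * \<phi> \<xi>) = (\<lambda>\<xi>. cis (- (\<xi> * - x)) * \<phi> \<xi>)" for x
    by (simp add: mult.commute)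
  then show ?thesis
    unfolding inv_fourier_def fourier_def by presburger
qed

lemma schwartz_inv_fourier: "\<phi> \<in> schwartz \<Longrightarrow> inv_fourier \<phi> \<in> schwartz"
  unfolding inv_fourier_eq by (intro schwartz_cmult schwartz_uminus_arg schwartz_fourier)

text \<open>Justifies the exchanges of integrals below: the oscillating kernels are bounded, and a
  product of integrable functions of separate variables is integrable on the product space.\<close>

lemma (in pair_sigma_finite) integrable_bounded_kernel:
  fixes u :: "'a \<Rightarrow> complex" and v :: "'b \<Rightarrow> complex"
  assumes u: "integrable M1 u" and v: "integrable M2 v"
    and k[measurable]: "case_prod k \<in> borel_measurable (M1 \<Otimes>\<^sub>M M2)" and B: "\<And>x y. norm (k x y) \<le> B"
  shows "integrable (M1 \<Otimes>\<^sub>M M2) (\<lambda>(x, y). k x y * (u x * v y))"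
proof -
  have [measurable]: "u \<in> borel_measurable M1" "v \<in> borel_measurable M2"
    using u v by auto
  have k': "(\<lambda>x. k (fst x) (snd x)) \<in> borel_measurable (M1 \<Otimes>\<^sub>M M2)"
    using k by (simp add: case_prod_beta)
  have *: "integrable (M1 \<Otimes>\<^sub>M M2) (\<lambda>p. u (fst p) * v (snd p))"
  proof (rule Fubini_integrable)
    show "integrable M1 (\<lambda>x. \<integral>y. norm (u (fst (x, y)) * v (snd (x, y))) \<partial>M2)"
      using u by (simp add: norm_mult)
    show "AE x in M1. integrable M2 (\<lambda>y. u (fst (x, y)) * v (snd (x, y)))"
      using v by simp
  qed measurable
  show ?thesis
  proof (rule Bochner_Integration.integrable_bound[OF integrable_mult_right[OF *, of "of_real B"]])
    show "(\<lambda>(x, y). k x y * (u x * v y)) \<in> borel_measurable (M1 \<Otimes>\<^sub>M M2)"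
      using k' by (simp add: case_prod_beta)
    show "AE p in M1 \<Otimes>\<^sub>M M2. norm (case p of (x, y) \<Rightarrow> k x y * (u x * v y))
        \<le> norm (of_real B * (u (fst p) * v (snd p)))"
      using order_trans[OF B abs_ge_self]
      by (intro AE_I2) (auto simp: norm_mult mult_right_mono split: prod.split)
  qed
qed

section \<open>Gaussian regularization and Fourier inversion\<close>

definition gauss :: "real \<Rightarrow> real" where "gauss x = exp (- x\<^sup>2 / 2)"

lemma gauss_eq: "gauss x = sqrt (2 * pi) * std_normal_density x"
  by (simp add: gauss_def std_normal_density_def)

lemma gauss_0 [simp]: "gauss 0 = 1" and gauss_pos [simp]: "gauss x > 0"
    and gauss_nonneg [simp]: "gauss x \<ge> 0"
  and gauss_le_1 [simp]: "gauss x \<le> 1"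
      and gauss_measurable [measurable]: "gauss \<in> borel_measurable borel"
  and isCont_gauss: "isCont gauss x"
  by (auto simp: gauss_def[abs_def])

lemma integrable_gauss [simp]: "integrable lborel gauss"
  unfolding gauss_eq[abs_def] by simp

lemma integral_gauss: "(LINT x|lborel. gauss x) = sqrt (2 * pi)"
  unfolding gauss_eq by (simp add: prob_space_normal_density)

text \<open>Read off from the characteristic function of the standard normal distribution.\<close>

lemma integral_cis_gauss:
    "(LINT x|lborel. cis (t * x) * of_real (gauss x)) = of_real (sqrt (2 * pi) * gauss t)"
proof -
  have "char std_normal_distribution t = (LINT x|lborel. std_normal_density x *\<^sub>R cis (t * x))"
    unfolding char_def by (subst integral_density) (auto simp: cis_conv_exp)
  also have "(LINT x|lborel. cis (t * x) * of_real (gauss x))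
      = of_real (sqrt (2 * pi)) * (LINT x|lborel. std_normal_density x *\<^sub>R cis (t * x))"
    by (subst integral_mult_right_zero[symmetric])
       (simp add: gauss_eq scaleR_conv_of_real mult.assoc mult.commute mult.left_commute)
  finally show ?thesis
    by (simp add: char_std_normal_distribution gauss_def)
qed

lemma integral_cis_gauss_scaled:
  assumes "\<epsilon> > 0"
  shows "(LINT x|lborel. cis (t * x) * of_real (gauss (\<epsilon> * x)))
      = of_real (sqrt (2 * pi) / \<epsilon> * gauss (t / \<epsilon>))"
proof -
  have "(LINT x|lborel. cis (t * x) * of_real (gauss (\<epsilon> * x)))
      = (1 / \<epsilon>) *\<^sub>R (LINT x|lborel. cis (t / \<epsilon> * x) * of_real (gauss x))"
    using lborel_integral_real_affine[of "1 / \<epsilon>"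
        "\<lambda>x. cis (t * x) * of_real (gauss (\<epsilon> * x))" 0] assms by simp
  then show ?thesis
    using assms integral_cis_gauss[of "t / \<epsilon>"] by (simp add: scaleR_conv_of_real)
qed

text \<open>The double integral behind Fourier inversion does not converge absolutely. The factor
  \<open>gauss (\<epsilon> * \<xi>)\<close> repairs this, and after the exchange its transform
  concentrates near \<open>y = x\<close>. The substitution \<open>y = x - \<epsilon> * z\<close>
  moves the parameter into the argument of \<open>\<phi>\<close>.\<close>

lemma gauss_regularized_inversion:
  assumes \<phi>: "integrable lborel \<phi>" and \<epsilon>: "\<epsilon> > 0"
  shows "(LINT \<xi>|lborel. of_real (gauss (\<epsilon> * \<xi>)) * (cis (x * \<xi>) * fourier \<phi> \<xi>))
       = of_real (sqrt (2 * pi)) * (LINT z|lborel. of_real (gauss z) * \<phi> (x - \<epsilon> * z))"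
proof -
  have [measurable]: "\<phi> \<in> borel_measurable borel"
    using borel_measurable_integrable[OF \<phi>] by simp
  have g: "integrable lborel (\<lambda>\<xi>. complex_of_real (gauss (\<epsilon> * \<xi>)))"
    using lborel_integrable_real_affine[of gauss \<epsilon> 0] \<epsilon> by simp
  have "(LINT \<xi>|lborel. of_real (gauss (\<epsilon> * \<xi>)) * (cis (x * \<xi>) * fourier \<phi> \<xi>))
      = (LINT \<xi>|lborel. (LINT y|lborel. cis ((x - y) * \<xi>) * (of_real (gauss (\<epsilon> * \<xi>)) * \<phi> y)))"
  proof (rule Bochner_Integration.integral_cong[OF refl])
    fix \<xi>
    have "of_real (gauss (\<epsilon> * \<xi>)) * (cis (x * \<xi>) * fourier \<phi> \<xi>)
        = (LINT y|lborel. of_real (gauss (\<epsilon> * \<xi>)) * (cis (x * \<xi>) * (cis (- (y * \<xi>)) * \<phi> y)))"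
      unfolding fourier_def by simp
    also have "\<dots> = (LINT y|lborel. cis ((x - y) * \<xi>) * (of_real (gauss (\<epsilon> * \<xi>)) * \<phi> y))"
    proof (rule Bochner_Integration.integral_cong[OF refl])
      fix y
      have "cis ((x - y) * \<xi>) = cis (x * \<xi>) * cis (- (y * \<xi>))"
        by (simp add: cis_mult algebra_simps)
      then show "of_real (gauss (\<epsilon> * \<xi>)) * (cis (x * \<xi>) * (cis (- (y * \<xi>)) * \<phi> y))
          = cis ((x - y) * \<xi>) * (of_real (gauss (\<epsilon> * \<xi>)) * \<phi> y)"
        by (simp only: mult_ac)
    qed
    finally show "of_real (gauss (\<epsilon> * \<xi>)) * (cis (x * \<xi>) * fourier \<phi> \<xi>)
        = (LINT y|lborel. cis ((x - y) * \<xi>) * (of_real (gauss (\<epsilon> * \<xi>)) * \<phi> y))" .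
  qed
  also have "\<dots> = (LINT y|lborel. (LINT \<xi>|lborel. cis ((x - y) * \<xi>)
      * (of_real (gauss (\<epsilon> * \<xi>)) * \<phi> y)))"
    by (rule lborel_pair.Fubini_integral[symmetric], rule
        lborel_pair.integrable_bounded_kernel[OF g \<phi>, where B = 1]) auto
  also have "\<dots> = (LINT y|lborel. of_real (sqrt (2 * pi) / \<epsilon> * gauss ((x - y) / \<epsilon>)) * \<phi> y)"
    by (simp add: integral_cis_gauss_scaled[OF \<epsilon>] mult.assoc[symmetric] del: of_real_mult
        of_real_divide)
  also have "\<dots> = \<epsilon> *\<^sub>R (LINT z|lborel. of_real (sqrt (2 * pi) / \<epsilon> * gauss z) * \<phi> (x - \<epsilon> * z))"
    using lborel_integral_real_affine[of "- \<epsilon>"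
        "\<lambda>y. of_real (sqrt (2 * pi) / \<epsilon> * gauss ((x - y) / \<epsilon>)) * \<phi> y" x] \<epsilon>
    by simp
  also have "\<dots> = of_real (sqrt (2 * pi)) * (LINT z|lborel. of_real (gauss z) * \<phi> (x - \<epsilon> * z))"
  proof -
    have eq: "of_real (sqrt (2 * pi) / \<epsilon> * gauss z) * \<phi> (x - \<epsilon> * z)
        = of_real (sqrt (2 * pi) / \<epsilon>) * (of_real (gauss z) * \<phi> (x - \<epsilon> * z))" for z
      by (simp add: mult.assoc)
    show ?thesis
      unfolding eq integral_mult_right_zero using \<epsilon> by (simp add: scaleR_conv_of_real)
  qed
  finally show ?thesis .
qed

text \<open>Both sides of the regularized formula pass to the limit \<epsilon> = 1/(n+1) by
  dominated convergence. The factor \<open>2 * pi\<close> arises as a square: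
  \<open>sqrt (2 * pi)\<close> from the transform of the Gaussian and once more from its total
  mass.\<close>

lemma fourier_inversion:
  assumes \<phi>: "\<phi> \<in> schwartz"
  shows "(LINT \<xi>|lborel. cis (x * \<xi>) * fourier \<phi> \<xi>) = 2 * of_real pi * \<phi> x"
proof -
  have int: "integrable lborel \<phi>" "integrable lborel (fourier \<phi>)"
    by (intro schwartz_integrable schwartz_fourier \<phi>)+
  have [measurable]: "\<phi> \<in> borel_measurable borel" "fourier \<phi> \<in> borel_measurable borel"
    by (intro schwartz_measurable schwartz_fourier \<phi>)+
  obtain C where C: "\<And>x. norm (\<phi> x) \<le> C"
    using schwartz_bound[OF \<phi>, of 0 0] by auto
  have isC: "isCont \<phi> y" for y
    using schwartz_continuous[OF \<phi>] by (simp add: continuous_on_eq_continuous_at)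
  let ?e = "\<lambda>n. inverse (real (Suc n))"
  have e0: "?e \<longlonglongrightarrow> 0"
    by (rule LIMSEQ_inverse_real_of_nat)
  have "(\<lambda>n. LINT \<xi>|lborel. of_real (gauss (?e n * \<xi>)) * (cis (x * \<xi>) * fourier \<phi> \<xi>))
      \<longlonglongrightarrow> (LINT \<xi>|lborel. cis (x * \<xi>) * fourier \<phi> \<xi>)"
  proof (rule integral_dominated_convergence[where w = "\<lambda>\<xi>. norm (fourier \<phi> \<xi>)"])
    show "AE \<xi> in lborel. (\<lambda>n. of_real (gauss (?e n * \<xi>)) * (cis (x * \<xi>) * fourier \<phi> \<xi>))
        \<longlonglongrightarrow> cis (x * \<xi>) * fourier \<phi> \<xi>"
    proof (rule AE_I2)
      fix \<xi>
      have "(\<lambda>n. gauss (?e n * \<xi>)) \<longlonglongrightarrow> gauss (0 * \<xi>)"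
        by (intro isCont_tendsto_compose[OF isCont_gauss] tendsto_intros e0)
      then have "(\<lambda>n. of_real (gauss (?e n * \<xi>)) * (cis (x * \<xi>) * fourier \<phi> \<xi>))
        \<longlonglongrightarrow> of_real (gauss (0 * \<xi>)) * (cis (x * \<xi>) * fourier \<phi> \<xi>)"
        by (intro tendsto_intros)
      then show "(\<lambda>n. of_real (gauss (?e n * \<xi>)) * (cis (x * \<xi>) * fourier \<phi> \<xi>))
        \<longlonglongrightarrow> cis (x * \<xi>) * fourier \<phi> \<xi>"
        by simp
    qed
    show "AE \<xi> in lborel. norm (of_real (gauss (?e n * \<xi>)) * (cis (x * \<xi>) * fourier \<phi> \<xi>))
        \<le> norm (fourier \<phi> \<xi>)" for n
      by (intro AE_I2) (simp add: norm_mult mult_left_le_one_le)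
  qed (use int(2) in auto)
  moreover have "(\<lambda>n. LINT z|lborel. of_real (gauss z) * \<phi> (x - ?e n * z))
      \<longlonglongrightarrow> (LINT z|lborel. of_real (gauss z) * \<phi> x)"
  proof (rule integral_dominated_convergence[where w = "\<lambda>z. gauss z * C"])
    show "AE z in lborel. (\<lambda>n. of_real (gauss z) * \<phi> (x - ?e n * z)) \<longlonglongrightarrow> of_real (gauss z) * \<phi> x"
    proof (rule AE_I2)
      fix z
      have "(\<lambda>n. \<phi> (x - ?e n * z)) \<longlonglongrightarrow> \<phi> (x - 0 * z)"
        by (intro isCont_tendsto_compose[OF isC] tendsto_intros e0)
      then show "(\<lambda>n. of_real (gauss z) * \<phi> (x - ?e n * z)) \<longlonglongrightarrow> of_real (gauss z) * \<phi> x"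
        by (intro tendsto_intros) simp
    qed
    show "AE z in lborel. norm (of_real (gauss z) * \<phi> (x - ?e n * z)) \<le> gauss z * C" for n
      by (intro AE_I2) (simp add: norm_mult mult_left_mono C)
  qed auto
  then have "(\<lambda>n. of_real (sqrt (2 * pi)) * (LINT z|lborel. of_real (gauss z) * \<phi> (x - ?e n * z)))
      \<longlonglongrightarrow> of_real (sqrt (2 * pi)) * (LINT z|lborel. of_real (gauss z) * \<phi> x)"
    by (intro tendsto_intros)
  ultimately have "(LINT \<xi>|lborel. cis (x * \<xi>) * fourier \<phi> \<xi>)
      = of_real (sqrt (2 * pi)) * (LINT z|lborel. of_real (gauss z) * \<phi> x)"
    by (subst (asm) gauss_regularized_inversion[OF int(1)]) (auto intro: LIMSEQ_unique)
  also have "\<dots> = of_real (sqrt (2 * pi) * sqrt (2 * pi)) * \<phi> x"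
    by (simp add: integral_gauss del: real_sqrt_mult_self)
  finally show ?thesis
    by simp
qed

lemma inv_fourier_fourier: "\<phi> \<in> schwartz \<Longrightarrow> inv_fourier (fourier \<phi>) = \<phi>"
  by (rule ext) (simp add: inv_fourier_def fourier_inversion)

lemma fourier_inv_fourier:
  assumes "\<phi> \<in> schwartz"
  shows "fourier (inv_fourier \<phi>) = \<phi>"
proof
  fix \<xi>
  have "fourier (inv_fourier \<phi>) \<xi>
      = (LINT x|lborel. cis (- (x * \<xi>)) * (1 / (2 * of_real pi) * fourier \<phi> (- x)))"
    unfolding inv_fourier_eq fourier_def[of "\<lambda>x. _ x"] by simp
  also have "\<dots> = (LINT x|lborel. 1 / (2 * of_real pi) * (cis (\<xi> * x) * fourier \<phi> x))"
    using lborel_integral_real_affine[of "- 1"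
        "\<lambda>x. cis (- (x * \<xi>)) * (1 / (2 * of_real pi) * fourier \<phi> (- x))" 0]
    by (simp add: mult.commute mult.left_commute)
  also have "\<dots> = \<phi> \<xi>"
    by (subst integral_mult_right_zero) (simp add: fourier_inversion[OF assms])
  finally show "fourier (inv_fourier \<phi>) \<xi> = \<phi> \<xi>" .
qed

section \<open>Uniqueness of the representing function\<close>

lemma power_le_fact_exp:
  fixes y :: real
  assumes "y \<ge> 0"
  shows "y ^ m \<le> fact m * exp y"
proof -
  have "y ^ m /\<^sub>R fact m \<le> (\<Sum>n. y ^ n /\<^sub>R fact n)"
    using sum_le_suminf[of "\<lambda>n. y ^ n /\<^sub>R fact n" "{m}"] assms summable_exp_generic[of y] by simp
  then show ?thesis
    by (simp add: exp_def field_simps)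
qed

text \<open>Supplies the modulated Gaussians that test uniqueness. Each derivative is a polynomial
  times the function itself; \<open>p\<close> is the recursion for these polynomials.\<close>

lemma exp_quadratic_schwartz:
  assumes c: "c > 0"
  shows "(\<lambda>x. exp (- of_real c * of_real x ^ 2 + z * of_real x)) \<in> schwartz"
proof -
  define e where "e x = exp (- of_real c * of_real x ^ 2 + z * of_real x)" for x :: real
  define p where "p n = ((\<lambda>p. pderiv p + [:z, - 2 * of_real c:] * p) ^^ n) 1" for n
  have pS: "p (Suc n) = pderiv (p n) + [:z, - 2 * of_real c:] * p n" and p0: "p 0 = 1" for n
    by (simp_all add: p_def)
  have de: "(e has_vector_derivative (z - 2 * of_real c * of_real x) * e x) (at x)" for x
    unfolding e_def[abs_def]
    by (rule has_vector_derivative_real_field)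
        (auto intro!: derivative_eq_intros simp: algebra_simps)
  have dp: "((\<lambda>x. poly q (of_real x)) has_vector_derivative poly (pderiv q) (of_real x)) (at x)"
      for q :: "complex poly" and x
    by (rule has_vector_derivative_real_field[OF poly_DERIV])
  \<comment> \<open>The maximum of \<open>(\<bar>Re z\<bar> + 1) * r - c * r\<^sup>2\<close> over
    \<open>r\<close>. Completing the square thus leaves the factor
    \<open>exp (- \<bar>x\<bar>)\<close>, which absorbs any power of \<open>x\<close>.\<close>
  define M where "M = (\<bar>Re z\<bar> + 1)\<^sup>2 / (4 * c)"
  have exp_le: "norm (e x) \<le> exp (M - \<bar>x\<bar>)" for x
  proof -
    have "0 \<le> (2 * c * \<bar>x\<bar> - (\<bar>Re z\<bar> + 1))\<^sup>2 / (4 * c)"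
      using c by simp
    also have "\<dots> = c * x\<^sup>2 - \<bar>Re z\<bar> * \<bar>x\<bar> - \<bar>x\<bar> + M"
      using c by (simp add: M_def power2_diff power_mult_distrib field_simps power2_eq_square)
    finally have "- c * x\<^sup>2 + Re z * x \<le> M - \<bar>x\<bar>"
      using abs_ge_self[of "Re z * x"] by (simp add: abs_mult)
    moreover have "norm (e x) = exp (- c * x\<^sup>2 + Re z * x)"
      by (simp add: e_def norm_exp_eq_Re flip: of_real_power)
    ultimately show ?thesis by simp
  qed
  have mono: "\<bar>x\<bar> ^ m * norm (e x) \<le> fact m * exp M" for m x
  proof -
    have "\<bar>x\<bar> ^ m * norm (e x) \<le> (fact m * exp \<bar>x\<bar>) * exp (M - \<bar>x\<bar>)"
      by (intro mult_mono power_le_fact_exp exp_le) auto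
    then show ?thesis
      by (simp add: exp_diff)
  qed
  have bound: "\<exists>C. \<forall>x. \<bar>x\<bar> ^ k * norm (poly q (of_real x) * e x) \<le> C" for k and q :: "complex poly"
  proof (intro exI allI)
    fix x
    have "\<bar>x\<bar> ^ k * norm (poly q (of_real x) * e x)
        \<le> \<bar>x\<bar> ^ k * ((\<Sum>i\<le>degree q. norm (coeff q i) * \<bar>x\<bar> ^ i) * norm (e x))"
      unfolding norm_mult poly_altdef
      by (intro mult_left_mono mult_right_mono sum_norm_le) (auto simp: norm_mult norm_power)
    also have "\<dots> = (\<Sum>i\<le>degree q. norm (coeff q i) * (\<bar>x\<bar> ^ (k + i) * norm (e x)))"
      by (simp add: sum_distrib_left sum_distrib_right power_add algebra_simps)
    also have "\<dots> \<le> (\<Sum>i\<le>degree q. norm (coeff q i) * (fact (k + i) * exp M))"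
      by (intro sum_mono mult_left_mono mono) auto
    finally show "\<bar>x\<bar> ^ k * norm (poly q (of_real x) * e x)
        \<le> (\<Sum>i\<le>degree q. norm (coeff q i) * (fact (k + i) * exp M))" .
  qed
  have "e \<in> schwartz"
  proof (rule schwartzI(1)[where D = "\<lambda>n x. poly (p n) (of_real x) * e x"])
    show "((\<lambda>x. poly (p n) (of_real x) * e x) has_vector_derivative poly (p (Suc n)) (of_real x)
        * e x) (at x)" for n x
      by (rule has_vector_derivative_eq_rhs[OF has_vector_derivative_mult[OF dp de]])
         (simp add: pS algebra_simps)
  qed (use bound in \<open>auto simp: p0\<close>)
  then show ?thesis
    by (simp add: e_def[abs_def])
qed

text \<open>If \<open>k\<close> is not null, the normalized positive and negative parts of \<open>k\<close> are the densities of
  probability measures with the same characteristic function.\<close>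

lemma real_fourier_zero_imp_zero:
  fixes k :: "real \<Rightarrow> real"
  assumes k: "integrable lborel k" and zero: "\<And>t. (LINT x|lborel. cis (t * x) * of_real (k x)) = 0"
  shows "AE x in lborel. k x = 0"
proof -
  define P where "P x = max 0 (k x)" for x
  define Q where "Q x = max 0 (- k x)" for x
  define m where "m = (LINT x|lborel. P x)"
  have P: "integrable lborel P" and Q: "integrable lborel Q"
    using k by (auto simp: P_def[abs_def] Q_def[abs_def])
  have [measurable]: "P \<in> borel_measurable borel" "Q \<in> borel_measurable borel"
    using P Q by (auto dest: borel_measurable_integrable)
  have PQ: "P x - Q x = k x" "P x \<ge> 0" "Q x \<ge> 0" for x
    by (auto simp: P_def Q_def)
  have "(LINT x|lborel. P x) - (LINT x|lborel. Q x) = (LINT x|lborel. k x)"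
    using P Q by (simp add: PQ flip: Bochner_Integration.integral_diff)
  also have "(LINT x|lborel. k x) = 0"
    using zero[of 0] by simp
  finally have mQ: "m = (LINT x|lborel. Q x)"
    by (simp add: m_def)
  show ?thesis
  proof (cases "m = 0")
    case True
    then have "AE x in lborel. P x = 0" "AE x in lborel. Q x = 0"
      using integral_nonneg_eq_0_iff_AE[OF P] integral_nonneg_eq_0_iff_AE[OF Q] PQ mQ m_def by auto
    then show ?thesis
    proof eventually_elim
      case (elim x)
      then show ?case
        using PQ(1)[of x] by simp
    qed
  next
    case False
    then have m: "m > 0"
      using PQ by (simp add: m_def less_le integral_nonneg_AE)
    have *: "real_distribution (density lborel (\<lambda>x. ennreal (R x / m)))
        \<and> char (density lborel (\<lambda>x. ennreal (R x / m))) t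
            = (LINT x|lborel. cis (t * x) * of_real (R x)) / of_real m"
      if R: "integrable lborel R" "\<And>x. R x \<ge> 0" "(LINT x|lborel. R x) = m" for R t
    proof -
      have [measurable]: "R \<in> borel_measurable borel"
        using R by (auto dest: borel_measurable_integrable)
      have "emeasure (density lborel (\<lambda>x. ennreal (R x / m))) UNIV
          = (\<integral>\<^sup>+x. ennreal (R x / m) \<partial>lborel)"
        by (simp add: emeasure_density)
      also have "\<dots> = ennreal (LINT x|lborel. R x / m)"
        using R m by (intro nn_integral_eq_integral) auto
      also have "\<dots> = 1"
        using R m by simp
      finally have "real_distribution (density lborel (\<lambda>x. ennreal (R x / m)))"
        by (auto simp: real_distribution_def real_distribution_axioms_def intro!: prob_spaceI)
      moreover have "char (density lborel (\<lambda>x. ennreal (R x / m))) t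
          = (LINT x|lborel. (R x / m) *\<^sub>R cis (t * x))"
        unfolding char_def using m R by (subst integral_density) (auto simp: cis_conv_exp)
      moreover have "\<dots> = (LINT x|lborel. (cis (t * x) * of_real (R x)) / of_real m)"
        by (intro Bochner_Integration.integral_cong) (auto simp: scaleR_conv_of_real)
      ultimately show ?thesis
        by simp
    qed
    have "(LINT x|lborel. cis (t * x) * of_real (P x)) - (LINT x|lborel. cis (t * x)
        * of_real (Q x))
        = (LINT x|lborel. cis (t * x) * of_real (k x))" for t
      using P Q by (subst Bochner_Integration.integral_diff[symmetric])
         (auto simp flip: right_diff_distrib of_real_diff simp: PQ intro!: integrable_cis_mult)
    then have "char (density lborel (\<lambda>x. ennreal (P x / m)))
        = char (density lborel (\<lambda>x. ennreal (Q x / m)))"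
      using *[OF P PQ(2)] *[OF Q PQ(3)] zero mQ m_def by (intro ext) auto
    then have "density lborel (\<lambda>x. ennreal (P x / m)) = density lborel (\<lambda>x. ennreal (Q x / m))"
      using *[OF P PQ(2)] *[OF Q PQ(3)] mQ m_def by (intro Levy_uniqueness) auto
    then have "AE x in lborel. ennreal (P x / m) = ennreal (Q x / m)"
      by (intro sigma_finite_measure.density_unique[OF lborel.sigma_finite_measure_axioms]) auto
    then show ?thesis
    proof eventually_elim
      case (elim x)
      then have "P x = Q x"
        using m PQ by (auto simp: ennreal_inj)
      then show ?case
        using PQ(1)[of x] by simp
    qed
  qed
qed

text \<open>The real and imaginary parts can be treated separately because the transform of
  \<open>cnj k\<close> is a reflected conjugate of that of \<open>k\<close> and hence vanishes as
  well.\<close>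

lemma fourier_zero_imp_zero:
  assumes k: "integrable lborel k" and zero: "\<And>t. fourier k t = 0"
  shows "AE x in lborel. k x = 0"
proof -
  have i: "integrable lborel (\<lambda>x. cis (t * x) * k x)"
      "integrable lborel (\<lambda>x. cis (t * x) * cnj (k x))" for t
    using k by (auto intro!: integrable_cis_mult)
  have k0: "(LINT x|lborel. cis (t * x) * k x) = 0" for t
    using zero[of "- t"] by (simp add: fourier_def mult.commute[of t])
  have c0: "(LINT x|lborel. cis (t * x) * cnj (k x)) = 0" for t
  proof -
    have "(LINT x|lborel. cis (t * x) * cnj (k x)) = (LINT x|lborel. cnj (cis (- (x * t)) * k x))"
      by (simp add: cis_cnj mult.commute)
    also have "\<dots> = cnj (fourier k t)"
      unfolding fourier_def by (rule Bochner_Integration.integral_cnj)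
    finally show ?thesis
      using zero by simp
  qed
  have "AE x in lborel. Re (k x) = 0"
  proof (rule real_fourier_zero_imp_zero)
    fix t
    have "(LINT x|lborel. cis (t * x) * of_real (Re (k x)))
        = (LINT x|lborel. (cis (t * x) * k x + cis (t * x) * cnj (k x)) / 2)"
      by (intro Bochner_Integration.integral_cong)
          (auto simp: complex_add_cnj simp flip: distrib_left)
    then show "(LINT x|lborel. cis (t * x) * of_real (Re (k x))) = 0"
      using i by (simp add: k0 c0)
  qed (use k in auto)
  moreover have "AE x in lborel. Im (k x) = 0"
  proof (rule real_fourier_zero_imp_zero)
    fix t
    have "(LINT x|lborel. cis (t * x) * of_real (Im (k x)))
        = (LINT x|lborel. (cis (t * x) * k x - cis (t * x) * cnj (k x)) / (2 * \<i>))"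
    proof (intro Bochner_Integration.integral_cong refl)
      fix x
      have "of_real (Im (k x)) = (k x - cnj (k x)) / (2 * \<i>)"
        by (simp add: complex_diff_cnj complex_eq_iff)
      then show "cis (t * x) * of_real (Im (k x))
          = (cis (t * x) * k x - cis (t * x) * cnj (k x)) / (2 * \<i>)"
        by (simp only: times_divide_eq_right right_diff_distrib)
    qed
    then show "(LINT x|lborel. cis (t * x) * of_real (Im (k x))) = 0"
      using i by (simp add: k0 c0)
  qed (use k in auto)
  ultimately show ?thesis
    by eventually_elim (simp add: complex_eq_iff)
qed

text \<open>Testing with the Schwartz functions \<open>e\<^sup>-\<^sup>i\<^sup>x\<^sup>t e\<^sup>-\<^sup>x\<^sup>x\<close> shows that the integrable function
  \<open>(g - h) e\<^sup>-\<^sup>x\<^sup>x\<close> has vanishing Fourier transform.\<close>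

lemma represents_unique:
  assumes g: "represents g T" and h: "represents h T"
  shows "AE x in lborel. g x = h x"
proof -
  define e where "e t x = exp (- of_real 1 * of_real x ^ 2 + (- \<i> * of_real t) * of_real x)"
      for t x :: real
  have e: "e t \<in> schwartz" for t
    unfolding e_def[abs_def] by (rule exp_quadratic_schwartz) simp
  have e_eq: "e t x = cis (- (x * t)) * e 0 x" for t x
    by (simp add: e_def cis_conv_exp mult_exp_exp algebra_simps)
  have i: "integrable lborel (\<lambda>x. g x * e t x)" "integrable lborel (\<lambda>x. h x * e t x)" for t
    using g h e by (auto simp: represents_def)
  have "AE x in lborel. (g x - h x) * e 0 x = 0"
  proof (rule fourier_zero_imp_zero)
    show "integrable lborel (\<lambda>x. (g x - h x) * e 0 x)"
      using i[of 0] by (simp add: left_diff_distrib)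
    fix t
    have "fourier (\<lambda>x. (g x - h x) * e 0 x) t = (LINT x|lborel. g x * e t x - h x * e t x)"
      unfolding fourier_def by (simp add: e_eq[of t] algebra_simps)
    also have "\<dots> = T (e t) - T (e t)"
      using g h e i by (auto simp: represents_def dist_of_fun_def)
    finally show "fourier (\<lambda>x. (g x - h x) * e 0 x) t = 0"
      by simp
  qed
  then show ?thesis
    by eventually_elim (simp add: e_def)
qed

section \<open>Van der Corput's lemmas\<close>

text \<open>Integration by parts of \<open>cis p = (cis p)' / (i p')\<close>. Since
  \<open>p'' \<ge> 0\<close>, the remainder is dominated by \<open>p'' / p'\<^sup>2\<close>, the
  exact derivative of \<open>- 1 / p'\<close>; as \<open>p'\<close> has constant sign, its integral
  is at most \<open>1 / l\<close>. The two boundary terms contribute \<open>1 / l\<close> each. The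
  bound does not involve the length of the interval.\<close>

lemma van_der_Corput_first:
  fixes p :: "real \<Rightarrow> real"
  assumes ab: "a \<le> b" and l: "l > 0"
    and p: "\<And>x. x \<in> {a..b} \<Longrightarrow> (p has_real_derivative p' x) (at x)"
    and p': "\<And>x. x \<in> {a..b} \<Longrightarrow> (p' has_real_derivative p'' x) (at x)"
    and cont: "continuous_on {a..b} p''" and nonneg: "\<And>x. x \<in> {a..b} \<Longrightarrow> p'' x \<ge> 0"
    and lower: "(\<forall>x\<in>{a..b}. p' x \<ge> l) \<or> (\<forall>x\<in>{a..b}. p' x \<le> - l)"
  shows "norm (integral {a..b} (\<lambda>x. cis (p x))) \<le> 3 / l"
proof -
  have ne: "p' x \<noteq> 0" and abs_l: "\<bar>p' x\<bar> \<ge> l" if "x \<in> {a..b}" for x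
    using lower l that by (fastforce)+
  have cp: "continuous_on {a..b} p" "continuous_on {a..b} p'"
    using DERIV_isCont[OF p] DERIV_isCont[OF p'] by (auto intro!: continuous_at_imp_continuous_on)
  define F where "F x = inverse (p' x) *\<^sub>R (- \<i> * cis (p x))" for x
  define R where "R x = cis (p x) * of_real (p'' x / (p' x)\<^sup>2) / \<i>" for x
  have F: "(F has_vector_derivative cis (p x) - R x) (at x within {a..b})" if x: "x \<in> {a..b}" for x
  proof -
    have 1: "((\<lambda>x. cis (p x)) has_vector_derivative p' x *\<^sub>R (\<i> * cis (p x))) (at x within {a..b})"
      using has_derivative_cis[OF has_field_derivative_imp_has_derivative[OF p[OF x]], THEN
          has_derivative_at_withinI]
      by (simp add: has_vector_derivative_def mult.commute)
    have 2: "((\<lambda>x. inverse (p' x)) has_real_derivative - (inverse (p' x) * p'' x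
        * inverse (p' x))) (at x within {a..b})"
      by (rule DERIV_inverse'[OF has_field_derivative_at_within[OF p'[OF x]] ne[OF x]])
    have "((\<lambda>x. inverse (p' x) *\<^sub>R (- \<i> * cis (p x))) has_vector_derivative
        (inverse (p' x) *\<^sub>R (- \<i> * (p' x *\<^sub>R (\<i> * cis (p x))))
            + (- (inverse (p' x) * p'' x * inverse (p' x))) *\<^sub>R (- \<i>
            * cis (p x)))) (at x within {a..b})"
      by (rule has_vector_derivative_scaleR[OF 2 has_vector_derivative_mult_right[OF 1]])
    moreover have "inverse (p' x) *\<^sub>R (- \<i> * (p' x *\<^sub>R (\<i> * cis (p x))))
        + (- (inverse (p' x) * p'' x * inverse (p' x))) *\<^sub>R (- \<i> * cis (p x))
        = cis (p x) - R x"
      using ne[OF x] by (simp add: R_def scaleR_conv_of_real field_simps power2_eq_square)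
    moreover have "F = (\<lambda>x. inverse (p' x) *\<^sub>R (- \<i> * cis (p x)))"
      by (rule ext) (simp add: F_def)
    ultimately show ?thesis by simp
  qed
  have "((\<lambda>x. cis (p x) - R x) has_integral F b - F a) {a..b}"
    using F ab by (intro fundamental_theorem_of_calculus) auto
  moreover have cR: "continuous_on {a..b} R"
    unfolding R_def using cp cont ne by (intro continuous_intros) auto
  then have iR: "R integrable_on {a..b}"
    by (rule integrable_continuous_real)
  ultimately have "((\<lambda>x. (cis (p x) - R x) + R x) has_integral (F b - F a)
      + integral {a..b} R) {a..b}"
    by (intro has_integral_add integrable_integral)
  then have "integral {a..b} (\<lambda>x. cis (p x)) = F b - F a + integral {a..b} R"
    by (simp add: integral_unique)
  also have "norm \<dots> \<le> norm (F b) + norm (F a) + norm (integral {a..b} R)"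
    by (meson add_mono norm_triangle_ineq norm_triangle_ineq4 order_refl order_trans)
  finally have main: "norm (integral {a..b} (\<lambda>x. cis (p x)))
      \<le> norm (F b) + norm (F a) + norm (integral {a..b} R)" .
  have F_le: "norm (F b) \<le> 1 / l" "norm (F a) \<le> 1 / l"
    using abs_l[of a] abs_l[of b] ab l by (auto simp: F_def norm_mult inverse_eq_divide frac_le)
  have "norm (integral {a..b} R) \<le> 1 / l"
  proof -
    have "((\<lambda>x. p'' x / (p' x)\<^sup>2) has_integral (- inverse (p' b)) - (- inverse (p' a))) {a..b}"
    proof (rule fundamental_theorem_of_calculus[OF ab])
      fix x assume x: "x \<in> {a..b}"
      have "((\<lambda>x. - inverse (p' x)) has_real_derivative - (- (inverse (p' x) * p'' x
          * inverse (p' x)))) (at x within {a..b})"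
        by (intro DERIV_minus DERIV_inverse'[OF has_field_derivative_at_within[OF p'[OF x]]
            ne[OF x]])
      then show "((\<lambda>x. - inverse (p' x)) has_vector_derivative p'' x / (p' x)\<^sup>2) (at x within {a..b})"
        by (simp add: has_real_derivative_iff_has_vector_derivative field_simps power2_eq_square)
    qed
    then have i: "(\<lambda>x. p'' x / (p' x)\<^sup>2) integrable_on {a..b}"
        "integral {a..b} (\<lambda>x. p'' x / (p' x)\<^sup>2) = inverse (p' a) - inverse (p' b)"
      by (auto simp: integral_unique)
    have "norm (integral {a..b} R) \<le> inverse (p' a) - inverse (p' b)"
      unfolding i(2)[symmetric]
      by (rule integral_norm_bound_integral[OF iR i(1)])
          (auto simp: R_def norm_mult norm_divide norm_power nonneg)
    also have "\<dots> \<le> inverse l"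
    proof -
      have "a \<in> {a..b}" "b \<in> {a..b}" using ab by auto
      from lower show ?thesis
      proof
        assume "\<forall>x\<in>{a..b}. p' x \<ge> l"
        with \<open>a \<in> _\<close> \<open>b \<in> _\<close> have "l \<le> p' a" "l \<le> p' b" by auto
        with l have "inverse (p' a) \<le> inverse l" "inverse (p' b) > 0"
          by (auto intro!: le_imp_inverse_le)
        then show ?thesis by linarith
      next
        assume "\<forall>x\<in>{a..b}. p' x \<le> - l"
        with \<open>a \<in> _\<close> \<open>b \<in> _\<close> have "p' a \<le> - l" "p' b \<le> - l" by auto
        then have "l \<le> - p' a" "l \<le> - p' b" by linarith+
        with l have "inverse (- p' b) \<le> inverse l" "inverse (- p' a) > 0"
          by (auto intro!: le_imp_inverse_le simp del: inverse_minus_eq)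
        then have "- inverse (p' b) \<le> inverse l" "inverse (p' a) < 0" by auto
        then show ?thesis by linarith
      qed
    qed
    finally show ?thesis by (simp add: inverse_eq_divide)
  qed
  with main F_le show ?thesis by simp
qed

lemma norm_integral_cis_le:
  assumes "a \<le> b" "continuous_on {a..b} p"
  shows "norm (integral {a..b} (\<lambda>x. cis (p x))) \<le> b - a"
proof -
  have "norm (integral {a..b} (\<lambda>x. cis (p x))) \<le> integral {a..b} (\<lambda>_. 1::real)"
    using assms by (intro integral_norm_bound_integral integrable_continuous_real continuous_intros)
        auto
  then show ?thesis using assms by simp
qed

text \<open>\<open>p'\<close> grows at rate at least \<open>l\<close>, so it is small only near one
  point \<open>c\<close>. At distance \<open>d = 1 / sqrt l\<close> or more from \<open>c\<close>,
  \<open>\<bar>p'\<bar>\<close> is at least \<open>l * d = sqrt l\<close>, and the first lemma gives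
  \<open>3 / sqrt l\<close> on either side. The middle part contributes at most its length
  \<open>2 * d\<close>, which this choice of \<open>d\<close> makes comparable; 3 + 2 + 3 =
  8.\<close>

lemma van_der_Corput_second:
  fixes p :: "real \<Rightarrow> real"
  assumes ab: "a \<le> b" and l: "l > 0"
    and p: "\<And>x. x \<in> {a..b} \<Longrightarrow> (p has_real_derivative p' x) (at x)"
    and p': "\<And>x. x \<in> {a..b} \<Longrightarrow> (p' has_real_derivative p'' x) (at x)"
    and cont: "continuous_on {a..b} p''" and lower: "\<And>x. x \<in> {a..b} \<Longrightarrow> p'' x \<ge> l"
  shows "norm (integral {a..b} (\<lambda>x. cis (p x))) \<le> 8 / sqrt l"
proof -
  have growth: "p' y - p' x \<ge> l * (y - x)" if "x \<in> {a..b}" "y \<in> {a..b}" "x \<le> y" for x y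
  proof (cases "x = y")
    case False
    then have "\<exists>z>x. z < y \<and> p' y - p' x = (y - x) * p'' z"
      using that by (intro MVT2 p') auto
    then obtain z where "x < z" "z < y" "p' y - p' x = (y - x) * p'' z"
      by blast
    then show ?thesis
      using lower[of z] that False by (simp add: mult.commute mult_left_mono)
  qed simp
  have cp: "continuous_on {a..b} p" "continuous_on {a..b} p'"
    using DERIV_isCont[OF p] DERIV_isCont[OF p'] by (auto intro!: continuous_at_imp_continuous_on)
  \<comment> \<open>If \<open>p'\<close> has constant sign, an endpoint serves as \<open>c\<close>
    and nothing remains on its outer side. So the sign of \<open>p' c\<close> is demanded only where
    an interval is left over.\<close>
  have "\<exists>c\<in>{a..b}. (c = a \<or> p' c \<le> 0) \<and> (c = b \<or> p' c \<ge> 0)"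
  proof -
    consider "p' a \<ge> 0" | "p' b \<le> 0" | "p' a \<le> 0" "p' b \<ge> 0" by linarith
    then show ?thesis
    proof cases
      case 3
      then obtain c where "a \<le> c" "c \<le> b" "p' c = 0"
        using IVT'[of p' a 0 b] ab cp by auto
      then show ?thesis by (intro bexI[of _ c]) auto
    qed (use ab in auto)
  qed
  then obtain c where c: "c \<in> {a..b}" and cl: "c = a \<or> p' c \<le> 0" and cr: "c = b \<or> p' c \<ge> 0"
    by blast
  define d where "d = 1 / sqrt l"
  have d: "d > 0" "l * d = sqrt l"
    using l by (auto simp: d_def real_div_sqrt)
  define u where "u = max a (c - d)"
  define v where "v = min b (c + d)"
  have uv: "a \<le> u" "u \<le> c" "c \<le> v" "v \<le> b" "v - u \<le> 2 * d"
    using c d by (auto simp: u_def v_def)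
  have ci: "continuous_on {a..b} (\<lambda>x. cis (p x))"
    by (intro continuous_intros cp)
  then have int: "(\<lambda>x. cis (p x)) integrable_on {x..y}" if "a \<le> x" "y \<le> b" for x y
    using that by (intro integrable_continuous_real continuous_on_subset[OF ci]) auto
  have "integral {a..b} (\<lambda>x. cis (p x))
      = integral {a..u} (\<lambda>x. cis (p x))
      + (integral {u..v} (\<lambda>x. cis (p x)) + integral {v..b} (\<lambda>x. cis (p x)))"
    using uv ab int by (simp add: Henstock_Kurzweil_Integration.integral_combine)
  also have "norm \<dots> \<le> norm (integral {a..u} (\<lambda>x. cis (p x)))
      + (norm (integral {u..v} (\<lambda>x. cis (p x))) + norm (integral {v..b} (\<lambda>x. cis (p x))))"
    by (meson add_mono norm_triangle_ineq order_refl order_trans)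
  also have "\<dots> \<le> 3 / sqrt l + (2 * d + 3 / sqrt l)"
  proof (intro add_mono)
    show "norm (integral {a..u} (\<lambda>x. cis (p x))) \<le> 3 / sqrt l"
    proof (cases "u = a")
      case True
      then show ?thesis using l by simp
    next
      case False
      then have u: "u = c - d" "a < c" using c d by (auto simp: u_def max_def split: if_splits)
      show ?thesis
      proof (rule van_der_Corput_first[where p' = p' and p'' = p''])
        show "(\<forall>x\<in>{a..u}. sqrt l \<le> p' x) \<or> (\<forall>x\<in>{a..u}. p' x \<le> - sqrt l)"
        proof (intro disjI2 ballI)
          fix x assume x: "x \<in> {a..u}"
          have "l * d \<le> l * (c - x)" using l x u by (intro mult_left_mono) auto
          then show "p' x \<le> - sqrt l"
            using growth[of x c] x c d cl u by auto
        qed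
        show "0 \<le> p'' x" if "x \<in> {a..u}" for x
          using lower[of x] l uv that by auto
      qed (use uv l p p' continuous_on_subset[OF cont] in auto)
    qed
    show "norm (integral {u..v} (\<lambda>x. cis (p x))) \<le> 2 * d"
      using norm_integral_cis_le[of u v p] uv continuous_on_subset[OF cp(1), of "{u..v}"] by auto
    show "norm (integral {v..b} (\<lambda>x. cis (p x))) \<le> 3 / sqrt l"
    proof (cases "v = b")
      case True
      then show ?thesis using l by simp
    next
      case False
      then have v: "v = c + d" "c < b" using c d by (auto simp: v_def min_def split: if_splits)
      show ?thesis
      proof (rule van_der_Corput_first[where p' = p' and p'' = p''])
        show "(\<forall>x\<in>{v..b}. sqrt l \<le> p' x) \<or> (\<forall>x\<in>{v..b}. p' x \<le> - sqrt l)"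
        proof (intro disjI1 ballI)
          fix x assume x: "x \<in> {v..b}"
          have "l * d \<le> l * (x - c)" using l x v by (intro mult_left_mono) auto
          then show "sqrt l \<le> p' x"
            using growth[of c x] x c d cr v by auto
        qed
        show "0 \<le> p'' x" if "x \<in> {v..b}" for x
          using lower[of x] l uv that by auto
      qed (use uv l p p' continuous_on_subset[OF cont] in auto)
    qed
  qed
  also have "\<dots> = 8 / sqrt l"
    by (simp add: d_def)
  finally show ?thesis .
qed

section \<open>The TT* method\<close>

lemma cnj_measurable [measurable]: "cnj \<in> borel_measurable borel"
  by (intro borel_measurable_continuous_onI continuous_intros)

text \<open>Schur's test for the kernel \<open>\<kappa>\<close> of T*T: the square of the norm is
  expanded into a double integral over \<open>M2\<close>, and the product of two values of
  \<open>g\<close> is split by \<open>2 u v \<le> u\<^sup>2 + v\<^sup>2\<close>. Finiteness of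
  \<open>M1\<close> makes the integral defining \<open>\<kappa>\<close> converge; \<open>M2\<close>
  may be infinite, as it is in the Plancherel inequality.\<close>

theorem TstarT_bound:
  fixes e :: "'a \<Rightarrow> 'b \<Rightarrow> complex"
  assumes M1: "finite_measure M1" and M2: "sigma_finite_measure M2"
    and e[measurable]: "case_prod e \<in> borel_measurable (M1 \<Otimes>\<^sub>M M2)" and e1: "\<And>x \<xi>. norm (e x \<xi>) \<le> 1"
    and g: "integrable M2 g"
    and kernel: "AE \<xi> in M2. (\<integral>\<^sup>+\<eta>. norm (LINT x|M1. e x \<xi> * cnj (e x \<eta>)) \<partial>M2) \<le> B"
  shows "(\<integral>\<^sup>+x. (norm (LINT \<xi>|M2. e x \<xi> * g \<xi>))\<^sup>2 \<partial>M1) \<le> B * (\<integral>\<^sup>+\<xi>. (norm (g \<xi>))\<^sup>2 \<partial>M2)"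
proof -
  interpret M1: finite_measure M1 by fact
  interpret M2: sigma_finite_measure M2 by fact
  interpret MM: pair_sigma_finite M2 M2 ..

  interpret P: pair_sigma_finite M1 "M2 \<Otimes>\<^sub>M M2" ..
  have [measurable]: "g \<in> borel_measurable M2"
    using g by auto
  define w where "w x = (LINT \<xi>|M2. e x \<xi> * g \<xi>)" for x
  define G where "G p = g (fst p) * cnj (g (snd p))" for p
  define E where "E x p = e x (fst p) * cnj (e x (snd p))" for x p
  define \<kappa> where "\<kappa> \<xi> \<eta> = (LINT x|M1. e x \<xi> * cnj (e x \<eta>))" for \<xi> \<eta>
  have [measurable]: "w \<in> borel_measurable M1"
    unfolding w_def[abs_def] by measurable
  have [measurable]: "case_prod \<kappa> \<in> borel_measurable (M2 \<Otimes>\<^sub>M M2)"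
    unfolding \<kappa>_def[abs_def] case_prod_beta by measurable
  have [measurable]: "(\<lambda>(\<xi>, \<eta>). \<kappa> \<eta> \<xi>) \<in> borel_measurable (M2 \<Otimes>\<^sub>M M2)"
    unfolding \<kappa>_def[abs_def] case_prod_beta by measurable
  have ei: "integrable M2 (\<lambda>\<xi>. e x \<xi> * g \<xi>)" if [simp]: "x \<in> space M1" for x
    by (rule Bochner_Integration.integrable_bound[OF g])
       (auto simp: norm_mult mult_left_le_one_le e1)
  have cg: "integrable M2 (\<lambda>\<xi>. cnj (g \<xi>))" using g by simp
  have G: "integrable (M2 \<Otimes>\<^sub>M M2) G"
    using MM.integrable_bounded_kernel[OF g cg, where k = "\<lambda>_ _. 1" and B = 1]
    by (simp add: G_def[abs_def] case_prod_beta')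
  have EG: "integrable (M1 \<Otimes>\<^sub>M (M2 \<Otimes>\<^sub>M M2)) (\<lambda>(x, p). E x p * (1 * G p))"
  proof (rule P.integrable_bounded_kernel[OF _ G])
    show "norm (E x p) \<le> 1" for x p
      using mult_mono[OF e1 e1, of x "fst p" x "snd p"] by (simp add: E_def norm_mult mult.commute)
  qed (simp_all add: E_def case_prod_beta)
  have ww: "of_real ((norm (w x))\<^sup>2) = (LINT p|(M2 \<Otimes>\<^sub>M M2). E x p * (1 * G p))" if x: "x \<in> space M1"
      for x
  proof -
    have "of_real ((norm (w x))\<^sup>2) = w x * cnj (w x)"
      by (rule complex_norm_square)
    also have "\<dots> = (LINT \<xi>|M2. (LINT \<eta>|M2. (e x \<xi> * g \<xi>) * cnj (e x \<eta> * g \<eta>)))"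
    proof -
      have c: "cnj (w x) = (LINT \<eta>|M2. cnj (e x \<eta> * g \<eta>))"
        unfolding w_def by (rule Bochner_Integration.integral_cnj[symmetric])
      show ?thesis
        unfolding c unfolding w_def by (simp only: integral_mult_left_zero integral_mult_right_zero)
    qed
    also have "\<dots> = (LINT p|(M2 \<Otimes>\<^sub>M M2). E x p * (1 * G p))"
    proof -
      have "integrable M2 (\<lambda>\<xi>. cnj (e x \<xi> * g \<xi>))"
        using ei[OF x] by (rule Bochner_Integration.integrable_cnj)
      then have "integrable (M2 \<Otimes>\<^sub>M M2) (\<lambda>(\<xi>, \<eta>). 1 * ((e x \<xi> * g \<xi>) * cnj (e x \<eta> * g \<eta>)))"
        by (intro MM.integrable_bounded_kernel[OF ei[OF x], where B = 1]) simp_all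
      from MM.integral_fst[OF this] show ?thesis
        by (simp add: E_def G_def case_prod_beta' mult_ac)
    qed
    finally show ?thesis .
  qed
  have wb: "norm (w x) \<le> (LINT \<xi>|M2. norm (g \<xi>))" if x: "x \<in> space M1" for x
    unfolding w_def
    by (rule order_trans[OF integral_norm_bound
        integral_mono[OF integrable_norm[OF ei[OF x]] integrable_norm[OF g]]])
       (simp add: norm_mult mult_left_le_one_le e1)
  have wi: "integrable M1 (\<lambda>x. (norm (w x))\<^sup>2)"
    by (rule M1.integrable_const_bound[where B = "(LINT \<xi>|M2. norm (g \<xi>))\<^sup>2"])
       (auto intro!: AE_I2 power_mono wb)
  have "of_real (LINT x|M1. (norm (w x))\<^sup>2) = (LINT x|M1. (LINT p|(M2 \<Otimes>\<^sub>M M2). E x p * (1 * G p)))"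
    unfolding Bochner_Integration.integral_complex_of_real[symmetric]
    by (rule Bochner_Integration.integral_cong[OF refl ww])
  also have "\<dots> = (LINT p|(M2 \<Otimes>\<^sub>M M2). (LINT x|M1. E x p * (1 * G p)))"
    by (rule P.Fubini_integral[OF EG, symmetric])
  also have "\<dots> = (LINT p|(M2 \<Otimes>\<^sub>M M2). case_prod \<kappa> p * G p)"
    by (simp add: \<kappa>_def E_def case_prod_beta')
  finally have eq: "of_real (LINT x|M1. (norm (w x))\<^sup>2)
      = (LINT p|(M2 \<Otimes>\<^sub>M M2). case_prod \<kappa> p * G p)" .
  have \<kappa>i: "integrable (M2 \<Otimes>\<^sub>M M2) (\<lambda>p. case_prod \<kappa> p * G p)"
    using P.integrable_snd[OF EG] by (simp add: \<kappa>_def E_def case_prod_beta')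
  have sym: "norm (\<kappa> \<xi> \<eta>) = norm (\<kappa> \<eta> \<xi>)" for \<xi> \<eta>
  proof -
    have "\<kappa> \<xi> \<eta> = cnj (\<kappa> \<eta> \<xi>)"
      unfolding \<kappa>_def Bochner_Integration.integral_cnj[symmetric]
      by (simp only: complex_cnj_mult complex_cnj_cnj mult.commute)
    then show ?thesis by simp
  qed
  \<comment> \<open>\<open>X\<close> and \<open>J\<close> are the halves that one variable
    contributes to the splitting of the product; by the symmetry of
    \<open>norm (\<kappa> \<xi> \<eta>)\<close> the other variable contributes the same.\<close>
  define X where "X = (\<integral>\<^sup>+\<xi>. ennreal ((norm (g \<xi>))\<^sup>2 / 2) \<partial>M2)"
  define J where "J = (\<integral>\<^sup>+\<xi>. (\<integral>\<^sup>+\<eta>. ennreal ((norm (g \<xi>))\<^sup>2 / 2) * ennreal (norm (\<kappa> \<xi> \<eta>)) \<partial>M2) \<partial>M2)"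
  have XX: "X + X = (\<integral>\<^sup>+\<xi>. (norm (g \<xi>))\<^sup>2 \<partial>M2)"
    unfolding X_def by (subst nn_integral_add[symmetric]) (simp_all flip: ennreal_plus)
  have J: "J \<le> B * X"
  proof -
    have "J \<le> (\<integral>\<^sup>+\<xi>. ennreal ((norm (g \<xi>))\<^sup>2 / 2) * B \<partial>M2)"
      unfolding J_def
    proof (rule nn_integral_mono_AE)
      show "AE \<xi> in M2. (\<integral>\<^sup>+\<eta>. ennreal ((norm (g \<xi>))\<^sup>2 / 2) * ennreal (norm (\<kappa> \<xi> \<eta>)) \<partial>M2)
          \<le> ennreal ((norm (g \<xi>))\<^sup>2 / 2) * B"
        using kernel AE_space
      proof eventually_elim
        case (elim \<xi>)
        then show ?case
          by (subst nn_integral_cmult) (auto intro!: mult_left_mono simp: \<kappa>_def)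
      qed
    qed
    also have "\<dots> = B * X"
      unfolding X_def by (subst nn_integral_multc) (auto simp: mult.commute)
    finally show ?thesis .
  qed
  have "ennreal (LINT x|M1. (norm (w x))\<^sup>2)
      = ennreal (norm (complex_of_real (LINT x|M1. (norm (w x))\<^sup>2)))"
    by (simp add: integral_nonneg_AE)
  also have "\<dots> \<le> (\<integral>\<^sup>+p. norm (case_prod \<kappa> p * G p) \<partial>(M2 \<Otimes>\<^sub>M M2))"
    unfolding eq by (rule integral_norm_bound_ennreal[OF \<kappa>i])
  also have "\<dots> = (\<integral>\<^sup>+\<xi>. (\<integral>\<^sup>+\<eta>. ennreal (norm (\<kappa> \<xi> \<eta> * (g \<xi> * cnj (g \<eta>)))) \<partial>M2) \<partial>M2)"
    using \<kappa>i by (subst M2.nn_integral_fst[symmetric]) (auto simp: G_def)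
  also have "\<dots> \<le> (\<integral>\<^sup>+\<xi>. (\<integral>\<^sup>+\<eta>. ennreal ((norm (g \<xi>))\<^sup>2 / 2) * ennreal (norm (\<kappa> \<xi> \<eta>))
      + ennreal ((norm (g \<eta>))\<^sup>2 / 2) * ennreal (norm (\<kappa> \<eta> \<xi>)) \<partial>M2) \<partial>M2)"
  proof (intro nn_integral_mono)
    fix \<xi> \<eta>
    have "norm (g \<xi>) * norm (g \<eta>) \<le> (norm (g \<xi>))\<^sup>2 / 2 + (norm (g \<eta>))\<^sup>2 / 2"
      using sum_squares_bound[of "norm (g \<xi>)" "norm (g \<eta>)"] by simp
    then have "norm (\<kappa> \<xi> \<eta> * (g \<xi> * cnj (g \<eta>)))
        \<le> ((norm (g \<xi>))\<^sup>2 / 2 + (norm (g \<eta>))\<^sup>2 / 2) * norm (\<kappa> \<xi> \<eta>)"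
      by (simp add: norm_mult mult.commute mult_left_mono)
    also have "\<dots> = (norm (g \<xi>))\<^sup>2 / 2 * norm (\<kappa> \<xi> \<eta>) + (norm (g \<eta>))\<^sup>2 / 2 * norm (\<kappa> \<eta> \<xi>)"
      by (simp add: sym[of \<eta> \<xi>] algebra_simps)
    finally show "ennreal (norm (\<kappa> \<xi> \<eta> * (g \<xi> * cnj (g \<eta>))))
        \<le> ennreal ((norm (g \<xi>))\<^sup>2 / 2) * ennreal (norm (\<kappa> \<xi> \<eta>))
      + ennreal ((norm (g \<eta>))\<^sup>2 / 2) * ennreal (norm (\<kappa> \<eta> \<xi>))"
      by (simp flip: ennreal_mult ennreal_plus add: ennreal_leI)
  qed
  also have "\<dots> = J + (\<integral>\<^sup>+\<xi>. (\<integral>\<^sup>+\<eta>. ennreal ((norm (g \<eta>))\<^sup>2 / 2) * ennreal (norm (\<kappa> \<eta> \<xi>)) \<partial>M2) \<partial>M2)"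
  proof -
    have "(\<integral>\<^sup>+\<eta>. ennreal ((norm (g \<xi>))\<^sup>2 / 2) * ennreal (norm (\<kappa> \<xi> \<eta>))
        + ennreal ((norm (g \<eta>))\<^sup>2 / 2) * ennreal (norm (\<kappa> \<eta> \<xi>)) \<partial>M2)
      = (\<integral>\<^sup>+\<eta>. ennreal ((norm (g \<xi>))\<^sup>2 / 2) * ennreal (norm (\<kappa> \<xi> \<eta>)) \<partial>M2)
        + (\<integral>\<^sup>+\<eta>. ennreal ((norm (g \<eta>))\<^sup>2 / 2) * ennreal (norm (\<kappa> \<eta> \<xi>)) \<partial>M2)"
      if [simp]: "\<xi> \<in> space M2" for \<xi>
      by (rule nn_integral_add) measurable
    then show ?thesis
      unfolding J_def by (subst nn_integral_add[symmetric]) (auto intro!: nn_integral_cong)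
  qed
  also have "(\<integral>\<^sup>+\<xi>. (\<integral>\<^sup>+\<eta>. ennreal ((norm (g \<eta>))\<^sup>2 / 2) * ennreal (norm (\<kappa> \<eta> \<xi>)) \<partial>M2) \<partial>M2) = J"
    unfolding J_def by (rule MM.Fubini') simp
  also have "J + J \<le> B * (X + X)"
    using J by (simp add: distrib_left add_mono)
  also have "ennreal (LINT x|M1. (norm (w x))\<^sup>2) = (\<integral>\<^sup>+x. (norm (w x))\<^sup>2 \<partial>M1)"
    using wi by (intro nn_integral_eq_integral[symmetric]) auto
  finally show ?thesis
    unfolding XX w_def .
qed

text \<open>The operator and its adjoint have the same norm; the adjoint is treated
    by the previous theorem.\<close>

theorem TTstar_bound:
  fixes e :: "'a \<Rightarrow> 'b \<Rightarrow> complex"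
  assumes M1: "finite_measure M1" and M2: "finite_measure M2"
    and e[measurable]: "case_prod e \<in> borel_measurable (M1 \<Otimes>\<^sub>M M2)" and e1: "\<And>x \<xi>. norm (e x \<xi>) \<le> 1"
    and g: "integrable M2 g"
    and kernel: "AE x in M1. (\<integral>\<^sup>+y. norm (LINT \<xi>|M2. e x \<xi> * cnj (e y \<xi>)) \<partial>M1) \<le> B"
  shows "(\<integral>\<^sup>+x. (norm (LINT \<xi>|M2. e x \<xi> * g \<xi>))\<^sup>2 \<partial>M1) \<le> B * (\<integral>\<^sup>+\<xi>. (norm (g \<xi>))\<^sup>2 \<partial>M2)"
proof -
  interpret M1: finite_measure M1 by fact
  interpret M2: finite_measure M2 by fact
  interpret P: pair_sigma_finite M1 M2 ..
  have [measurable]: "g \<in> borel_measurable M2"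
    using g by auto
  define w where "w x = (LINT \<xi>|M2. e x \<xi> * g \<xi>)" for x
  define H where "H \<xi> = (LINT x|M1. e x \<xi> * cnj (w x))" for \<xi>
  define A where "A = (\<integral>\<^sup>+x. (norm (w x))\<^sup>2 \<partial>M1)"
  have [measurable]: "w \<in> borel_measurable M1"
    unfolding w_def[abs_def] by measurable
  have [measurable]: "(\<lambda>(\<xi>, x). e x \<xi>) \<in> borel_measurable (M2 \<Otimes>\<^sub>M M1)"
    by measurable
  have [measurable]: "H \<in> borel_measurable M2"
    unfolding H_def[abs_def] by measurable
  have ei: "integrable M2 (\<lambda>\<xi>. e x \<xi> * g \<xi>)" if [simp]: "x \<in> space M1" for x
    by (rule Bochner_Integration.integrable_bound[OF g])
       (auto simp: norm_mult mult_left_le_one_le e1)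
  have wb: "norm (w x) \<le> (LINT \<xi>|M2. norm (g \<xi>))" if x: "x \<in> space M1" for x
    unfolding w_def
    by (rule order_trans[OF integral_norm_bound
        integral_mono[OF integrable_norm[OF ei[OF x]] integrable_norm[OF g]]])
       (simp add: norm_mult mult_left_le_one_le e1)
  have wi: "integrable M1 (\<lambda>x. (norm (w x))\<^sup>2)"
    by (rule M1.integrable_const_bound[where B = "(LINT \<xi>|M2. norm (g \<xi>))\<^sup>2"])
       (auto intro!: AE_I2 power_mono wb)
  have cwi: "integrable M1 (\<lambda>x. cnj (w x))"
    by (rule M1.integrable_const_bound[where B = "(LINT \<xi>|M2. norm (g \<xi>))"])
       (auto intro!: AE_I2 wb)
  have A_fin: "A = ennreal (LINT x|M1. (norm (w x))\<^sup>2)"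
    unfolding A_def using wi by (intro nn_integral_eq_integral) auto
  \<comment> \<open>Up to conjugation \<open>H\<close> is the adjoint operator applied to
    \<open>w\<close>. With the two measures exchanged, the kernel required by the previous theorem
    is the one bounded in \<open>kernel\<close>.\<close>
  have HA: "(\<integral>\<^sup>+\<xi>. (norm (H \<xi>))\<^sup>2 \<partial>M2) \<le> B * A"
  proof -
    have "(\<integral>\<^sup>+\<xi>. (norm (LINT x|M1. e x \<xi> * cnj (w x)))\<^sup>2 \<partial>M2)
        \<le> B * (\<integral>\<^sup>+x. (norm (cnj (w x)))\<^sup>2 \<partial>M1)"
      by (rule TstarT_bound[OF M2 M1.sigma_finite_measure_axioms _ _ cwi kernel]) (simp_all add: e1)
    then show ?thesis
      by (simp add: H_def A_def)
  qed
  have int: "integrable (M1 \<Otimes>\<^sub>M M2) (\<lambda>(x, \<xi>). e x \<xi> * (cnj (w x) * g \<xi>))"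
    by (rule P.integrable_bounded_kernel[OF cwi g e e1])
  have "of_real (LINT x|M1. (norm (w x))\<^sup>2) = (LINT x|M1. w x * cnj (w x))"
    unfolding Bochner_Integration.integral_complex_of_real[symmetric]
    by (simp only: complex_norm_square)
  also have "\<dots> = (LINT x|M1. (LINT \<xi>|M2. e x \<xi> * (cnj (w x) * g \<xi>)))"
    unfolding w_def integral_mult_left_zero[symmetric] by (simp add: mult_ac)
  also have "\<dots> = (LINT \<xi>|M2. (LINT x|M1. e x \<xi> * (cnj (w x) * g \<xi>)))"
    by (rule P.Fubini_integral[OF int, symmetric])
  also have "\<dots> = (LINT \<xi>|M2. g \<xi> * H \<xi>)"
    unfolding H_def integral_mult_right_zero[symmetric] by (simp add: mult_ac)
  finally have eq: "of_real (LINT x|M1. (norm (w x))\<^sup>2) = (LINT \<xi>|M2. g \<xi> * H \<xi>)" .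
  have gHi: "integrable M2 (\<lambda>\<xi>. g \<xi> * H \<xi>)"
    using P.integrable_snd[OF int] unfolding H_def integral_mult_right_zero[symmetric]
    by (simp add: mult_ac)
  have "A = ennreal (norm (complex_of_real (LINT x|M1. (norm (w x))\<^sup>2)))"
    unfolding A_fin by (simp add: integral_nonneg_AE)
  also have "\<dots> \<le> (\<integral>\<^sup>+\<xi>. norm (g \<xi> * H \<xi>) \<partial>M2)"
    unfolding eq by (rule integral_norm_bound_ennreal[OF gHi])
  also have "\<dots> = (\<integral>\<^sup>+\<xi>. ennreal (norm (g \<xi>)) * ennreal (norm (H \<xi>)) \<partial>M2)"
    by (simp add: norm_mult ennreal_mult)
  \<comment> \<open>Cauchy-Schwarz and the bound for \<open>H\<close> give \<open>A * A\<close> on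
    the left and a factor \<open>A\<close> on the right. One \<open>A\<close> cancels, since
    \<open>w\<close> is bounded on a finite measure space and so \<open>A\<close> is finite.\<close>
  finally have "A\<^sup>2 \<le> (\<integral>\<^sup>+\<xi>. ennreal (norm (g \<xi>)) * ennreal (norm (H \<xi>)) \<partial>M2)\<^sup>2"
    by (rule power_mono) simp
  also have "\<dots> \<le> (\<integral>\<^sup>+\<xi>. (ennreal (norm (g \<xi>)))\<^sup>2 \<partial>M2) * (\<integral>\<^sup>+\<xi>. (ennreal (norm (H \<xi>)))\<^sup>2 \<partial>M2)"
    by (rule Cauchy_Schwarz_nn_integral) auto
  also have "\<dots> \<le> (\<integral>\<^sup>+\<xi>. (norm (g \<xi>))\<^sup>2 \<partial>M2) * (B * A)"
    using HA by (intro mult_mono) (auto simp: ennreal_power)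
  finally have *: "A * A \<le> A * (B * (\<integral>\<^sup>+\<xi>. (norm (g \<xi>))\<^sup>2 \<partial>M2))"
    by (simp add: power2_eq_square mult_ac)
  have "A \<le> B * (\<integral>\<^sup>+\<xi>. (norm (g \<xi>))\<^sup>2 \<partial>M2)"
  proof (cases "A = 0")
    case False
    have "A \<noteq> \<top>" by (simp add: A_fin)
    with * False show ?thesis
      by (simp add: ennreal_mult_le_mult_iff)
  qed simp
  then show ?thesis
    by (simp add: A_def w_def)
qed

text \<open>\<open>TstarT_bound\<close> requires a finite measure in \<open>x\<close>, so Lebesgue
  measure is first damped by a Gaussian. The kernel is then a Gaussian of total integral
  \<open>2 * pi\<close> for every \<epsilon>, and Fatou's lemma removes the damping.\<close>

theorem plancherel_le:
  assumes g: "integrable lborel g"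
  shows "(\<integral>\<^sup>+x. (norm (LINT \<xi>|lborel. cis (x * \<xi>) * g \<xi>))\<^sup>2 \<partial>lborel)
      \<le> ennreal (2 * pi) * (\<integral>\<^sup>+\<xi>. (norm (g \<xi>))\<^sup>2 \<partial>lborel)"
proof -
  have [measurable]: "g \<in> borel_measurable borel"
    using g by (auto dest: borel_measurable_integrable)
  define w where "w x = (LINT \<xi>|lborel. cis (x * \<xi>) * g \<xi>)" for x :: real
  have [measurable]: "w \<in> borel_measurable borel"
    unfolding w_def[abs_def] by measurable
  let ?R = "ennreal (2 * pi) * (\<integral>\<^sup>+\<xi>. (norm (g \<xi>))\<^sup>2 \<partial>lborel)"
  have reg: "(\<integral>\<^sup>+x. ennreal (gauss (\<epsilon> * x)) * (norm (w x))\<^sup>2 \<partial>lborel) \<le> ?R" if \<epsilon>: "\<epsilon> > 0" for \<epsilon>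
  proof -
    define M where "M = density lborel (\<lambda>x. ennreal (gauss (\<epsilon> * x)))"
    have gi: "integrable lborel (\<lambda>x. gauss (\<epsilon> * x))"
      using lborel_integrable_real_affine[OF integrable_gauss, of \<epsilon> 0] \<epsilon> by simp
    have fin: "finite_measure M"
    proof
      have "emeasure M (space M) = (\<integral>\<^sup>+x. ennreal (gauss (\<epsilon> * x)) \<partial>lborel)"
        by (simp add: M_def emeasure_density)
      also have "\<dots> = ennreal (LINT x|lborel. gauss (\<epsilon> * x))"
        using gi by (intro nn_integral_eq_integral) auto
      finally show "emeasure M (space M) \<noteq> \<infinity>" by simp
    qed
    have sets[measurable_cong]: "sets M = sets borel" by (simp add: M_def)
    have kern: "(\<integral>\<^sup>+\<eta>. norm (LINT x|M. cis (x * \<xi>) * cnj (cis (x * \<eta>))) \<partial>lborel) \<le> ennreal (2 * pi)"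
        for \<xi>
    proof -
      have "(LINT x|M. cis (x * \<xi>) * cnj (cis (x * \<eta>)))
          = of_real (sqrt (2 * pi) / \<epsilon> * gauss ((\<xi> - \<eta>) / \<epsilon>))" for \<eta>
      proof -
        have "(LINT x|M. cis (x * \<xi>) * cnj (cis (x * \<eta>)))
            = (LINT x|lborel. gauss (\<epsilon> * x) *\<^sub>R (cis (x * \<xi>) * cnj (cis (x * \<eta>))))"
          unfolding M_def by (rule integral_density) auto
        also have "\<dots> = (LINT x|lborel. cis ((\<xi> - \<eta>) * x) * of_real (gauss (\<epsilon> * x)))"
          by (intro Bochner_Integration.integral_cong)
              (auto simp: scaleR_conv_of_real cis_cnj cis_mult algebra_simps)
        finally show ?thesis
          by (simp only: integral_cis_gauss_scaled[OF \<epsilon>])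
      qed
      then have "(\<integral>\<^sup>+\<eta>. norm (LINT x|M. cis (x * \<xi>) * cnj (cis (x * \<eta>))) \<partial>lborel)
          = (\<integral>\<^sup>+\<eta>. ennreal (sqrt (2 * pi) / \<epsilon> * gauss ((\<xi> - \<eta>) / \<epsilon>)) \<partial>lborel)"
        using \<epsilon> by (simp add: norm_mult norm_divide abs_mult)
      also have "\<dots> = ennreal \<epsilon> * (\<integral>\<^sup>+z. ennreal (sqrt (2 * pi) / \<epsilon> * gauss z) \<partial>lborel)"
        using \<epsilon> by (subst nn_integral_real_affine[where c = "- \<epsilon>" and t = \<xi>]) auto
      also have "\<dots> = ennreal \<epsilon> * ennreal (LINT z|lborel. sqrt (2 * pi) / \<epsilon> * gauss z)"
        using \<epsilon> by (subst nn_integral_eq_integral) auto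
      also have "\<dots> = ennreal (\<epsilon> * (sqrt (2 * pi) / \<epsilon> * sqrt (2 * pi)))"
        using \<epsilon> by (simp add: integral_gauss flip: ennreal_mult)
      also have "\<epsilon> * (sqrt (2 * pi) / \<epsilon> * sqrt (2 * pi)) = 2 * pi"
        using \<epsilon> by simp
      finally show ?thesis by simp
    qed
    have "(\<integral>\<^sup>+x. (norm (w x))\<^sup>2 \<partial>M) \<le> ?R"
      unfolding w_def
      by (rule TstarT_bound[OF fin lborel.sigma_finite_measure_axioms _ _ g]) (use kern in auto)
    then show ?thesis
      unfolding M_def by (subst (asm) nn_integral_density) auto
  qed
  let ?e = "\<lambda>n. inverse (real (Suc n))"
  have lim: "(\<lambda>n. ennreal (gauss (?e n * x)) * (norm (w x))\<^sup>2) \<longlonglongrightarrow> ennreal ((norm (w x))\<^sup>2)" for x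
  proof -
    have "(\<lambda>n. gauss (?e n * x)) \<longlonglongrightarrow> gauss (0 * x)"
      by (intro isCont_tendsto_compose[OF isCont_gauss] tendsto_intros LIMSEQ_inverse_real_of_nat)
    then have "(\<lambda>n. ennreal (gauss (?e n * x) * (norm (w x))\<^sup>2)) \<longlonglongrightarrow> ennreal (gauss (0 * x)
        * (norm (w x))\<^sup>2)"
      by (intro tendsto_intros)
    then show ?thesis by (simp add: ennreal_mult)
  qed
  have "(\<integral>\<^sup>+x. (norm (w x))\<^sup>2 \<partial>lborel)
      = (\<integral>\<^sup>+x. liminf (\<lambda>n. ennreal (gauss (?e n * x)) * (norm (w x))\<^sup>2) \<partial>lborel)"
    using lim_imp_Liminf[OF _ lim] by simp
  also have "\<dots> \<le> liminf (\<lambda>n. \<integral>\<^sup>+x. ennreal (gauss (?e n * x)) * (norm (w x))\<^sup>2 \<partial>lborel)"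
    by (rule nn_integral_liminf) auto
  also have "\<dots> \<le> liminf (\<lambda>n::nat. ?R)"
    by (intro Liminf_mono always_eventually allI reg) simp
  also have "\<dots> = ?R"
    by (simp add: Liminf_const)
  finally show ?thesis
    by (simp add: w_def)
qed

section \<open>Maximal estimates on an annulus\<close>

abbreviation L2sq :: "(real \<Rightarrow> complex) \<Rightarrow> real" where
  "L2sq g \<equiv> LINT \<xi>|lborel. (norm (g \<xi>))\<^sup>2"

abbreviation square_integrable :: "(real \<Rightarrow> complex) \<Rightarrow> bool" where
  "square_integrable g \<equiv> integrable lborel (\<lambda>\<xi>. (norm (g \<xi>))\<^sup>2)"

abbreviation Hs_sq :: "real \<Rightarrow> (real \<Rightarrow> complex) \<Rightarrow> real" where
  "Hs_sq s g \<equiv> LINT \<xi>|lborel. (1 + \<xi>\<^sup>2) powr s * (norm (g \<xi>))\<^sup>2"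

abbreviation Hs_integrable :: "real \<Rightarrow> (real \<Rightarrow> complex) \<Rightarrow> bool" where
  "Hs_integrable s g \<equiv> integrable lborel (\<lambda>\<xi>. (1 + \<xi>\<^sup>2) powr s * (norm (g \<xi>))\<^sup>2)"

text \<open>Up to the factor \<open>2\<pi>\<close>, this is \<open>S\<^sup>a f(x,t)\<close> for the \<open>f\<close> with Fourier transform \<open>g\<close>.\<close>

definition evol :: "real \<Rightarrow> (real \<Rightarrow> complex) \<Rightarrow> real \<Rightarrow> real \<Rightarrow> complex" where
  "evol a g t x = (LINT \<xi>|lborel. cis (x * \<xi> + t * \<bar>\<xi>\<bar> powr a) * g \<xi>)"

section \<open>The oscillatory kernel of an annulus\<close>

text \<open>The contribution of the positive frequencies to the TT* kernel; there \<open>x\<close>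
  and \<open>t\<close> are differences of two points and of two times.\<close>

definition osc :: "real \<Rightarrow> real \<Rightarrow> real \<Rightarrow> real \<Rightarrow> complex" where
  "osc a N x t = integral {N..2 * N} (\<lambda>\<xi>. cis (x * \<xi> + t * \<xi> powr a))"

lemma phase_deriv:
  fixes \<xi> :: real
  assumes "\<xi> > 0"
  shows "((\<lambda>\<xi>. x * \<xi> + t * \<xi> powr a) has_real_derivative x + t * a * \<xi> powr (a - 1)) (at \<xi>)"
    and "((\<lambda>\<xi>. x + t * a * \<xi> powr (a - 1)) has_real_derivative t * a * (a - 1)
        * \<xi> powr (a - 2)) (at \<xi>)"
  using assms by (auto intro!: derivative_eq_intros simp: algebra_simps)

lemma osc_cnj: "osc a N (- x) (- t) = cnj (osc a N x t)"
  unfolding osc_def Henstock_Kurzweil_Integration.integral_cnj by (simp add: cis_cnj algebra_simps)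

lemma norm_osc_trivial:
  assumes "N > 0"
  shows "norm (osc a N x t) \<le> N"
  unfolding osc_def using assms
  by (intro order_trans[OF norm_integral_cis_le] continuous_intros) auto

text \<open>By the assumption on \<open>t\<close>, the dispersive part of the phase derivative is at
  most \<open>\<bar>x\<bar> / 2\<close> on the interval, so the derivative keeps its sign and size
  \<open>\<bar>x\<bar> / 2\<close>. Conjugation reduces negative times to positive ones, where the
  phase is convex.\<close>

lemma norm_osc_nonstationary:
  assumes a: "a > 1" and N: "N > 0" and x: "x \<noteq> 0" and t: "2 * a * \<bar>t\<bar> * (2 * N) powr (a - 1) \<le> \<bar>x\<bar>"
  shows "norm (osc a N x t) \<le> 6 / \<bar>x\<bar>"
proof -
  have *: "norm (osc a N x t) \<le> 6 / \<bar>x\<bar>" if x: "x \<noteq> 0" and t0: "t \<ge> 0"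
      and t: "2 * a * t * (2 * N) powr (a - 1) \<le> \<bar>x\<bar>" for x t
  proof -
    have b: "0 \<le> t * a * \<xi> powr (a - 1)" "t * a * \<xi> powr (a - 1) \<le> \<bar>x\<bar> / 2" if "\<xi> \<in> {N..2 * N}"
        for \<xi>
    proof -
      have "t * a * \<xi> powr (a - 1) \<le> t * a * (2 * N) powr (a - 1)"
        using that N a t0 by (intro mult_left_mono powr_mono2) auto
      then show "t * a * \<xi> powr (a - 1) \<le> \<bar>x\<bar> / 2"
        using t by (simp add: mult_ac)
    qed (use t0 a in simp)
    have "norm (osc a N x t) \<le> 3 / (\<bar>x\<bar> / 2)"
      unfolding osc_def
    proof (rule van_der_Corput_first[where p' = "\<lambda>\<xi>. x + t * a * \<xi> powr (a - 1)"
        and p'' = "\<lambda>\<xi>. t * a * (a - 1) * \<xi> powr (a - 2)"])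
      show "(\<forall>\<xi>\<in>{N..2 * N}. \<bar>x\<bar> / 2 \<le> x + t * a * \<xi> powr (a - 1)) \<or> (\<forall>\<xi>\<in>{N..2 * N}. x
          + t * a * \<xi> powr (a - 1) \<le> - (\<bar>x\<bar> / 2))"
      proof (cases "x > 0")
        case True
        show ?thesis using b(1) True by (intro disjI1 ballI) force
      next
        case False
        show ?thesis
        proof (intro disjI2 ballI)
          fix \<xi> assume "\<xi> \<in> {N..2 * N}"
          from b(2)[OF this] show "x + t * a * \<xi> powr (a - 1) \<le> - (\<bar>x\<bar> / 2)" using False by auto
        qed
      qed
    qed (use N x a t0 phase_deriv in \<open>auto intro!: continuous_intros\<close>)
    then show ?thesis by simp
  qed
  show ?thesis
  proof (cases "t \<ge> 0")
    case True
    then show ?thesis using *[OF x, of t] t by simp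
  next
    case False
    then show ?thesis using *[of "- x" "- t"] x t by (simp add: osc_cnj)
  qed
qed

text \<open>The exponent \<open>a - 2\<close> in the second derivative may have either sign. Writing
  the power as \<open>\<xi> powr a / \<xi>\<^sup>2\<close> and estimating numerator and denominator
  at opposite endpoints covers both cases; this is the origin of the 4.\<close>

lemma norm_osc_second:
  assumes a: "a > 1" and N: "N > 0" and l: "0 < l" "l \<le> \<bar>t\<bar> * a * (a - 1) * (N powr a / (4 * N\<^sup>2))"
  shows "norm (osc a N x t) \<le> 8 / sqrt l"
proof -
  have *: "norm (osc a N x t) \<le> 8 / sqrt l" if t0: "t \<ge> 0"
      and lt: "l \<le> t * a * (a - 1) * (N powr a / (4 * N\<^sup>2))" for x t
    unfolding osc_def
  proof (rule van_der_Corput_second[where p' = "\<lambda>\<xi>. x + t * a * \<xi> powr (a - 1)"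
      and p'' = "\<lambda>\<xi>. t * a * (a - 1) * \<xi> powr (a - 2)"])
    fix \<xi> assume \<xi>: "\<xi> \<in> {N..2 * N}"
    have "N powr a / (4 * N\<^sup>2) \<le> \<xi> powr a / \<xi>\<^sup>2"
    proof (rule frac_le)
      show "N powr a \<le> \<xi> powr a" using \<xi> N a by (intro powr_mono2) auto
      have "\<xi>\<^sup>2 \<le> (2 * N)\<^sup>2" using \<xi> N by (intro power_mono) auto
      then show "\<xi>\<^sup>2 \<le> 4 * N\<^sup>2" by (simp add: power_mult_distrib)
    qed (use \<xi> N in auto)
    also have "\<dots> = \<xi> powr (a - 2)"
      using \<xi> N by (simp add: powr_diff)
    finally have "t * a * (a - 1) * (N powr a / (4 * N\<^sup>2)) \<le> t * a * (a - 1) * \<xi> powr (a - 2)"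
      using t0 a by (intro mult_left_mono) auto
    then show "l \<le> t * a * (a - 1) * \<xi> powr (a - 2)"
      using lt by simp
  qed (use N a t0 l phase_deriv in \<open>auto intro!: continuous_intros\<close>)
  show ?thesis
  proof (cases "t \<ge> 0")
    case True
    then show ?thesis using *[of t] l by simp
  next
    case False
    then show ?thesis using *[of "- t" "- x"] l by (simp add: osc_cnj)
  qed
qed

lemma nn_integral_powr_near_0:
  assumes p: "0 < p" and r: "r \<ge> 0"
  shows "(\<integral>\<^sup>+z. ennreal (\<bar>z\<bar> powr (p - 1)) * indicator {-r..r} z \<partial>lborel)
      = ennreal (2 * r powr p / p)"
proof -
  have pos: "(\<integral>\<^sup>+z. ennreal (\<bar>z\<bar> powr (p - 1)) * indicator {0..r} z \<partial>lborel)
      = ennreal (r powr p / p)"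
  proof -
    have "((\<lambda>z. z powr (p - 1)) has_integral (r powr (p - 1 + 1) / (p - 1 + 1))) {0..r}"
      using p r by (intro has_integral_powr_from_0) auto
    then have hi: "((\<lambda>z::real. \<bar>z\<bar> powr (p - 1)) has_integral (r powr p / p)) {0..r}"
      by (subst has_integral_cong[where g = "\<lambda>z. z powr (p - 1)"]) auto
    have eq: "(\<lambda>z. indicator {0..r} z * \<bar>z\<bar> powr (p - 1))
        = (\<lambda>z. if z \<in> {0..r} then \<bar>z\<bar> powr (p - 1) else 0)"
      by (auto simp: indicator_def)
    have "((\<lambda>z. indicator {0..r} z * \<bar>z\<bar> powr (p - 1)) has_integral (r powr p / p)) UNIV"
      unfolding eq has_integral_restrict_UNIV by (rule hi)
    from nn_integral_has_integral_lborel[OF _ _ this]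
    have "(\<integral>\<^sup>+z. ennreal (indicator {0..r} z * \<bar>z\<bar> powr (p - 1)) \<partial>lborel) = ennreal (r powr p / p)"
      by simp
    then show ?thesis
      by (simp add: ennreal_mult' ennreal_indicator mult.commute)
  qed
  have neg: "(\<integral>\<^sup>+z. ennreal (\<bar>z\<bar> powr (p - 1)) * indicator {-r..0} z \<partial>lborel)
      = ennreal (r powr p / p)"
  proof -
    have "(\<integral>\<^sup>+z. ennreal (\<bar>z\<bar> powr (p - 1)) * indicator {-r..0} z \<partial>lborel)
        = (\<integral>\<^sup>+z. ennreal (\<bar>z\<bar> powr (p - 1)) * indicator {0..r} z \<partial>lborel)"
      by (subst nn_integral_real_affine[where c = "-1"
          and t = 0]) (auto intro!: nn_integral_cong simp: indicator_def)
    then show ?thesis using pos by simp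
  qed
  have "(\<integral>\<^sup>+z. ennreal (\<bar>z\<bar> powr (p - 1)) * indicator {-r..r} z \<partial>lborel)
      = (\<integral>\<^sup>+z. ennreal (\<bar>z\<bar> powr (p - 1)) * indicator {-r..0} z + ennreal (\<bar>z\<bar> powr (p - 1))
          * indicator {0..r} z \<partial>lborel)"
    using r by (intro nn_integral_cong_AE AE_I[of _ _ "{0}"]) (auto simp: indicator_def)
  also have "\<dots> = ennreal (r powr p / p) + ennreal (r powr p / p)"
    by (subst nn_integral_add) (simp_all add: pos neg)
  also have "\<dots> = ennreal (2 * r powr p / p)"
    using p by (simp flip: ennreal_plus)
  finally show ?thesis .
qed

text \<open>The range \<open>2 * T\<close> accommodates differences of two times bounded by
  \<open>T\<close>, and evenness accommodates the negative frequencies, which contribute at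
  \<open>- z\<close>. The point \<open>z = 0\<close> is excluded because the majorants contain
  negative powers of \<open>\<bar>z\<bar>\<close>, to which \<open>powr\<close> assigns the value 0
  there.\<close>

definition osc_majorant :: "real \<Rightarrow> real \<Rightarrow> real \<Rightarrow> (real \<Rightarrow> real) \<Rightarrow> bool" where
  "osc_majorant a N T \<kappa> \<longleftrightarrow> \<kappa> \<in> borel_measurable borel \<and> (\<forall>z. \<kappa> z \<ge> 0) \<and> (\<forall>z. \<kappa> (- z) = \<kappa> z) \<and>
     (\<forall>z t. z \<noteq> 0 \<longrightarrow> \<bar>t\<bar> \<le> 2 * T \<longrightarrow> norm (osc a N z t) \<le> \<kappa> z)"

lemma ex_osc_majorant:
  assumes a: "a > 1" and \<epsilon>: "0 < \<epsilon>" "\<epsilon> < 1"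
  shows "\<exists>C>0. \<forall>N\<ge>1. \<forall>T\<ge>0. \<exists>\<kappa>. osc_majorant a N T \<kappa> \<and>
      (\<integral>\<^sup>+z. ennreal (\<kappa> z) * indicator {-1..1} z \<partial>lborel)
          \<le> ennreal (C * (N powr \<epsilon> + sqrt (min N (T * N powr a))))"
proof -
  \<comment> \<open>Chosen so that the second derivative of the phase is at least
    \<open>c * \<bar>z\<bar> / N\<close> as soon as \<open>norm_osc_nonstationary\<close> fails to
    apply. \<open>C1\<close> is the constant in
    \<open>N * \<rho> = C1 * (T * N powr a)\<close>.\<close>
  define c where "c = (a - 1) / (8 * 2 powr (a - 1))"
  define C1 where "C1 = 4 * a * 2 powr (a - 1)"
  define C where "C = 12 / \<epsilon> + 8 / sqrt c * 4 * sqrt C1"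
  have c: "c > 0" using a by (simp add: c_def)
  have C1: "C1 \<ge> 1"
  proof -
    have "1 \<le> 2 powr (a - 1)" using a by (intro ge_one_powr_ge_zero) auto
    then show ?thesis using a mult_mono[of 1 "4 * a" 1 "2 powr (a - 1)"] by (simp add: C1_def)
  qed
  have C: "C > 0" using \<epsilon> c C1 by (simp add: C_def add_pos_nonneg)
  moreover have "\<exists>\<kappa>. osc_majorant a N T \<kappa> \<and>
      (\<integral>\<^sup>+z. ennreal (\<kappa> z) * indicator {-1..1} z \<partial>lborel)
          \<le> ennreal (C * (N powr \<epsilon> + sqrt (min N (T * N powr a))))"
    if N: "N \<ge> 1" and T: "T \<ge> 0" for N T
  proof -
    define \<rho> where "\<rho> = 4 * a * T * (2 * N) powr (a - 1)"
    \<comment> \<open>Only \<open>\<bar>z\<bar> \<le> 1\<close> is integrated over, so the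
      stationary term extends to \<open>r\<close> and contributes a multiple of
      \<open>sqrt (N * r)\<close>, where \<open>N * r\<close> is at most \<open>C1\<close> times
      \<open>min N (T * N powr a)\<close>.\<close>
    define r where "r = min 1 \<rho>"
    define \<kappa> where "\<kappa> z = 6 * N powr \<epsilon> * \<bar>z\<bar> powr (\<epsilon> - 1) + 8 / sqrt c * sqrt N
        * (\<bar>z\<bar> powr (1/2 - 1) * indicator {-\<rho>..\<rho>} z)" for z :: real
    have \<rho>: "\<rho> \<ge> 0" using a T by (simp add: \<rho>_def)
    then have r: "r \<ge> 0" by (simp add: r_def)
    have bound: "norm (osc a N z t) \<le> \<kappa> z" if z: "z \<noteq> 0" and t: "\<bar>t\<bar> \<le> 2 * T" for z t
    proof (cases "2 * a * \<bar>t\<bar> * (2 * N) powr (a - 1) \<le> \<bar>z\<bar>")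
      case True
      have "norm (osc a N z t) \<le> 6 / \<bar>z\<bar>"
        using N by (intro norm_osc_nonstationary a z True) simp
      moreover have "norm (osc a N z t) \<le> N"
        using N by (intro norm_osc_trivial) simp
      ultimately have "norm (osc a N z t) \<le> min N (6 / \<bar>z\<bar>)" by simp
      \<comment> \<open>The function \<open>6 / \<bar>z\<bar>\<close> is not integrable at 0, and
        truncating it at \<open>N\<close> would produce a logarithm. Interpolating between the two
        bounds keeps a pure power, integrable at the cost of
        \<open>N powr \<epsilon>\<close>.\<close>
      also have "\<dots> = (min N (6 / \<bar>z\<bar>)) powr \<epsilon> * (min N (6 / \<bar>z\<bar>)) powr (1 - \<epsilon>)"
        using N z by (subst powr_add[symmetric]) auto
      also have "\<dots> \<le> N powr \<epsilon> * (6 / \<bar>z\<bar>) powr (1 - \<epsilon>)"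
        using N z \<epsilon> by (intro mult_mono powr_mono2) auto
      also have "(6 / \<bar>z\<bar>) powr (1 - \<epsilon>) = 6 powr (1 - \<epsilon>) * \<bar>z\<bar> powr (\<epsilon> - 1)"
        using z by (simp add: powr_divide powr_diff field_simps)
      also have "(6::real) powr (1 - \<epsilon>) \<le> 6 powr 1"
        using \<epsilon> by (intro powr_mono) auto
      finally have "norm (osc a N z t) \<le> N powr \<epsilon> * (6 * \<bar>z\<bar> powr (\<epsilon> - 1))"
        by (simp add: mult_left_mono mult_right_mono)
      then show ?thesis
        using c N by (simp add: \<kappa>_def mult_ac add_increasing2)
    next
      case False
      then have t1: "\<bar>z\<bar> < 2 * a * \<bar>t\<bar> * (2 * N) powr (a - 1)" by simp
      also have "\<dots> \<le> 2 * a * (2 * T) * (2 * N) powr (a - 1)"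
        using a t by (intro mult_right_mono mult_left_mono) auto
      finally have zr: "\<bar>z\<bar> \<le> \<rho>" by (simp add: \<rho>_def)
      \<comment> \<open>A possible stationary point forces \<open>\<bar>t\<bar>\<close> to be at
        least a multiple of \<open>\<bar>z\<bar> * N powr (1 - a)\<close>; this converts the
        curvature bound in \<open>t\<close> into one in \<open>z\<close> that is uniform over the
        times.\<close>
      have "c * \<bar>z\<bar> / N \<le> \<bar>t\<bar> * a * (a - 1) * (N powr a / (4 * N\<^sup>2))"
      proof -
        have "c * \<bar>z\<bar> / N \<le> c * (2 * a * \<bar>t\<bar> * (2 * N) powr (a - 1)) / N"
          using c N t1 by (intro divide_right_mono mult_left_mono) auto
        also have "\<dots> = \<bar>t\<bar> * a * (a - 1) * (N powr a / (4 * N\<^sup>2))"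
          using N by (simp add: c_def powr_mult powr_diff field_simps power2_eq_square)
        finally show ?thesis .
      qed
      then have "norm (osc a N z t) \<le> 8 / sqrt (c * \<bar>z\<bar> / N)"
        using N c z by (intro norm_osc_second a) auto
      also have "\<dots> = 8 / sqrt c * sqrt N * (\<bar>z\<bar> powr (1/2 - 1))"
        using z by (simp add: real_sqrt_mult real_sqrt_divide powr_minus powr_half_sqrt field_simps)
      finally show ?thesis
        using zr N by (simp add: \<kappa>_def indicator_def abs_le_iff add_increasing)
    qed
    have int: "(\<integral>\<^sup>+z. ennreal (\<kappa> z) * indicator {-1..1} z \<partial>lborel)
        \<le> ennreal (C * (N powr \<epsilon> + sqrt (min N (T * N powr a))))"
    proof -
      have "(\<integral>\<^sup>+z. ennreal (\<kappa> z) * indicator {-1..1} z \<partial>lborel)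
        = (\<integral>\<^sup>+z. ennreal (6 * N powr \<epsilon>) * (ennreal (\<bar>z\<bar> powr (\<epsilon> - 1)) * indicator {-1..1} z)
            + ennreal (8 / sqrt c * sqrt N)
                * (ennreal (\<bar>z\<bar> powr (1/2 - 1)) * indicator {-r..r} z) \<partial>lborel)"
      proof (intro nn_integral_cong)
        fix z
        have e: "ennreal (A * u + K * (v * i))
            = ennreal A * ennreal u + ennreal K * (ennreal v * ennreal i)"
          if "A \<ge> 0" "u \<ge> 0" "K \<ge> 0" "v \<ge> 0" "i \<ge> 0" for A u K v i
          using that by (simp add: ennreal_mult)
        show "ennreal (\<kappa> z) * indicator {-1..1} z
            = ennreal (6 * N powr \<epsilon>) * (ennreal (\<bar>z\<bar> powr (\<epsilon> - 1)) * indicator {-1..1} z)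
            + ennreal (8 / sqrt c * sqrt N) * (ennreal (\<bar>z\<bar> powr (1/2 - 1)) * indicator {-r..r} z)"
        proof (cases "z \<in> {-1..1}")
          case True
          then have "indicator {-\<rho>..\<rho>} z = (indicator {-r..r} z :: real)"
            by (auto simp: r_def indicator_def)
          then have "ennreal (\<kappa> z) = ennreal (6 * N powr \<epsilon>) * ennreal (\<bar>z\<bar> powr (\<epsilon> - 1))
            + ennreal (8 / sqrt c * sqrt N)
                * (ennreal (\<bar>z\<bar> powr (1/2 - 1)) * ennreal (indicator {-r..r} z))"
            unfolding \<kappa>_def using c N by (simp only:) (rule e; simp)
          then show ?thesis
            using True by (simp add: ennreal_indicator)
        qed (auto simp: r_def indicator_def)
      qed
      also have "\<dots> = ennreal (6 * N powr \<epsilon>) * ennreal (2 * 1 powr \<epsilon> / \<epsilon>)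
          + ennreal (8 / sqrt c * sqrt N) * ennreal (2 * r powr (1/2) / (1/2))"
        using nn_integral_powr_near_0[OF \<epsilon>(1), of 1] nn_integral_powr_near_0[of "1/2" r] r
        by (subst nn_integral_add) (simp_all add: nn_integral_cmult)
      also have "\<dots> = ennreal (6 * N powr \<epsilon> * (2 / \<epsilon>) + 8 / sqrt c * sqrt N * (4 * sqrt r))"
        using c N \<epsilon> r by (simp add: powr_half_sqrt flip: ennreal_mult ennreal_plus)
      also have "\<dots> \<le> ennreal (C * (N powr \<epsilon> + sqrt (min N (T * N powr a))))"
      proof (rule ennreal_leI)
        have "N * r \<le> C1 * min N (T * N powr a)"
        proof -
          have "N * r \<le> 1 * N" "1 * N \<le> C1 * N" using N C1 by (auto simp: r_def)
          moreover have "N * r \<le> N * \<rho>" using N by (auto simp: r_def)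
          moreover have "N * \<rho> = C1 * (T * N powr a)"
            using N by (simp add: \<rho>_def C1_def powr_mult powr_diff)
          ultimately show ?thesis
            by (auto simp: min_def)
        qed
        then have "sqrt N * sqrt r \<le> sqrt C1 * sqrt (min N (T * N powr a))"
          by (simp flip: real_sqrt_mult)
        then have "8 / sqrt c * 4 * (sqrt N * sqrt r)
            \<le> 8 / sqrt c * 4 * (sqrt C1 * sqrt (min N (T * N powr a)))"
          using c by (intro mult_left_mono) auto
        moreover have "C * (N powr \<epsilon> + sqrt (min N (T * N powr a)))
            = 12 / \<epsilon> * N powr \<epsilon> + 8 / sqrt c * 4 * (sqrt C1 * sqrt (min N (T * N powr a)))
             + (8 / sqrt c * 4 * sqrt C1 * N powr \<epsilon> + 12 / \<epsilon> * sqrt (min N (T * N powr a)))"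
          by (simp add: C_def algebra_simps add_divide_distrib)
        moreover have "8 / sqrt c * 4 * sqrt C1 * N powr \<epsilon> + 12 / \<epsilon> * sqrt (min N (T * N powr a))
            \<ge> 0"
          using c C1 \<epsilon> N T by simp
        ultimately show "6 * N powr \<epsilon> * (2 / \<epsilon>) + 8 / sqrt c * sqrt N * (4 * sqrt r)
            \<le> C * (N powr \<epsilon> + sqrt (min N (T * N powr a)))"
          by (simp add: mult_ac)
      qed
      finally show ?thesis .
    qed
    show ?thesis
    proof (intro exI[of _ \<kappa>] conjI int)
      have "\<kappa> \<in> borel_measurable borel" unfolding \<kappa>_def[abs_def] by measurable
      moreover have "\<kappa> z \<ge> 0" for z using c N by (simp add: \<kappa>_def)
      moreover have "\<kappa> (- z) = \<kappa> z" for z by (simp add: \<kappa>_def indicator_def) auto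
      ultimately show "osc_majorant a N T \<kappa>"
        using bound by (auto simp: osc_majorant_def)
    qed
  qed
  ultimately show ?thesis by blast
qed

section \<open>The linearized maximal function\<close>

text \<open>Half-open, so that the annuli with \<open>N = 2 ^ k\<close> are disjoint and fill
  \<open>\<bar>\<xi>\<bar> \<ge> 1\<close>.\<close>

definition annulus :: "real \<Rightarrow> real set" where
  "annulus N = {\<xi>. N \<le> \<bar>\<xi>\<bar> \<and> \<bar>\<xi>\<bar> < 2 * N}"

lemma annulus_sets [measurable]: "annulus N \<in> sets borel"
  unfolding annulus_def by measurable

lemma annulus_bounded: "bounded (annulus N)"
  by (rule bounded_subset[of "{-2 * N..2 * N}"]) (auto simp: annulus_def)

lemma finite_measure_density_indicator:
  fixes S :: "real set"
  assumes [measurable]: "S \<in> sets borel" and "bounded S"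
  shows "finite_measure (density lborel (indicator S))"
proof
  have "emeasure lborel S < \<infinity>"
    using emeasure_bounded_finite[OF assms(2)] by simp
  then show "emeasure (density lborel (indicator S)) (space (density lborel (indicator S))) \<noteq> \<infinity>"
    by (simp add: emeasure_density)
qed

text \<open>The pointwise inequality \<open>u \<le> 1 + u\<^sup>2\<close> on the bounded set
  \<open>S\<close> suffices.\<close>

lemma integrable_of_square_integrable:
  fixes g :: "real \<Rightarrow> complex"
  assumes [measurable]: "S \<in> sets borel" and S: "bounded S"
    and [measurable]: "g \<in> borel_measurable borel" and supp: "\<And>\<xi>. \<xi> \<notin> S \<Longrightarrow> g \<xi> = 0"
    and g2: "square_integrable g"
  shows "integrable lborel g"
proof (rule Bochner_Integration.integrable_bound)
  show "integrable lborel (\<lambda>\<xi>. indicat_real S \<xi> + (norm (g \<xi>))\<^sup>2)"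
    using emeasure_bounded_finite[OF S] g2
    by (intro Bochner_Integration.integrable_add integrable_real_indicator) auto
  have "norm (g \<xi>) \<le> indicat_real S \<xi> + (norm (g \<xi>))\<^sup>2" for \<xi>
  proof (cases "\<xi> \<in> S")
    case True
    have "norm (g \<xi>) \<le> 1 + (norm (g \<xi>))\<^sup>2"
      using sum_squares_bound[of 1 "norm (g \<xi>)"]
      by (simp add: algebra_simps) (smt (verit) norm_ge_zero)
    then show ?thesis using True by simp
  qed (simp add: supp)
  then show "AE \<xi> in lborel. norm (g \<xi>) \<le> norm (indicat_real S \<xi> + (norm (g \<xi>))\<^sup>2)"
    by (intro AE_I2) (simp add: order_trans[OF _ abs_ge_self])
qed simp

text \<open>Joint measurability in time and position is what permits the time to be a function of
  \<open>x\<close>.\<close>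

lemma measurable_evol [measurable]:
  assumes [measurable]: "g \<in> borel_measurable borel" "\<tau> \<in> borel_measurable M"
      "\<sigma> \<in> borel_measurable M"
  shows "(\<lambda>x. evol a g (\<tau> x) (\<sigma> x)) \<in> borel_measurable M"
proof -
  have "(\<lambda>p. evol a g (fst p) (snd p)) \<in> borel_measurable (borel \<Otimes>\<^sub>M borel)"
    unfolding evol_def by measurable
  from measurable_compose[OF _ this, of "\<lambda>x. (\<tau> x, \<sigma> x)" M] show ?thesis by simp
qed

text \<open>The dispersion \<open>\<bar>\<xi>\<bar> powr a\<close> is even, so reflecting the
  negative frequencies merely changes the sign of \<open>x\<close>.\<close>

lemma norm_annulus_kernel_le:
  assumes N: "N > 0"
  shows "norm (LINT \<xi>|lborel. indicator (annulus N) \<xi> *\<^sub>R cis (x * \<xi> + t * \<bar>\<xi>\<bar> powr a))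
      \<le> norm (osc a N x t) + norm (osc a N (- x) t)"
proof -
  have fin: "integrable lborel (\<lambda>\<xi>. indicator S \<xi> *\<^sub>R cis (y * \<xi> + t * \<bar>\<xi>\<bar> powr a))"
    if S: "S \<in> sets borel" "bounded S" for S and y
  proof (rule integrable_of_square_integrable[OF S])
    show "integrable lborel (\<lambda>\<xi>. (norm (indicat_real S \<xi> *\<^sub>R cis (y * \<xi> + t * \<bar>\<xi>\<bar> powr a)))\<^sup>2)"
    proof -
      have eq: "(\<lambda>\<xi>. (norm (indicat_real S \<xi> *\<^sub>R cis (y * \<xi> + t * \<bar>\<xi>\<bar> powr a)))\<^sup>2) = indicat_real S"
        by (auto simp: indicator_def)
      show ?thesis
        unfolding eq using S emeasure_bounded_finite[OF S(2)]
        by (intro integrable_real_indicator) auto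
    qed
  qed (use S in auto)
  have pos: "(LINT \<xi>|lborel. indicator {N..<2 * N} \<xi> *\<^sub>R cis (y * \<xi> + t * \<bar>\<xi>\<bar> powr a))
      = osc a N y t" for y
  proof -
    have "(LINT \<xi>|lborel. indicator {N..<2 * N} \<xi> *\<^sub>R cis (y * \<xi> + t * \<bar>\<xi>\<bar> powr a))
        = (LINT \<xi>|lborel. indicator {N..2 * N} \<xi> *\<^sub>R cis (y * \<xi> + t * \<bar>\<xi>\<bar> powr a))"
      by (rule integral_cong_AE) (auto intro!: AE_I[of _ _ "{2 * N}"] simp: indicator_def)
    also have "\<dots> = integral {N..2 * N} (\<lambda>\<xi>. cis (y * \<xi> + t * \<bar>\<xi>\<bar> powr a))"
      using fin[of "{N..2 * N}" y]
      by (subst set_borel_integral_eq_integral(2)[symmetric])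
          (auto simp: set_integrable_def set_lebesgue_integral_def)
    also have "\<dots> = osc a N y t"
      unfolding osc_def using N by (intro Henstock_Kurzweil_Integration.integral_cong) auto
    finally show ?thesis .
  qed
  have neg: "(LINT \<xi>|lborel. indicator {- (2 * N)<..- N} \<xi> *\<^sub>R cis (x * \<xi> + t * \<bar>\<xi>\<bar> powr a))
      = osc a N (- x) t"
    unfolding pos[of "- x", symmetric]
    by (subst lborel_integral_real_affine[where c = "- 1" and t = 0])
       (auto intro!: Bochner_Integration.integral_cong simp: indicator_def)
  have "(LINT \<xi>|lborel. indicator (annulus N) \<xi> *\<^sub>R cis (x * \<xi> + t * \<bar>\<xi>\<bar> powr a))
      = (LINT \<xi>|lborel. indicator {N..<2 * N} \<xi> *\<^sub>R cis (x * \<xi> + t * \<bar>\<xi>\<bar> powr a)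
          + indicator {- (2 * N)<..- N} \<xi> *\<^sub>R cis (x * \<xi> + t * \<bar>\<xi>\<bar> powr a))"
    using N by (intro Bochner_Integration.integral_cong)
        (auto simp: annulus_def indicator_def abs_if)
  also have "\<dots> = osc a N x t + osc a N (- x) t"
    using fin[of "{N..<2 * N}" x] fin[of "{- (2 * N)<..- N}" x] by (simp add: pos neg)
  finally show ?thesis
    by (simp add: norm_triangle_ineq)
qed

text \<open>The TT* kernel at \<open>(x, y)\<close> is the annulus kernel at \<open>x - y\<close>
  and \<open>\<tau> x - \<tau> y\<close>. The majorant forgets the time difference, so the Schur
  integral becomes that of a function of \<open>x - y\<close> over a unit interval, whatever
  \<open>\<tau>\<close> is. The factor 2 counts the two signs of the frequency.\<close>

lemma linearized_maximal_bound:
  assumes N: "N \<ge> 1" and T: "\<And>x. \<bar>\<tau> x\<bar> \<le> T"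
    and [measurable]: "\<tau> \<in> borel_measurable borel" "g \<in> borel_measurable borel"
    and maj: "osc_majorant a N T \<kappa>"
    and supp: "\<And>\<xi>. \<xi> \<notin> annulus N \<Longrightarrow> g \<xi> = 0"
    and g2: "square_integrable g"
  shows "(\<integral>\<^sup>+x. ennreal ((norm (evol a g (\<tau> x) x))\<^sup>2) * indicator {c..c+1} x \<partial>lborel)
    \<le> (2 * (\<integral>\<^sup>+z. ennreal (\<kappa> z) * indicator {-1..1} z \<partial>lborel)) * (\<integral>\<^sup>+\<xi>. (norm (g \<xi>))\<^sup>2 \<partial>lborel)"
proof -
  have [measurable]: "\<kappa> \<in> borel_measurable borel"
    and \<kappa>: "\<And>z. \<kappa> z \<ge> 0" "\<And>z. \<kappa> (- z) = \<kappa> z" "\<And>z t. z \<noteq> 0 \<Longrightarrow> \<bar>t\<bar> \<le> 2 * T \<Longrightarrow> norm (osc a N z t) \<le> \<kappa> z"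
    using maj by (auto simp: osc_majorant_def)
  define M1 where "M1 = density lborel (indicator {c..c+1})"
  define M2 where "M2 = density lborel (indicator (annulus N))"
  define e where "e x \<xi> = cis (x * \<xi> + \<tau> x * \<bar>\<xi>\<bar> powr a)" for x \<xi>
  have M: "finite_measure M1" "finite_measure M2"
    unfolding M1_def M2_def by (intro finite_measure_density_indicator annulus_bounded; simp)+
  have [measurable_cong]: "sets M1 = sets borel" "sets M2 = sets borel"
    by (simp_all add: M1_def M2_def)
  have gi: "integrable lborel g"
    by (rule integrable_of_square_integrable[OF _ annulus_bounded _ supp g2]) auto
  have int_M2: "(LINT \<xi>|M2. f \<xi>) = (LINT \<xi>|lborel. indicator (annulus N) \<xi> *\<^sub>R f \<xi>)"
    if "f \<in> borel_measurable borel" for f :: "real \<Rightarrow> complex"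
    unfolding M2_def using that integral_density[of f lborel "indicat_real (annulus N)"]
    by (simp add: ennreal_indicator)
  have nn_M2: "(\<integral>\<^sup>+\<xi>. f \<xi> \<partial>M2) = (\<integral>\<^sup>+\<xi>. indicator (annulus N) \<xi> * f \<xi> \<partial>lborel)"
    if "f \<in> borel_measurable borel" for f
    unfolding M2_def using that by (subst nn_integral_density) auto
  have nn_M1: "(\<integral>\<^sup>+x. f x \<partial>M1) = (\<integral>\<^sup>+x. indicator {c..c+1} x * f x \<partial>lborel)"
    if "f \<in> borel_measurable borel" for f
    unfolding M1_def using that by (subst nn_integral_density) auto
  have ge: "indicator (annulus N) \<xi> *\<^sub>R (f * g \<xi>) = f * g \<xi>" for f \<xi>
    using supp by (auto simp: indicator_def)
  have gM2: "integrable M2 g"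
    unfolding M2_def using gi supp
    by (subst integrable_density[where g = "indicat_real (annulus N)", unfolded ennreal_indicator])
       (auto simp: indicator_def intro!:
           Bochner_Integration.integrable_cong[THEN iffD1, OF refl _ gi])
  have ev: "(LINT \<xi>|M2. e x \<xi> * g \<xi>) = evol a g (\<tau> x) x" for x
    by (subst int_M2) (auto simp: e_def ge evol_def)
  have "(\<integral>\<^sup>+x. (norm (LINT \<xi>|M2. e x \<xi> * g \<xi>))\<^sup>2 \<partial>M1)
      \<le> (2 * (\<integral>\<^sup>+z. ennreal (\<kappa> z) * indicator {-1..1} z \<partial>lborel)) * (\<integral>\<^sup>+\<xi>. (norm (g \<xi>))\<^sup>2 \<partial>M2)"
  proof (rule TTstar_bound[OF M _ _ gM2])
    show "case_prod e \<in> borel_measurable (M1 \<Otimes>\<^sub>M M2)"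
      unfolding e_def case_prod_beta' by measurable
    have "(\<integral>\<^sup>+y. norm (LINT \<xi>|M2. e x \<xi> * cnj (e y \<xi>)) \<partial>M1)
        \<le> 2 * (\<integral>\<^sup>+z. ennreal (\<kappa> z) * indicator {-1..1} z \<partial>lborel)"
      if x: "x \<in> {c..c+1}" for x
    proof -
      have k: "norm (LINT \<xi>|M2. e x \<xi> * cnj (e y \<xi>)) \<le> 2 * \<kappa> (x - y)" if "y \<noteq> x" for y
      proof -
        have "(LINT \<xi>|M2. e x \<xi> * cnj (e y \<xi>))
            = (LINT \<xi>|lborel. indicator (annulus N) \<xi> *\<^sub>R cis ((x - y) * \<xi>
                + (\<tau> x - \<tau> y) * \<bar>\<xi>\<bar> powr a))"
          by (subst int_M2) (auto simp: e_def cis_cnj cis_mult algebra_simps)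
        also have "norm \<dots> \<le> norm (osc a N (x - y) (\<tau> x - \<tau> y))
            + norm (osc a N (- (x - y)) (\<tau> x - \<tau> y))"
          using N by (intro norm_annulus_kernel_le) simp
        also have "\<dots> \<le> \<kappa> (x - y) + \<kappa> (- (x - y))"
          using that T[of x] T[of y] by (intro add_mono \<kappa>(3)) auto
        finally show ?thesis using \<kappa>(2)[of "x - y"] by simp
      qed
      have "(\<integral>\<^sup>+y. norm (LINT \<xi>|M2. e x \<xi> * cnj (e y \<xi>)) \<partial>M1)
          = (\<integral>\<^sup>+y. indicator {c..c+1} y * ennreal (norm (LINT \<xi>|M2. e x \<xi> * cnj (e y \<xi>))) \<partial>lborel)"
      proof (rule nn_M1)
        interpret M2: finite_measure M2 by fact
        show "(\<lambda>y. ennreal (norm (LINT \<xi>|M2. e x \<xi> * cnj (e y \<xi>)))) \<in> borel_measurable borel"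
          unfolding e_def by measurable
      qed
      also have "\<dots> \<le> (\<integral>\<^sup>+y. 2 * (ennreal (\<kappa> (x - y)) * indicator {-1..1} (x - y)) \<partial>lborel)"
      proof (rule nn_integral_mono_AE, use AE_lborel_singleton[of x] in eventually_elim)
        case (elim y)
        then have "ennreal (norm (LINT \<xi>|M2. e x \<xi> * cnj (e y \<xi>))) \<le> ennreal (2 * \<kappa> (x - y))"
          by (intro ennreal_leI k)
        also have "\<dots> = 2 * ennreal (\<kappa> (x - y))"
          using \<kappa>(1) by (simp add: ennreal_mult)
        finally show ?case
          using x by (auto simp: indicator_def)
      qed
      also have "\<dots> = 2 * (\<integral>\<^sup>+y. ennreal (\<kappa> (x - y)) * indicator {-1..1} (x - y) \<partial>lborel)"
        by (rule nn_integral_cmult) measurable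
      also have "(\<integral>\<^sup>+y. ennreal (\<kappa> (x - y)) * indicator {-1..1} (x - y) \<partial>lborel)
          = (\<integral>\<^sup>+z. ennreal (\<kappa> z) * indicator {-1..1} z \<partial>lborel)"
        by (subst nn_integral_real_affine[where c = "- 1" and t = x]) (auto simp: )
      finally show ?thesis .
    qed
    then show "AE x in M1. (\<integral>\<^sup>+y. norm (LINT \<xi>|M2. e x \<xi> * cnj (e y \<xi>)) \<partial>M1)
        \<le> 2 * (\<integral>\<^sup>+z. ennreal (\<kappa> z) * indicator {-1..1} z \<partial>lborel)"
      unfolding M1_def by (subst AE_density) (auto simp: indicator_def)
  qed (simp add: e_def)
  moreover have "(\<integral>\<^sup>+x. (norm (LINT \<xi>|M2. e x \<xi> * g \<xi>))\<^sup>2 \<partial>M1)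
      = (\<integral>\<^sup>+x. ennreal ((norm (evol a g (\<tau> x) x))\<^sup>2) * indicator {c..c+1} x \<partial>lborel)"
    unfolding ev by (subst nn_M1) (auto simp: mult.commute)
  moreover have "(\<integral>\<^sup>+\<xi>. (norm (g \<xi>))\<^sup>2 \<partial>M2) = (\<integral>\<^sup>+\<xi>. (norm (g \<xi>))\<^sup>2 \<partial>lborel)"
    by (subst nn_M2) (auto simp: supp indicator_def intro!: nn_integral_cong)
  ultimately show ?thesis by simp
qed

text \<open>For finitely many times a measurable choice of the best one is elementary: the induction
  step compares the new time with the best of the old ones.\<close>

lemma finite_sup_attained:
  assumes "finite F" "F \<noteq> {}" and [measurable]: "g \<in> borel_measurable borel"
  shows "\<exists>\<tau>. \<tau> \<in> borel_measurable borel \<and> (\<forall>x. \<tau> x \<in> F) \<and>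
      (\<forall>x. \<forall>t\<in>F. norm (evol a g t x) \<le> norm (evol a g (\<tau> x) x))"
  using assms(1,2)
proof (induction F rule: finite_ne_induct)
  case (singleton t)
  show ?case by (rule exI[of _ "\<lambda>_. t"]) auto
next
  case (insert t F)
  then obtain \<tau> where [measurable]: "\<tau> \<in> borel_measurable borel" and \<tau>: "\<And>x. \<tau> x \<in> F"
    "\<And>x s. s \<in> F \<Longrightarrow> norm (evol a g s x) \<le> norm (evol a g (\<tau> x) x)" by blast
  define \<tau>' where "\<tau>' x = (if norm (evol a g (\<tau> x) x) \<le> norm (evol a g t x) then t else \<tau> x)" for x
  have "\<tau>' \<in> borel_measurable borel"
    unfolding \<tau>'_def[abs_def] by measurable
  moreover have "norm (evol a g s x) \<le> norm (evol a g (\<tau>' x) x)" if "s \<in> insert t F" for s x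
    using that \<tau>(2)[of s x] by (auto simp: \<tau>'_def)
  ultimately show ?case
    using \<tau>(1) by (intro exI[of _ \<tau>']) (auto simp: \<tau>'_def)
qed

text \<open>The linearized bound is uniform in \<open>\<tau>\<close>, hence in the finite set of
  times from which \<open>\<tau>\<close> selects; finite sets increase to \<open>D\<close>, and
  monotone convergence applies.\<close>

lemma countable_maximal_bound:
  assumes a: "a > 1" and \<epsilon>: "0 < \<epsilon>" "\<epsilon> < 1"
  obtains C where "C > 0" and
      "\<And>N T D g c. N \<ge> 1 \<Longrightarrow> T \<ge> 0 \<Longrightarrow> countable D \<Longrightarrow> (\<forall>t\<in>D. \<bar>t\<bar> \<le> T) \<Longrightarrow> g \<in> borel_measurable borel \<Longrightarrow>
      (\<forall>\<xi>. \<xi> \<notin> annulus N \<longrightarrow> g \<xi> = 0) \<Longrightarrow> square_integrable g \<Longrightarrow>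
      (\<integral>\<^sup>+x. (SUP t\<in>D. ennreal ((norm (evol a g t x))\<^sup>2)) * indicator {c..c+1} x \<partial>lborel)
      \<le> ennreal (C * (N powr \<epsilon> + sqrt (min N (T * N powr a))) * (L2sq g))"
proof -
  obtain C where C: "C > 0" and maj: "\<And>N T. N \<ge> 1 \<Longrightarrow> T \<ge> 0 \<Longrightarrow> \<exists>\<kappa>. osc_majorant a N T \<kappa> \<and>
      (\<integral>\<^sup>+z. ennreal (\<kappa> z) * indicator {-1..1} z \<partial>lborel)
          \<le> ennreal (C * (N powr \<epsilon> + sqrt (min N (T * N powr a))))"
    using ex_osc_majorant[OF a \<epsilon>] by blast
  have *: "(\<integral>\<^sup>+x. (SUP t\<in>D. ennreal ((norm (evol a g t x))\<^sup>2)) * indicator {c..c+1} x \<partial>lborel)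
      \<le> ennreal (2 * C * (N powr \<epsilon> + sqrt (min N (T * N powr a))) * (L2sq g))"
    if N: "N \<ge> 1" and T: "T \<ge> 0" and D: "countable D" and DT: "\<forall>t\<in>D. \<bar>t\<bar> \<le> T"
        and [measurable]: "g \<in> borel_measurable borel"
      and supp: "\<forall>\<xi>. \<xi> \<notin> annulus N \<longrightarrow> g \<xi> = 0" and g2: "square_integrable g" for N T D g c
  proof (cases "D = {}")
    case False
    define d where "d = from_nat_into D"
    have d: "d ` UNIV = D" unfolding d_def using range_from_nat_into[OF False D] .
    define B where "B = C * (N powr \<epsilon> + sqrt (min N (T * N powr a)))"
    have B: "B \<ge> 0" using C N T by (simp add: B_def)
    obtain \<kappa> where \<kappa>: "osc_majorant a N T \<kappa>"
        and \<kappa>_int: "(\<integral>\<^sup>+z. ennreal (\<kappa> z) * indicator {-1..1} z \<partial>lborel) \<le> ennreal B"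
      using maj[OF N T] unfolding B_def by blast
    let ?G = "L2sq g"
    have G: "(\<integral>\<^sup>+\<xi>. (norm (g \<xi>))\<^sup>2 \<partial>lborel) = ennreal ?G"
      by (rule nn_integral_eq_integral[OF g2]) simp
    define f where "f n x = (SUP i\<in>{..n::nat}. ennreal ((norm (evol a g (d i) x))\<^sup>2))
        * indicator {c..c+1} x" for n x
    have fm[measurable]: "f n \<in> borel_measurable borel" for n
      unfolding f_def[abs_def] by measurable
    have mono: "incseq f"
      unfolding incseq_def le_fun_def f_def by (auto intro!: mult_right_mono SUP_subset_mono)
    have fin: "(\<integral>\<^sup>+x. f n x \<partial>lborel) \<le> ennreal (2 * B * ?G)" for n
    proof -
      obtain \<tau> where [measurable]: "\<tau> \<in> borel_measurable borel" and \<tau>: "\<And>x. \<tau> x \<in> d ` {..n}"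
        "\<And>x t. t \<in> d ` {..n} \<Longrightarrow> norm (evol a g t x) \<le> norm (evol a g (\<tau> x) x)"
        using finite_sup_attained[of "d ` {..n}" g a] by auto
      have "f n x \<le> ennreal ((norm (evol a g (\<tau> x) x))\<^sup>2) * indicator {c..c+1} x" for x
        unfolding f_def using \<tau>(2) by (intro mult_right_mono SUP_least ennreal_leI power_mono) auto
      then have "(\<integral>\<^sup>+x. f n x \<partial>lborel)
          \<le> (\<integral>\<^sup>+x. ennreal ((norm (evol a g (\<tau> x) x))\<^sup>2) * indicator {c..c+1} x \<partial>lborel)"
        by (intro nn_integral_mono) simp
      also have "\<dots> \<le> (2 * (\<integral>\<^sup>+z. ennreal (\<kappa> z) * indicator {-1..1} z \<partial>lborel))
          * (\<integral>\<^sup>+\<xi>. (norm (g \<xi>))\<^sup>2 \<partial>lborel)"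
      proof (rule linearized_maximal_bound[OF N])
        show "\<bar>\<tau> x\<bar> \<le> T" for x using \<tau>(1)[of x] d DT by auto
      qed (use \<kappa> supp g2 in auto)
      also have "\<dots> \<le> (2 * ennreal B) * ennreal ?G"
        unfolding G using \<kappa>_int by (intro mult_right_mono mult_left_mono) auto
      also have "\<dots> = ennreal (2 * B * ?G)"
        using B by (simp add: ennreal_mult integral_nonneg_AE)
      finally show ?thesis .
    qed
    have "(SUP t\<in>D. ennreal ((norm (evol a g t x))\<^sup>2)) * indicator {c..c+1} x = (SUP n. f n x)"
        for x
    proof -
      have "(SUP t\<in>D. ennreal ((norm (evol a g t x))\<^sup>2))
          = (SUP n. SUP i\<in>{..n}. ennreal ((norm (evol a g (d i) x))\<^sup>2))"
        unfolding d[symmetric] by (intro antisym SUP_least SUP_mono')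
            (auto intro!: SUP_upper2 SUP_upper)
      then show ?thesis
        unfolding f_def by (simp add: SUP_mult_right_ennreal)
    qed
    then have "(\<integral>\<^sup>+x. (SUP t\<in>D. ennreal ((norm (evol a g t x))\<^sup>2)) * indicator {c..c+1} x \<partial>lborel)
        = (SUP n. \<integral>\<^sup>+x. f n x \<partial>lborel)"
      using mono by (simp add: nn_integral_monotone_convergence_SUP)
    also have "\<dots> \<le> ennreal (2 * B * ?G)"
      using fin by (intro SUP_least)
    finally show ?thesis by (simp add: B_def mult_ac)
  qed (simp add: bot_ennreal)
  show ?thesis
    by (rule that[OF _ *]) (use C in simp)
qed

section \<open>From countably many times to all times; the rate on one annulus\<close>

lemma integrable_bounded_mult:
  fixes f :: "real \<Rightarrow> complex" and h :: "real \<Rightarrow> real"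
  assumes f: "integrable lborel f" and [measurable]: "h \<in> borel_measurable borel"
    and b: "\<And>x. f x \<noteq> 0 \<Longrightarrow> \<bar>h x\<bar> \<le> B"
  shows "integrable lborel (\<lambda>x. of_real (h x) * f x)"
proof (rule Bochner_Integration.integrable_bound[OF integrable_mult_right[OF f, of "of_real B"]])
  have [measurable]: "f \<in> borel_measurable borel"
    using f by (auto dest: borel_measurable_integrable)
  show "(\<lambda>x. of_real (h x) * f x) \<in> borel_measurable lborel" by measurable
  have "\<bar>h x\<bar> * norm (f x) \<le> \<bar>B\<bar> * norm (f x)" for x
    using b[of x] by (cases "f x = 0") (auto intro!: mult_right_mono)
  then show "AE x in lborel. norm (of_real (h x) * f x) \<le> norm (of_real B * f x)"
    by (intro AE_I2) (simp add: norm_mult)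
qed

lemma evol_has_vector_derivative:
  assumes g: "integrable lborel g" and b: "\<And>\<xi>. g \<xi> \<noteq> 0 \<Longrightarrow> \<bar>\<xi>\<bar> powr a \<le> B"
  shows "((\<lambda>t. evol a g t x) has_vector_derivative \<i>
      * evol a (\<lambda>\<xi>. of_real (\<bar>\<xi>\<bar> powr a) * g \<xi>) t x) (at t)"
proof -
  have [measurable]: "g \<in> borel_measurable borel"
    using g by (auto dest: borel_measurable_integrable)
  have eq: "cis (x * \<xi> + t * \<bar>\<xi>\<bar> powr a) * v = cis (t * \<bar>\<xi>\<bar> powr a) * (cis (x * \<xi>) * v)" for t \<xi> v
    by (simp add: cis_mult[symmetric])
  have 1: "integrable lborel (\<lambda>\<xi>. cis (x * \<xi>) * g \<xi>)"
    by (intro integrable_cis_mult g) measurable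
  have 2: "integrable lborel (\<lambda>\<xi>. of_real (\<bar>\<xi>\<bar> powr a) * (cis (x * \<xi>) * g \<xi>))"
    by (rule integrable_bounded_mult[OF 1, where B = B]) (use b in auto)
  have 3: "integrable lborel (\<lambda>\<xi>. of_real (\<bar>\<xi>\<bar> powr a)
      * (of_real (\<bar>\<xi>\<bar> powr a) * (cis (x * \<xi>) * g \<xi>)))"
    by (rule integrable_bounded_mult[OF 2, where B = B]) (use b in auto)
  have "((\<lambda>t. evol a g t x) has_vector_derivative
      (LINT \<xi>|lborel. cis (t * \<bar>\<xi>\<bar> powr a)
          * (\<i> * (of_real (\<bar>\<xi>\<bar> powr a) * (cis (x * \<xi>) * g \<xi>))))) (at t)"
    unfolding evol_def eq by (rule integral_cis_has_vector_derivative[OF _ 1 2 3]) measurable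
  also have "(LINT \<xi>|lborel. cis (t * \<bar>\<xi>\<bar> powr a)
      * (\<i> * (of_real (\<bar>\<xi>\<bar> powr a) * (cis (x * \<xi>) * g \<xi>))))
      = \<i> * evol a (\<lambda>\<xi>. of_real (\<bar>\<xi>\<bar> powr a) * g \<xi>) t x"
    unfolding evol_def eq integral_mult_right_zero[symmetric] by (simp add: mult_ac)
  finally show ?thesis .
qed

lemma evol_continuous:
  assumes "integrable lborel g" and "\<And>\<xi>. g \<xi> \<noteq> 0 \<Longrightarrow> \<bar>\<xi>\<bar> powr a \<le> B"
  shows "continuous_on UNIV (\<lambda>t. evol a g t x)"
  by (intro continuous_at_imp_continuous_on ballI
      has_vector_derivative_continuous[OF evol_has_vector_derivative[OF assms]])

text \<open>Continuity in time carries the countable maximal bound over to all times. The rational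
  is sought in an open interval inside \<open>{-T..T}\<close>, which also covers the endpoints
  \<open>t = T\<close> and \<open>t = - T\<close>.\<close>

lemma le_SUP_Rats:
  fixes f :: "real \<Rightarrow> real"
  assumes f: "continuous_on UNIV f" and T: "T > 0" and t: "\<bar>t\<bar> \<le> T" and nonneg: "\<And>q. f q \<ge> 0"
  shows "ennreal (f t) \<le> (SUP q\<in>\<rat> \<inter> {-T..T}. ennreal (f q))"
proof (rule ccontr)
  define S where "S = (SUP q\<in>\<rat> \<inter> {-T..T}. ennreal (f q))"
  assume "\<not> ?thesis"
  then have less: "S < ennreal (f t)" by (simp add: S_def)
  define s where "s = enn2real S"
  have S: "S = ennreal s"
    using order_less_trans[OF less ennreal_less_top] by (simp add: s_def)
  have s0: "s \<ge> 0" by (simp add: s_def)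
  have "ennreal s < ennreal (f t)" using less S by simp
  with s0 have s: "s < f t" "s \<ge> 0" by (simp_all add: ennreal_less_iff)
  have "isCont f t" using f by (simp add: continuous_on_eq_continuous_at)
  then have "\<forall>\<^sub>F y in at t. s < f y"
    using s(1) by (intro order_tendstoD(1)[OF isContD])
  then obtain d where d: "d > 0" "\<And>y. y \<noteq> t \<Longrightarrow> dist y t < d \<Longrightarrow> s < f y"
    unfolding eventually_at by auto
  have "max (- T) (t - d) < min T (t + d)" using T t d(1) by auto
  then obtain q where q: "q \<in> \<rat>" "max (- T) (t - d) < q" "q < min T (t + d)"
    using Rats_dense_in_real by blast
  then have "s < f q"
    using d(2)[of q] s(1) by (cases "q = t") (auto simp: dist_real_def)
  moreover have "ennreal (f q) \<le> S"
    unfolding S_def using q by (intro SUP_upper) auto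
  ultimately show False
    using s(2) by (subst (asm) S) (simp add: ennreal_le_iff)
qed

text \<open>A measurable function takes the place of the supremum over uncountably many times. It
  may be infinite at some points; the inequality is therefore stated as a product in
  \<open>ennreal\<close>, without dividing by the power of \<open>t\<close>.\<close>

definition rate_majorant :: "real \<Rightarrow> real \<Rightarrow> (real \<Rightarrow> complex) \<Rightarrow> real \<Rightarrow> (real \<Rightarrow> ennreal) \<Rightarrow> bool" where
  "rate_majorant a \<delta> g B W \<longleftrightarrow> W \<in> borel_measurable borel \<and>
     (\<forall>x t. t \<noteq> 0 \<longrightarrow> \<bar>t\<bar> \<le> 1 \<longrightarrow>
       ennreal ((norm (evol a g t x - evol a g 0 x))\<^sup>2) \<le> ennreal (\<bar>t\<bar> powr (2 * \<delta>)) * W x) \<and>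
     (\<forall>c. (\<integral>\<^sup>+x. W x * indicator {c..c+1} x \<partial>lborel) \<le> ennreal B)"

text \<open>Instead of maximizing over the dyadic time scales, \<open>W\<close> adds their maximal
  functions. This costs the number of scales, which is of order \<open>log N\<close> and is absorbed
  into a small power of \<open>N\<close>.\<close>

theorem annulus_rate_bound:
  assumes a: "a > 1" and \<delta>: "0 \<le> \<delta>" "\<delta> < 1" and p: "(a - 1) * \<delta> + max \<delta> (1/4) < p"
  obtains C where "C > 0" and
      "\<And>j g. g \<in> borel_measurable borel \<Longrightarrow> (\<forall>\<xi>. \<xi> \<notin> annulus (2 ^ j) \<longrightarrow> g \<xi> = 0) \<Longrightarrow>
      square_integrable g \<Longrightarrow>
      (\<exists>W. rate_majorant a \<delta> g (C * (2 ^ j) powr (2 * p) * (L2sq g)) W)"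
proof -
  define \<sigma> where "\<sigma> = (a - 1) * \<delta> + max \<delta> (1/4)"
  \<comment> \<open>The square of the norm leaves room for \<open>N powr (2 * \<epsilon>)\<close>:
    one factor \<open>N powr \<epsilon>\<close> is lost in the kernel, the other to the number of
    time scales.\<close>
  define \<epsilon> where "\<epsilon> = min (p - \<sigma>) (1/2)"
  have \<epsilon>: "0 < \<epsilon>" "\<epsilon> < 1" "\<sigma> + \<epsilon> \<le> p" using p by (auto simp: \<epsilon>_def \<sigma>_def)
  obtain C where C: "C > 0"
      and maxb: "\<And>N T D g c. N \<ge> 1 \<Longrightarrow> T \<ge> 0 \<Longrightarrow> countable D \<Longrightarrow> (\<forall>t\<in>D. \<bar>t\<bar> \<le> T) \<Longrightarrow>
      g \<in> borel_measurable borel \<Longrightarrow>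
      (\<forall>\<xi>. \<xi> \<notin> annulus N \<longrightarrow> g \<xi> = 0) \<Longrightarrow> square_integrable g \<Longrightarrow>
      (\<integral>\<^sup>+x. (SUP t\<in>D. ennreal ((norm (evol a g t x))\<^sup>2)) * indicator {c..c+1} x \<partial>lborel)
      \<le> ennreal (C * (N powr \<epsilon> + sqrt (min N (T * N powr a))) * (L2sq g))"
    by (rule countable_maximal_bound[OF a \<epsilon>(1,2)]) (rule that)
  \<comment> \<open>From \<open>real L + 1 \<le> a * j + 2\<close> and \<open>u \<le> exp u\<close>
    with \<open>u = \<epsilon> * ln 2 * j\<close>.\<close>
  define K1 where "K1 = a / (\<epsilon> * ln 2) + 2"
  define K where "K = K1 * (128 * C) + 2 * C * 2 powr (2 * a)"
  have K1: "K1 > 0" using a \<epsilon> by (simp add: K1_def add_pos_pos)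
  have K: "K > 0" using C K1 by (simp add: K_def add_pos_pos)
  define D where "D T = \<rat> \<inter> {-T..T}" for T :: real
  have D: "countable (D T)" "\<forall>t\<in>D T. \<bar>t\<bar> \<le> T" for T
    using countable_rat by (auto simp: D_def)
  have *: "\<exists>W. rate_majorant a \<delta> g (K * (2 ^ j) powr (2 * p) * (L2sq g)) W"
    if g[measurable]: "g \<in> borel_measurable borel" and supp: "\<forall>\<xi>. \<xi> \<notin> annulus (2 ^ j) \<longrightarrow> g \<xi> = 0"
      and g2: "square_integrable g" for j g
  proof -
    define N :: real where "N = 2 ^ j"
    have N: "N \<ge> 1" by (simp add: N_def)
    have Npow: "N powr y = 2 powr (real j * y)" for y :: real
      by (simp add: N_def powr_powr flip: powr_realpow)
    \<comment> \<open>Up to the factor \<open>\<i>\<close>, the evolution of \<open>h\<close> is the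
      time derivative of the evolution of \<open>g\<close>; on this annulus its L2 norm exceeds that
      of \<open>g\<close> by at most \<open>(2 * N) powr a\<close>.\<close>
    define h where "h \<xi> = of_real (\<bar>\<xi>\<bar> powr a) * g \<xi>" for \<xi>
    define G where "G = (L2sq g)"
    have G: "G \<ge> 0" by (simp add: G_def)
    have hm[measurable]: "h \<in> borel_measurable borel" unfolding h_def[abs_def] by measurable
    have gi: "integrable lborel g"
      by (rule integrable_of_square_integrable[OF _ annulus_bounded _ _ g2, of
          "2 ^ j"]) (use supp in auto)
    have b: "\<bar>\<xi>\<bar> powr a \<le> (2 * N) powr a" if "g \<xi> \<noteq> 0" for \<xi>
    proof -
      have "\<xi> \<in> annulus (2 ^ j)" using supp that by blast
      then show ?thesis using a by (intro powr_mono2) (auto simp: annulus_def N_def)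
    qed
    have hi: "integrable lborel h"
      unfolding h_def[abs_def] by (rule integrable_bounded_mult[OF gi,
          where B = "(2 * N) powr a"]) (use b in auto)
    have b': "\<bar>\<xi>\<bar> powr a \<le> (2 * N) powr a" if "h \<xi> \<noteq> 0" for \<xi>
      using b that by (auto simp: h_def)
    have h_le: "(norm (h \<xi>))\<^sup>2 \<le> (2 * N) powr (2 * a) * (norm (g \<xi>))\<^sup>2" for \<xi>
    proof (cases "g \<xi> = 0")
      case False
      have "(\<bar>\<xi>\<bar> powr a)\<^sup>2 \<le> ((2 * N) powr a)\<^sup>2"
        by (intro power_mono b False) simp
      also have "\<dots> = (2 * N) powr (2 * a)"
        by (simp add: power2_eq_square flip: powr_add)
      finally show ?thesis
        by (simp add: h_def norm_mult power_mult_distrib mult_right_mono)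
    qed (simp add: h_def)
    have h2: "square_integrable h"
      by (rule Bochner_Integration.integrable_bound[OF integrable_mult_right[OF g2, of
          "(2 * N) powr (2 * a)"]])
         (use h_le in auto)
    have hG: "(L2sq h) \<le> (2 * N) powr (2 * a) * G"
      unfolding G_def integral_mult_right_zero[symmetric] using h2 g2 h_le
      by (intro integral_mono) auto
    have hsupp: "\<forall>\<xi>. \<xi> \<notin> annulus N \<longrightarrow> h \<xi> = 0"
      using supp by (auto simp: h_def N_def)
    define S where "S T x = (SUP t\<in>D T. ennreal ((norm (evol a g t x))\<^sup>2))" for T x
    define S' where "S' x = (SUP t\<in>D (N powr - a). ennreal ((norm (evol a h t x))\<^sup>2))" for x
    \<comment> \<open>Times with \<open>N powr - a < \<bar>t\<bar> \<le> 1\<close> lie in scales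
      \<open>2 powr - l\<close> with \<open>l \<le> L\<close>, and even the smallest of these scales
      is at least \<open>N powr - a / 2\<close>.\<close>
    define L where "L = nat \<lceil>a * j\<rceil>"
    \<comment> \<open>On scale \<open>l\<close> the factor
      \<open>2 powr (2 * (real l + 1) * \<delta>)\<close> bounds
      \<open>\<bar>t\<bar> powr (- 2 * \<delta>)\<close>; the 4 comes from estimating both terms of
      the difference by the same maximal function. In \<open>V'\<close> the factor bounds
      \<open>\<bar>t\<bar> powr (2 - 2 * \<delta>)\<close>, which remains of
      \<open>\<bar>t\<bar>\<^sup>2\<close> after the rate is split off.\<close>
    define V where "V l x = ennreal (4 * 2 powr (2 * (real l + 1) * \<delta>)) * S (2 powr - real l) x"
        for l x
    define V' where "V' x = ennreal (N powr (- 2 * a * (1 - \<delta>))) * S' x" for x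
    define W where "W x = (\<Sum>l\<le>L. V l x) + V' x" for x
    have [measurable]: "S T \<in> borel_measurable borel" "S' \<in> borel_measurable borel" for T
      unfolding S_def[abs_def] S'_def[abs_def] by (intro borel_measurable_SUP D(1); measurable)+
    have [measurable]: "V l \<in> borel_measurable borel" "V' \<in> borel_measurable borel" for l
      unfolding V_def[abs_def] V'_def[abs_def] by measurable
    have W[measurable]: "W \<in> borel_measurable borel"
      unfolding W_def[abs_def] by measurable
    have S_ge: "ennreal ((norm (evol a g t x))\<^sup>2) \<le> S T x" if "T > 0" "\<bar>t\<bar> \<le> T" for t x T
      unfolding S_def D_def using that
      by (intro le_SUP_Rats[where f =
          "\<lambda>t. (norm (evol a g t x))\<^sup>2"] continuous_intros evol_continuous[OF gi b]) auto
    have S'_ge: "ennreal ((norm (evol a h t x))\<^sup>2) \<le> S' x" if "\<bar>t\<bar> \<le> N powr - a" for t x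
      unfolding S'_def D_def using that N
      by (intro le_SUP_Rats[where f =
          "\<lambda>t. (norm (evol a h t x))\<^sup>2"] continuous_intros evol_continuous[OF hi b']) auto
    have pointwise: "ennreal ((norm (evol a g t x - evol a g 0 x))\<^sup>2)
        \<le> ennreal (\<bar>t\<bar> powr (2 * \<delta>)) * W x"
      if t: "t \<noteq> 0" "\<bar>t\<bar> \<le> 1" for x t
    proof (cases "\<bar>t\<bar> \<le> N powr - a")
      case True

      \<comment> \<open>The mean value inequality, with the time derivative maximized over the
        compact interval between \<open>- \<bar>t\<bar>\<close> and
        \<open>\<bar>t\<bar>\<close>.\<close>
      have dbl: "\<exists>\<tau>. \<bar>\<tau>\<bar> \<le> \<bar>t\<bar> \<and> norm (evol a g t x - evol a g 0 x) \<le> \<bar>t\<bar> * norm (evol a h \<tau> x)"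
      proof -
        have "\<exists>\<tau>\<in>{-\<bar>t\<bar>..\<bar>t\<bar>}. \<forall>y\<in>{-\<bar>t\<bar>..\<bar>t\<bar>}. norm (evol a h y x) \<le> norm (evol a h \<tau> x)"
          by (intro continuous_attains_sup continuous_intros
              continuous_on_subset[OF evol_continuous[OF hi b']]) auto
        then obtain \<tau> where \<tau>: "\<tau> \<in> {-\<bar>t\<bar>..\<bar>t\<bar>}"
            "\<And>y. y \<in> {-\<bar>t\<bar>..\<bar>t\<bar>} \<Longrightarrow> norm (evol a h y x) \<le> norm (evol a h \<tau> x)"
          by blast
        have "norm (evol a g t x - evol a g 0 x) \<le> norm (evol a h \<tau> x) * norm (t - 0)"
        proof (rule differentiable_bound[of "{-\<bar>t\<bar>..\<bar>t\<bar>}"])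
          fix y assume "y \<in> {-\<bar>t\<bar>..\<bar>t\<bar>}"
          then have "norm (evol a h y x) \<le> norm (evol a h \<tau> x)" by (rule \<tau>(2))
          then show "onorm (\<lambda>z. z *\<^sub>R (\<i> * evol a h y x)) \<le> norm (evol a h \<tau> x)"
            by (intro onorm_le) (simp add: norm_mult mult.commute mult_left_mono)
          show "((\<lambda>t. evol a g t x) has_derivative (\<lambda>z. z *\<^sub>R (\<i>
              * evol a h y x))) (at y within {-\<bar>t\<bar>..\<bar>t\<bar>})"
            using evol_has_vector_derivative[OF gi b, of x y]
            unfolding has_vector_derivative_def h_def[abs_def] by (rule has_derivative_at_withinI)
        qed auto
        then show ?thesis using \<tau>(1) by (intro exI[of _ \<tau>]) (auto simp: mult.commute)
      qed
      then obtain \<tau> where \<tau>: "\<bar>\<tau>\<bar> \<le> \<bar>t\<bar>"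
          "norm (evol a g t x - evol a g 0 x) \<le> \<bar>t\<bar> * norm (evol a h \<tau> x)" by blast
      have "\<bar>t\<bar>\<^sup>2 = \<bar>t\<bar> powr (2 * \<delta>) * \<bar>t\<bar> powr (2 * (1 - \<delta>))"
        using t by (simp add: powr_add[symmetric] algebra_simps powr_numeral)
      moreover have "\<bar>t\<bar> powr (2 * (1 - \<delta>)) \<le> (N powr - a) powr (2 * (1 - \<delta>))"
        using True \<delta> by (intro powr_mono2) auto
      moreover have "(N powr - a) powr (2 * (1 - \<delta>)) = N powr (- 2 * a * (1 - \<delta>))"
        by (simp add: powr_powr algebra_simps)
      ultimately have t2: "\<bar>t\<bar>\<^sup>2 \<le> \<bar>t\<bar> powr (2 * \<delta>) * N powr (- 2 * a * (1 - \<delta>))"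
        by (simp add: mult_left_mono)
      have "(norm (evol a g t x - evol a g 0 x))\<^sup>2 \<le> (\<bar>t\<bar> * norm (evol a h \<tau> x))\<^sup>2"
        by (intro power_mono \<tau>(2)) simp
      also have "\<dots> = \<bar>t\<bar>\<^sup>2 * (norm (evol a h \<tau> x))\<^sup>2"
        by (simp add: power_mult_distrib)
      also have "\<dots> \<le> \<bar>t\<bar> powr (2 * \<delta>) * N powr (- 2 * a * (1 - \<delta>)) * (norm (evol a h \<tau> x))\<^sup>2"
        by (intro mult_right_mono t2) simp
      finally have "ennreal ((norm (evol a g t x - evol a g 0 x))\<^sup>2)
          \<le> ennreal (\<bar>t\<bar> powr (2 * \<delta>))
              * (ennreal (N powr (- 2 * a * (1 - \<delta>))) * ennreal ((norm (evol a h \<tau> x))\<^sup>2))"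
        by (simp add: mult.assoc flip: ennreal_mult)
      also have "\<dots> \<le> ennreal (\<bar>t\<bar> powr (2 * \<delta>)) * V' x"
        unfolding V'_def using \<tau>(1) True by (intro mult_left_mono S'_ge) auto
      also have "\<dots> \<le> ennreal (\<bar>t\<bar> powr (2 * \<delta>)) * W x"
        unfolding W_def by (intro mult_left_mono) auto
      finally show ?thesis .
    next
      case False
      define l where "l = nat \<lfloor>- log 2 \<bar>t\<bar>\<rfloor>"
      have "- log 2 \<bar>t\<bar> \<ge> 0" using t by simp
      then have l: "real l \<le> - log 2 \<bar>t\<bar>" "- log 2 \<bar>t\<bar> < real l + 1"
        unfolding l_def by linarith+
      have t_eq: "\<bar>t\<bar> = 2 powr (log 2 \<bar>t\<bar>)" using t by simp
      have tl: "\<bar>t\<bar> \<le> 2 powr - real l" "2 powr - (real l + 1) \<le> \<bar>t\<bar>"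
        using l by (subst t_eq; intro powr_mono; simp)+
      have "2 powr (- a * j) < 2 powr (log 2 \<bar>t\<bar>)"
        unfolding t_eq[symmetric] using False by (simp add: Npow mult.commute)
      then have "real l < a * j" using l(1) by simp
      then have lL: "l \<le> L" unfolding L_def by linarith
      have "(norm (evol a g t x - evol a g 0 x))\<^sup>2 \<le> (norm (evol a g t x) + norm (evol a g 0 x))\<^sup>2"
        by (intro power_mono norm_triangle_ineq4) simp
      also have "\<dots> \<le> 2 * (norm (evol a g t x))\<^sup>2 + 2 * (norm (evol a g 0 x))\<^sup>2"
        using sum_squares_bound[of "norm (evol a g t x)" "norm (evol a g 0 x)"]
        by (simp add: power2_sum)
      finally have "ennreal ((norm (evol a g t x - evol a g 0 x))\<^sup>2)
          \<le> 2 * ennreal ((norm (evol a g t x))\<^sup>2) + 2 * ennreal ((norm (evol a g 0 x))\<^sup>2)"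
        by (simp add: ennreal_leI flip: ennreal_plus ennreal_numeral ennreal_mult)
      also have "\<dots> \<le> 2 * S (2 powr - real l) x + 2 * S (2 powr - real l) x"
        using tl by (intro add_mono mult_left_mono S_ge) auto
      also have "\<dots> = 4 * S (2 powr - real l) x"
        by (simp flip: distrib_right)
      also have "\<dots> \<le> ennreal (\<bar>t\<bar> powr (2 * \<delta>)) * V l x"
      proof -
        have "1 = (2 powr - (real l + 1)) powr (2 * \<delta>) * 2 powr (2 * (real l + 1) * \<delta>)"
          by (simp add: powr_powr powr_add[symmetric] algebra_simps)
        also have "\<dots> \<le> \<bar>t\<bar> powr (2 * \<delta>) * 2 powr (2 * (real l + 1) * \<delta>)"
          using tl \<delta> by (intro mult_right_mono powr_mono2) auto
        finally have "ennreal 4 \<le> ennreal (\<bar>t\<bar> powr (2 * \<delta>) * (4 * 2 powr (2 * (real l + 1) * \<delta>)))"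
          by (intro ennreal_leI) simp
        then have "4 * S (2 powr - real l) x
            \<le> ennreal (\<bar>t\<bar> powr (2 * \<delta>) * (4 * 2 powr (2 * (real l + 1) * \<delta>)))
            * S (2 powr - real l) x"
          by (intro mult_right_mono) simp_all
        then show ?thesis
          by (simp add: V_def ennreal_mult mult.assoc)
      qed
      also have "\<dots> \<le> ennreal (\<bar>t\<bar> powr (2 * \<delta>)) * W x"
      proof (intro mult_left_mono)
        have "V l x \<le> (\<Sum>l\<le>L. V l x)" using lL by (intro member_le_sum) auto
        then show "V l x \<le> W x" unfolding W_def by (rule add_increasing2[rotated]) simp
      qed simp
      finally show ?thesis .
    qed
    have int: "(\<integral>\<^sup>+x. W x * indicator {c..c+1} x \<partial>lborel) \<le> ennreal (K * (2 ^ j) powr (2 * p) * G)"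
        for c
    proof -
      have Lb: "real L \<le> a * j + 1"
      proof -
        have "real L = of_int \<lceil>a * j\<rceil>" using a by (simp add: L_def)
        then show ?thesis by linarith
      qed
      have N\<epsilon>: "N powr \<epsilon> \<ge> 1" using N \<epsilon> by (intro ge_one_powr_ge_zero) auto
      have \<sigma>eq: "2 * \<sigma> = 2 * a * \<delta> + max 0 (1/2 - 2 * \<delta>)"
        unfolding \<sigma>_def by (simp add: max_def algebra_simps)
      have Vl: "(\<integral>\<^sup>+x. V l x * indicator {c..c+1} x \<partial>lborel)
          \<le> ennreal (128 * C * N powr (2 * \<sigma> + \<epsilon>) * G)" if l: "l \<le> L" for l
      proof -
        define T where "T = 2 powr - real l"
        \<comment> \<open>In terms of \<open>y\<close>, the time weight equals
          \<open>N powr (2 * a * \<delta>) * y powr (- 2 * \<delta>)\<close> up to a constant. The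
          rounding in \<open>L\<close> only guarantees \<open>y \<ge> 1/2\<close> instead of
          \<open>y \<ge> 1\<close>.\<close>
        define y where "y = T * N powr a"
        define z where "z = min N y"
        have "real l \<le> a * j + 1"
          using l Lb by linarith
        then have "2 powr (-1) \<le> 2 powr (- real l + j * a)"
          by (intro powr_mono) (auto simp: mult.commute)
        also have "2 powr (- real l + j * a) = y"
          by (simp only: y_def T_def Npow powr_add)
        finally have y: "y \<ge> 1/2"
          by (simp add: powr_minus)
        then have z: "z \<ge> 1/2" "z \<le> N" "z \<le> y" using N by (auto simp: z_def)
        have T2: "2 powr (2 * (real l + 1) * \<delta>) \<le> 4 * (N powr (2 * a * \<delta>) * y powr (- 2 * \<delta>))"
        proof -
          have "y powr (- 2 * \<delta>) = T powr (- 2 * \<delta>) * N powr (- 2 * a * \<delta>)"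
            unfolding y_def using N by (simp add: powr_mult powr_powr T_def algebra_simps)
          then have "N powr (2 * a * \<delta>) * y powr (- 2 * \<delta>) = T powr (- 2 * \<delta>)"
            using N by (simp add: powr_minus field_simps)
          also have "\<dots> = 2 powr (2 * real l * \<delta>)"
            by (simp add: T_def powr_powr mult_ac)
          finally have e: "N powr (2 * a * \<delta>) * y powr (- 2 * \<delta>) = 2 powr (2 * real l * \<delta>)" .
          have "2 powr (2 * (real l + 1) * \<delta>) = 2 powr (2 * \<delta>) * 2 powr (2 * real l * \<delta>)"
            by (simp add: powr_add[symmetric] algebra_simps)
          also have "\<dots> \<le> 2 powr 2 * 2 powr (2 * real l * \<delta>)"
            using \<delta> by (intro mult_right_mono powr_mono) auto
          finally show ?thesis unfolding e by simp
        qed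
        have y1: "y powr (- 2 * \<delta>) \<le> 4"
        proof -
          have "y powr (- 2 * \<delta>) \<le> (1/2) powr (- 2 * \<delta>)"
            using y \<delta> by (intro powr_mono2') auto
          also have "\<dots> = 2 powr (2 * \<delta>)" by (simp add: powr_minus powr_divide)
          also have "\<dots> \<le> 2 powr 2" using \<delta> by (intro powr_mono) auto
          finally show ?thesis by simp
        qed
        \<comment> \<open>Since \<open>z \<le> y\<close>, the product is at most
          \<open>z powr (1/2 - 2 * \<delta>)\<close>. Its exponent changes sign at \<delta> = 1/4:
          the largest value occurs at \<open>z = N\<close> below and at \<open>z = 1/2\<close>
          above. This is where the maximum in the theorem arises.\<close>
        have y2: "y powr (- 2 * \<delta>) * sqrt z \<le> 4 * N powr (max 0 (1/2 - 2 * \<delta>))"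
        proof -
          have "y powr (- 2 * \<delta>) * sqrt z \<le> z powr (- 2 * \<delta>) * z powr (1/2)"
            using z \<delta> by (simp add: powr_half_sqrt) (intro mult_right_mono powr_mono2'; simp)
          also have "\<dots> = z powr (1/2 - 2 * \<delta>)" by (simp add: powr_add[symmetric])
          also have "\<dots> \<le> 4 * N powr (max 0 (1/2 - 2 * \<delta>))"
          proof (cases "\<delta> \<le> 1/4")
            case True
            have e: "max 0 (1/2 - 2 * \<delta>) = 1/2 - 2 * \<delta>" using True by simp
            have "z powr (1/2 - 2 * \<delta>) \<le> N powr (1/2 - 2 * \<delta>)"
              using True z by (intro powr_mono2) auto
            also have "\<dots> \<le> 4 * N powr (1/2 - 2 * \<delta>)" by simp
            finally show ?thesis unfolding e .
          next
            case False
            have "z powr (1/2 - 2 * \<delta>) \<le> (1/2) powr (1/2 - 2 * \<delta>)"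
              using False z by (intro powr_mono2') auto
            also have "\<dots> = 2 powr (2 * \<delta> - 1/2)" by (simp add: powr_divide powr_diff)
            also have "\<dots> \<le> 2 powr 2" using \<delta> by (intro powr_mono) auto
            finally show ?thesis using False N by (simp add: max_def)
          qed
          finally show ?thesis .
        qed
        have "y powr (- 2 * \<delta>) * (N powr \<epsilon> + sqrt z) \<le> 8 * N powr (\<epsilon> + max 0 (1/2 - 2 * \<delta>))"
        proof -
          have "y powr (- 2 * \<delta>) * N powr \<epsilon> \<le> 4 * N powr \<epsilon>" by (intro mult_right_mono y1) simp
          also have "\<dots> \<le> 4 * N powr (\<epsilon> + max 0 (1/2 - 2 * \<delta>))" using N
              by (intro mult_left_mono powr_mono) auto
          finally have 1: "y powr (- 2 * \<delta>) * N powr \<epsilon> \<le> 4 * N powr (\<epsilon> + max 0 (1/2 - 2 * \<delta>))" .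
          have "4 * N powr (max 0 (1/2 - 2 * \<delta>)) \<le> 4 * N powr (\<epsilon> + max 0 (1/2 - 2 * \<delta>))"
            using N \<epsilon> by (intro mult_left_mono powr_mono) auto
          with y2 1 show ?thesis by (simp add: distrib_left)
        qed
        then have "4 * (4 * (N powr (2 * a * \<delta>) * (y powr (- 2 * \<delta>) * (N powr \<epsilon> + sqrt z))))
            \<le> 4 * (4 * (N powr (2 * a * \<delta>) * (8 * N powr (\<epsilon> + max 0 (1/2 - 2 * \<delta>)))))"
          by (intro mult_left_mono) auto
        also have "\<dots> = 128 * N powr (2 * \<sigma> + \<epsilon>)"
        proof -
          have e: "2 * \<sigma> + \<epsilon> = 2 * a * \<delta> + (\<epsilon> + max 0 (1/2 - 2 * \<delta>))" using \<sigma>eq by simp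
          show ?thesis unfolding e powr_add[of N "2 * a * \<delta>"] by simp
        qed
        finally have key: "16 * (N powr (2 * a * \<delta>) * y powr (- 2 * \<delta>)) * (N powr \<epsilon> + sqrt z)
            \<le> 128 * N powr (2 * \<sigma> + \<epsilon>)"
          by (simp add: mult_ac)
        have "(\<integral>\<^sup>+x. V l x * indicator {c..c+1} x \<partial>lborel)
            = ennreal (4 * 2 powr (2 * (real l + 1) * \<delta>))
                * (\<integral>\<^sup>+x. S T x * indicator {c..c+1} x \<partial>lborel)"
          unfolding V_def T_def by (simp add: mult.assoc nn_integral_cmult)
        also have "\<dots> \<le> ennreal (4 * 2 powr (2 * (real l + 1) * \<delta>))
            * ennreal (C * (N powr \<epsilon> + sqrt (min N (T * N powr a))) * G)"
          unfolding S_def G_def using N supp g2 D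
          by (intro mult_left_mono maxb) (auto simp: T_def N_def)
        also have "\<dots> = ennreal (4 * 2 powr (2 * (real l + 1) * \<delta>) * (N powr \<epsilon> + sqrt z) * (C * G))"
          using C G N z by (simp add: z_def y_def mult_ac flip: ennreal_mult)
        also have "\<dots> \<le> ennreal (128 * N powr (2 * \<sigma> + \<epsilon>) * (C * G))"
        proof (intro ennreal_leI mult_right_mono)
          have "4 * 2 powr (2 * (real l + 1) * \<delta>) * (N powr \<epsilon> + sqrt z)
              \<le> 4 * (4 * (N powr (2 * a * \<delta>) * y powr (- 2 * \<delta>))) * (N powr \<epsilon> + sqrt z)"
            using z by (intro mult_right_mono mult_left_mono T2) auto
          then show "4 * 2 powr (2 * (real l + 1) * \<delta>) * (N powr \<epsilon> + sqrt z)
              \<le> 128 * N powr (2 * \<sigma> + \<epsilon>)"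
            using key by simp
        qed (use C G in auto)
        finally show ?thesis by (simp add: mult_ac)
      qed
      have V': "(\<integral>\<^sup>+x. V' x * indicator {c..c+1} x \<partial>lborel)
          \<le> ennreal (2 * C * 2 powr (2 * a) * N powr (2 * \<sigma> + \<epsilon>) * G)"
      proof -
        have "(\<integral>\<^sup>+x. V' x * indicator {c..c+1} x \<partial>lborel)
            = ennreal (N powr (- 2 * a * (1 - \<delta>))) * (\<integral>\<^sup>+x. S' x * indicator {c..c+1} x \<partial>lborel)"
          unfolding V'_def by (simp add: mult.assoc nn_integral_cmult)
        also have "\<dots> \<le> ennreal (N powr (- 2 * a * (1 - \<delta>)))
            * ennreal (C * (N powr \<epsilon> + sqrt (min N (N powr - a * N powr a))) * (L2sq h))"
          unfolding S'_def using N hsupp h2 D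
          by (intro mult_left_mono maxb) auto
        also have "\<dots> \<le> ennreal (N powr (- 2 * a * (1 - \<delta>)))
            * ennreal (C * (2 * N powr \<epsilon>) * ((2 * N) powr (2 * a) * G))"
        proof (intro mult_left_mono ennreal_leI mult_mono hG)
          \<comment> \<open>At \<open>T = N powr - a\<close> the minimum under the root is 1: for
            such short times the kernel has no large stationary contribution.\<close>
          have "N powr - a * N powr a = 1" using N by (simp add: powr_add[symmetric])
          then show "N powr \<epsilon> + sqrt (min N (N powr - a * N powr a)) \<le> 2 * N powr \<epsilon>"
            using N N\<epsilon> by (simp add: min_def)
        qed (use C N in auto)
        also have "\<dots> = ennreal (2 * C * 2 powr (2 * a) * N powr (2 * a * \<delta> + \<epsilon>) * G)"
        proof -
          have "N powr (- 2 * a * (1 - \<delta>)) * (C * (2 * N powr \<epsilon>) * ((2 * N) powr (2 * a) * G))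
             = 2 * C * 2 powr (2 * a) * (N powr (- 2 * a * (1 - \<delta>)) * N powr \<epsilon> * N powr (2 * a))
                 * G"
            using N by (simp add: powr_mult mult_ac)
          also have "N powr (- 2 * a * (1 - \<delta>)) * N powr \<epsilon> * N powr (2 * a)
              = N powr (2 * a * \<delta> + \<epsilon>)"
            by (simp add: powr_add[symmetric] algebra_simps)
          finally show ?thesis
            using C G by (simp flip: ennreal_mult)
        qed
        also have "\<dots> \<le> ennreal (2 * C * 2 powr (2 * a) * N powr (2 * \<sigma> + \<epsilon>) * G)"
          using C G N by (intro ennreal_leI mult_right_mono mult_left_mono powr_mono)
              (auto simp: \<sigma>eq)
        finally show ?thesis .
      qed
      have L1: "real L + 1 \<le> K1 * N powr \<epsilon>"
      proof -
        note Lb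
        moreover have "a * j \<le> a / (\<epsilon> * ln 2) * N powr \<epsilon>"
        proof -
          have "\<epsilon> * ln 2 * j \<le> exp (\<epsilon> * ln 2 * j)" using exp_ge_add_one_self[of "\<epsilon> * ln 2 * j"]
              by linarith
          also have "\<dots> = N powr \<epsilon>" unfolding Npow by (simp add: powr_def mult_ac)
          finally have "a / (\<epsilon> * ln 2) * (\<epsilon> * ln 2 * j) \<le> a / (\<epsilon> * ln 2) * N powr \<epsilon>"
            using a \<epsilon> by (intro mult_left_mono) auto
          then show ?thesis using \<epsilon> by simp
        qed
        moreover have "2 \<le> 2 * N powr \<epsilon>" using N\<epsilon> by simp
        ultimately show ?thesis by (simp add: K1_def distrib_right)
      qed
      have "(\<integral>\<^sup>+x. W x * indicator {c..c+1} x \<partial>lborel)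
          = (\<Sum>l\<le>L. \<integral>\<^sup>+x. V l x * indicator {c..c+1} x \<partial>lborel)
              + (\<integral>\<^sup>+x. V' x * indicator {c..c+1} x \<partial>lborel)"
      proof -
        have "(\<integral>\<^sup>+x. W x * indicator {c..c+1} x \<partial>lborel)
            = (\<integral>\<^sup>+x. (\<Sum>l\<le>L. V l x * indicator {c..c+1} x) + V' x * indicator {c..c+1} x \<partial>lborel)"
          unfolding W_def distrib_right sum_distrib_right ..
        also have "\<dots> = (\<integral>\<^sup>+x. (\<Sum>l\<le>L. V l x * indicator {c..c+1} x) \<partial>lborel)
            + (\<integral>\<^sup>+x. V' x * indicator {c..c+1} x \<partial>lborel)"
          by (rule nn_integral_add) measurable
        also have "(\<integral>\<^sup>+x. (\<Sum>l\<le>L. V l x * indicator {c..c+1} x) \<partial>lborel)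
            = (\<Sum>l\<le>L. \<integral>\<^sup>+x. V l x * indicator {c..c+1} x \<partial>lborel)"
          by (rule nn_integral_sum) measurable
        finally show ?thesis .
      qed
      also have "\<dots> \<le> (\<Sum>l\<le>L. ennreal (128 * C * N powr (2 * \<sigma> + \<epsilon>) * G))
          + ennreal (2 * C * 2 powr (2 * a) * N powr (2 * \<sigma> + \<epsilon>) * G)"
        by (intro add_mono sum_mono Vl V') simp
      also have "\<dots> = ennreal ((real L + 1) * (128 * C * N powr (2 * \<sigma> + \<epsilon>) * G)
          + 2 * C * 2 powr (2 * a) * N powr (2 * \<sigma> + \<epsilon>) * G)"
        using C G by (subst sum_ennreal) (auto simp: ennreal_plus[symmetric] simp del: ennreal_plus)
      also have "\<dots> \<le> ennreal (K * N powr (2 * p) * G)"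
      proof (rule ennreal_leI)
        have "(real L + 1) * (128 * C * N powr (2 * \<sigma> + \<epsilon>) * G)
            \<le> (K1 * N powr \<epsilon>) * (128 * C * N powr (2 * \<sigma> + \<epsilon>) * G)"
          using C G by (intro mult_right_mono L1) auto
        also have "\<dots> = K1 * (128 * C) * N powr (2 * (\<sigma> + \<epsilon>)) * G"
          by (simp add: powr_add[symmetric] algebra_simps)
        also have "\<dots> \<le> K1 * (128 * C) * N powr (2 * p) * G"
          using C G K1 N \<epsilon>(3) by (intro mult_right_mono mult_left_mono powr_mono) auto
        finally have 1: "(real L + 1) * (128 * C * N powr (2 * \<sigma> + \<epsilon>) * G)
            \<le> K1 * (128 * C) * N powr (2 * p) * G" .
        have "2 * C * 2 powr (2 * a) * N powr (2 * \<sigma> + \<epsilon>) * G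
            \<le> 2 * C * 2 powr (2 * a) * N powr (2 * p) * G"
          using C G N \<epsilon> by (intro mult_right_mono mult_left_mono powr_mono) auto
        with 1 show "(real L + 1) * (128 * C * N powr (2 * \<sigma> + \<epsilon>) * G) + 2 * C * 2 powr (2 * a)
            * N powr (2 * \<sigma> + \<epsilon>) * G \<le> K * N powr (2 * p) * G"
          by (simp add: K_def distrib_right)
      qed
      finally show ?thesis by (simp add: N_def)
    qed
    show ?thesis
      using W pointwise int unfolding rate_majorant_def G_def by (intro exI[of _ W] conjI allI impI)
  qed
  show ?thesis
    by (rule that[OF K *])
qed

section \<open>The inverse Fourier transform on L2 as a pointwise series\<close>

definition piece :: "(nat \<Rightarrow> real set) \<Rightarrow> (real \<Rightarrow> complex) \<Rightarrow> nat \<Rightarrow> real \<Rightarrow> complex" where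
  "piece S g j \<xi> = indicator (S j) \<xi> *\<^sub>R g \<xi>"

text \<open>Boundedness makes every piece integrable, so its inverse transform is an ordinary
  integral; summability of the L2 norms makes the sum of these converge a.e. It is used with all
  dyadic annuli for sufficiency and with a sparse sequence of annuli for necessity.\<close>

definition L2_partition :: "(nat \<Rightarrow> real set) \<Rightarrow> (real \<Rightarrow> complex) \<Rightarrow> bool" where
  "L2_partition S g \<longleftrightarrow> (\<forall>j. S j \<in> sets borel \<and> bounded (S j)) \<and> disjoint_family S \<and>
      (\<forall>\<xi>. g \<xi> \<noteq> 0 \<longrightarrow> \<xi> \<in> (\<Union>j. S j)) \<and>
     g \<in> borel_measurable borel \<and> square_integrable g \<and>
     summable (\<lambda>j. sqrt (L2sq (piece S g j)))"

text \<open>A concrete inverse Fourier transform, defined at every point; where the series diverges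
  the value carries no meaning, and \<open>AE_summable_synth\<close> shows that this happens only on
  a null set.\<close>

definition synth :: "(nat \<Rightarrow> real set) \<Rightarrow> (real \<Rightarrow> complex) \<Rightarrow> real \<Rightarrow> complex" where
  "synth S g x = (\<Sum>j. 1 / (2 * of_real pi) * (LINT \<xi>|lborel. cis (x * \<xi>) * piece S g j \<xi>))"

lemma ennreal_le_sqrtI:
  assumes "X\<^sup>2 \<le> ennreal c" "c \<ge> 0"
  shows "X \<le> ennreal (sqrt c)"
proof (cases X)
  case (real r)
  then have "r\<^sup>2 \<le> c"
    using assms by (simp add: ennreal_power ennreal_le_iff)
  then have "r \<le> sqrt c" by (rule real_le_rsqrt)
  then show ?thesis using real by (simp add: ennreal_leI)
next
  case top
  then show ?thesis using assms by (simp add: power2_eq_square ennreal_top_mult top_unique)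
qed

lemma L2_schwartz_integrable:
  assumes [measurable]: "g \<in> borel_measurable borel" and g2: "square_integrable g"
      and \<psi>: "\<psi> \<in> schwartz"
  shows "integrable lborel (\<lambda>\<xi>. g \<xi> * \<psi> \<xi>)"
proof -
  have [measurable]: "\<psi> \<in> borel_measurable borel" by (rule schwartz_measurable[OF \<psi>])
  obtain C where C: "C \<ge> 0" "\<And>x. norm (\<psi> x) \<le> C"
    using schwartz_bound[OF \<psi>, of 0 0] by auto
  show ?thesis
  proof (rule Bochner_Integration.integrable_bound)
    show "integrable lborel (\<lambda>\<xi>. (norm (g \<xi>))\<^sup>2 + C * norm (\<psi> \<xi>))"
      using g2 schwartz_integrable[OF \<psi>] by auto
    have "norm (g \<xi> * \<psi> \<xi>) \<le> (norm (g \<xi>))\<^sup>2 + C * norm (\<psi> \<xi>)" for \<xi>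
    proof -
      have "2 * norm (g \<xi>) * norm (\<psi> \<xi>) \<le> (norm (g \<xi>))\<^sup>2 + (norm (\<psi> \<xi>))\<^sup>2"
        by (rule sum_squares_bound)
      moreover have "(norm (\<psi> \<xi>))\<^sup>2 \<le> C * norm (\<psi> \<xi>)"
        unfolding power2_eq_square by (intro mult_right_mono C) simp
      moreover have "0 \<le> norm (g \<xi>) * norm (\<psi> \<xi>)" by simp
      ultimately show ?thesis unfolding norm_mult by linarith
    qed
    then show "AE \<xi> in lborel. norm (g \<xi> * \<psi> \<xi>) \<le> norm ((norm (g \<xi>))\<^sup>2 + C * norm (\<psi> \<xi>))"
      by (intro AE_I2 order_trans[OF _
          abs_ge_self[THEN order_trans, OF eq_refl[OF real_norm_def[symmetric]]]])
  qed measurable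
qed

lemma L2_partition_piece:
  assumes "L2_partition S g"
  shows "piece S g j \<in> borel_measurable borel" "integrable lborel (piece S g j)"
    "square_integrable (piece S g j)"
proof -
  have [measurable]: "S j \<in> sets borel" "g \<in> borel_measurable borel" and b: "bounded (S j)"
    and g2: "square_integrable g"
    using assms by (auto simp: L2_partition_def)
  show m[measurable]: "piece S g j \<in> borel_measurable borel"
    unfolding piece_def[abs_def] by measurable
  show 2: "square_integrable (piece S g j)"
    by (rule Bochner_Integration.integrable_bound[OF g2]) (auto simp: piece_def indicator_def)
  show "integrable lborel (piece S g j)"
    by (rule integrable_of_square_integrable[OF _ b m _ 2]) (auto simp: piece_def)
qed

lemma L2_partition_modulate:
  assumes S: "L2_partition S g" and [measurable]: "h \<in> borel_measurable borel"
  shows "L2_partition S (\<lambda>\<xi>. cis (h \<xi>) * g \<xi>)"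
proof -
  have eq: "norm (piece S (\<lambda>\<xi>. cis (h \<xi>) * g \<xi>) j \<xi>) = norm (piece S g j \<xi>)" for j \<xi>
    by (simp add: piece_def norm_mult)
  have [measurable]: "g \<in> borel_measurable borel" using S by (simp add: L2_partition_def)
  show ?thesis
    using S unfolding L2_partition_def eq by (auto simp: norm_mult)
qed

text \<open>Evolving in time only modulates the Fourier transform, so one partition serves all
  times.\<close>

lemma evol_piece_eq:
  "evol a (piece S g j) t x
      = (LINT \<xi>|lborel. cis (x * \<xi>) * piece S (\<lambda>\<xi>. cis (t * \<bar>\<xi>\<bar> powr a) * g \<xi>) j \<xi>)"
  unfolding evol_def piece_def
  by (intro Bochner_Integration.integral_cong) (simp_all add: cis_mult[symmetric] mult_ac)

text \<open>Plancherel and Cauchy-Schwarz against the weight \<open>inverse (1 + x\<^sup>2)\<close>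
  turn L2 bounds into weighted L1 bounds. The latter can be summed under the integral, and the
  weight dominates Schwartz functions.\<close>

lemma synth_pieces_bound:
  assumes S: "L2_partition S g"
  shows "integrable lborel (\<lambda>x. norm (LINT \<xi>|lborel. cis (x * \<xi>) * piece S g j \<xi>)
      * inverse (1 + x\<^sup>2))"
    and "(LINT x|lborel. norm (LINT \<xi>|lborel. cis (x * \<xi>) * piece S g j \<xi>) * inverse (1 + x\<^sup>2))
      \<le> sqrt (2 * pi * (LINT x|lborel. inverse (1 + x\<^sup>2))) * sqrt (L2sq (piece S g j))"
proof -
  note pm[measurable] = L2_partition_piece(1)[OF S]
  define w where "w x = (LINT \<xi>|lborel. cis (x * \<xi>) * piece S g j \<xi>)" for x
  define K where "K = (LINT x::real|lborel. inverse (1 + x\<^sup>2))"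
  define G where "G = (L2sq (piece S g j))"
  have K: "K \<ge> 0" by (simp add: K_def integral_nonneg_AE)
  have G: "G \<ge> 0" by (simp add: G_def)
  have [measurable]: "w \<in> borel_measurable borel" unfolding w_def[abs_def] by measurable
  have "(\<integral>\<^sup>+x. ennreal (norm (w x)) * ennreal (inverse (1 + x\<^sup>2)) \<partial>lborel)\<^sup>2
      \<le> (\<integral>\<^sup>+x. (ennreal (norm (w x)))\<^sup>2 \<partial>lborel) * (\<integral>\<^sup>+x. (ennreal (inverse (1 + x\<^sup>2)))\<^sup>2 \<partial>lborel)"
    by (rule Cauchy_Schwarz_nn_integral) auto
  also have "\<dots> \<le> ennreal (2 * pi * G) * ennreal K"
  proof (rule mult_mono)
    have "(\<integral>\<^sup>+x. (norm (w x))\<^sup>2 \<partial>lborel)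
        \<le> ennreal (2 * pi) * (\<integral>\<^sup>+\<xi>. (norm (piece S g j \<xi>))\<^sup>2 \<partial>lborel)"
      unfolding w_def by (rule plancherel_le[OF L2_partition_piece(2)[OF S]])
    also have "(\<integral>\<^sup>+\<xi>. (norm (piece S g j \<xi>))\<^sup>2 \<partial>lborel) = ennreal G"
      unfolding G_def by (rule nn_integral_eq_integral[OF L2_partition_piece(3)[OF S]]) simp
    finally show "(\<integral>\<^sup>+x. (ennreal (norm (w x)))\<^sup>2 \<partial>lborel) \<le> ennreal (2 * pi * G)"
      using G by (simp add: ennreal_power ennreal_mult)
    have "(\<integral>\<^sup>+x. (ennreal (inverse (1 + (x::real)\<^sup>2)))\<^sup>2 \<partial>lborel)
        \<le> (\<integral>\<^sup>+x. ennreal (inverse (1 + (x::real)\<^sup>2)) \<partial>lborel)"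
    proof (rule nn_integral_mono)
      fix x :: real
      have "inverse (1 + x\<^sup>2) \<le> 1" by (simp add: inverse_le_1_iff)
      then have "(inverse (1 + x\<^sup>2))\<^sup>2 \<le> inverse (1 + x\<^sup>2)"
        unfolding power2_eq_square[of "inverse _"] by (intro mult_left_le) auto
      then show "(ennreal (inverse (1 + x\<^sup>2)))\<^sup>2 \<le> ennreal (inverse (1 + x\<^sup>2))"
        by (simp add: ennreal_power ennreal_leI)
    qed
    also have "\<dots> = ennreal K"
      unfolding K_def by (rule nn_integral_eq_integral[OF integrable_inverse_1_plus_square_UNIV])
          simp
    finally show "(\<integral>\<^sup>+x. (ennreal (inverse (1 + (x::real)\<^sup>2)))\<^sup>2 \<partial>lborel) \<le> ennreal K" .
  qed auto
  also have "\<dots> = ennreal (2 * pi * K * G)"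
    using K G by (simp add: mult_ac flip: ennreal_mult)
  finally have "(\<integral>\<^sup>+x. ennreal (norm (w x)) * ennreal (inverse (1 + x\<^sup>2)) \<partial>lborel)
      \<le> ennreal (sqrt (2 * pi * K * G))"
    using K G by (intro ennreal_le_sqrtI) auto
  then have le: "(\<integral>\<^sup>+x. ennreal (norm (w x) * inverse (1 + x\<^sup>2)) \<partial>lborel)
      \<le> ennreal (sqrt (2 * pi * K) * sqrt G)"
    by (simp add: ennreal_mult real_sqrt_mult)
  show i: "integrable lborel (\<lambda>x. norm (LINT \<xi>|lborel. cis (x * \<xi>) * piece S g j \<xi>)
      * inverse (1 + x\<^sup>2))"
    unfolding w_def[symmetric]
  proof (rule integrableI_bounded)
    have "(\<integral>\<^sup>+x. ennreal (norm (norm (w x) * inverse (1 + x\<^sup>2))) \<partial>lborel)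
        = (\<integral>\<^sup>+x. ennreal (norm (w x) * inverse (1 + x\<^sup>2)) \<partial>lborel)"
      by (simp add: abs_mult)
    also have "\<dots> < \<infinity>"
      using le by (rule order.strict_trans1) simp
    finally show "(\<integral>\<^sup>+x. ennreal (norm (norm (w x) * inverse (1 + x\<^sup>2))) \<partial>lborel) < \<infinity>" .
  qed measurable
  have "ennreal (LINT x|lborel. norm (w x) * inverse (1 + x\<^sup>2))
      = (\<integral>\<^sup>+x. ennreal (norm (w x) * inverse (1 + x\<^sup>2)) \<partial>lborel)"
    using i unfolding w_def[symmetric] by (intro nn_integral_eq_integral[symmetric]) auto
  with le have "ennreal (LINT x|lborel. norm (w x) * inverse (1 + x\<^sup>2))
      \<le> ennreal (sqrt (2 * pi * K) * sqrt G)"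
    by simp
  then show "(LINT x|lborel. norm (LINT \<xi>|lborel. cis (x * \<xi>) * piece S g j \<xi>) * inverse (1 + x\<^sup>2))
      \<le> sqrt (2 * pi * (LINT x|lborel. inverse (1 + x\<^sup>2))) * sqrt (L2sq (piece S g j))"
    unfolding w_def K_def[symmetric] G_def[symmetric] using K G by (subst (asm) ennreal_le_iff) auto
qed

lemma summable_synth_bounds:
  assumes S: "L2_partition S g"
  shows "summable (\<lambda>j. LINT x|lborel. norm (LINT \<xi>|lborel. cis (x * \<xi>) * piece S g j \<xi>)
      * inverse (1 + x\<^sup>2))"
proof (rule summable_comparison_test')
  show "summable (\<lambda>j. sqrt (2 * pi * (LINT x|lborel. inverse (1 + x\<^sup>2)))
      * sqrt (L2sq (piece S g j)))"
    using S by (intro summable_mult) (simp add: L2_partition_def)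
  show "norm (LINT x|lborel. norm (LINT \<xi>|lborel. cis (x * \<xi>) * piece S g j \<xi>) * inverse (1 + x\<^sup>2))
      \<le> sqrt (2 * pi * (LINT x|lborel. inverse (1 + x\<^sup>2))) * sqrt (L2sq (piece S g j))" for j
    using synth_pieces_bound(2)[OF S, of j] by (simp add: integral_nonneg_AE)
qed

text \<open>The sum of the absolute values has finite weighted integral, hence is finite a.e.; the
  positive weight is then divided out.\<close>

lemma AE_summable_synth:
  assumes S: "L2_partition S g"
  shows "AE x in lborel. summable (\<lambda>j. norm (LINT \<xi>|lborel. cis (x * \<xi>) * piece S g j \<xi>))"
proof -
  define w where "w j x = (LINT \<xi>|lborel. cis (x * \<xi>) * piece S g j \<xi>)" for j x
  define b where "b j = (LINT x|lborel. norm (w j x) * inverse (1 + x\<^sup>2))" for j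
  have [measurable]: "w j \<in> borel_measurable borel" for j
    using L2_partition_piece(1)[OF S, of j, measurable] unfolding w_def[abs_def] by measurable
  have b: "b j \<ge> 0" for j
    by (simp add: b_def integral_nonneg_AE)
  have bs: "summable b"
    using summable_synth_bounds[OF S] by (simp add: b_def[abs_def] w_def)
  have "(\<integral>\<^sup>+x. (\<Sum>j. ennreal (norm (w j x) * inverse (1 + x\<^sup>2))) \<partial>lborel)
      = (\<Sum>j. \<integral>\<^sup>+x. ennreal (norm (w j x) * inverse (1 + x\<^sup>2)) \<partial>lborel)"
    by (rule nn_integral_suminf) measurable
  also have "\<dots> = (\<Sum>j. ennreal (b j))"
    unfolding b_def w_def using synth_pieces_bound(1)[OF S]
    by (intro arg_cong[where f = suminf] ext nn_integral_eq_integral) auto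
  also have "\<dots> = ennreal (\<Sum>j. b j)"
    using b bs by (intro suminf_ennreal2) auto
  finally have "(\<integral>\<^sup>+x. (\<Sum>j. ennreal (norm (w j x) * inverse (1 + x\<^sup>2))) \<partial>lborel) \<noteq> \<infinity>"
    by simp
  then have "AE x in lborel. (\<Sum>j. ennreal (norm (w j x) * inverse (1 + x\<^sup>2))) \<noteq> \<infinity>"
    by (intro nn_integral_noteq_infinite) measurable
  then show ?thesis
  proof eventually_elim
    case (elim x)
    then have "summable (\<lambda>j. norm (w j x) * inverse (1 + x\<^sup>2))"
      by (intro summable_suminf_not_top) auto
    then have "summable (\<lambda>j. norm (w j x) * inverse (1 + x\<^sup>2) * (1 + x\<^sup>2))"
      by (rule summable_mult2)
    moreover have "inverse (1 + x\<^sup>2) * (1 + x\<^sup>2) = 1"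
      by (simp add: add_nonneg_eq_0_iff)
    ultimately show ?case
      by (simp add: w_def mult.assoc)
  qed
qed

lemma synth_measurable [measurable]:
  assumes S: "L2_partition S g"
  shows "synth S g \<in> borel_measurable borel"
proof -
  have [measurable]: "piece S g j \<in> borel_measurable borel" for j
    by (rule L2_partition_piece(1)[OF S])
  show ?thesis unfolding synth_def[abs_def] by measurable
qed

theorem represents_synth:
  assumes S: "L2_partition S g"
  shows "represents (synth S g) (inv_fourier_dist (dist_of_fun g))"
    and "integrable lborel (\<lambda>x. synth S g x * of_real (inverse (1 + x\<^sup>2)))"
proof -
  define w where "w j x = 1 / (2 * of_real pi) * (LINT \<xi>|lborel. cis (x * \<xi>) * piece S g j \<xi>)"
      for j x
  have pm[measurable]: "piece S g j \<in> borel_measurable borel" for j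
    by (rule L2_partition_piece(1)[OF S])
  have gm[measurable]: "g \<in> borel_measurable borel" and g2: "square_integrable g"
    and disj: "disjoint_family S" and cov: "\<And>\<xi>. g \<xi> \<noteq> 0 \<Longrightarrow> \<xi> \<in> (\<Union>j. S j)"
        and [measurable]: "\<And>j. S j \<in> sets borel"
    using S by (auto simp: L2_partition_def)
  have [measurable]: "w j \<in> borel_measurable borel" for j
    unfolding w_def[abs_def] by measurable
  have wn: "norm (w j x) = 1 / (2 * pi) * norm (LINT \<xi>|lborel. cis (x * \<xi>) * piece S g j \<xi>)" for j x
    by (simp add: w_def norm_mult norm_divide)
  have synth: "synth S g x = (\<Sum>j. w j x)" for x
    by (simp add: synth_def w_def)
  have wi: "integrable lborel (\<lambda>x. norm (w j x) * inverse (1 + x\<^sup>2))" for j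
    unfolding wn using integrable_mult_right[OF synth_pieces_bound(1)[OF S, of j], of
        "1 / (2 * pi)"] by (simp add: mult.assoc)
  have ws: "summable (\<lambda>j. LINT x|lborel. norm (w j x) * inverse (1 + x\<^sup>2))"
    unfolding wn mult.assoc integral_mult_right_zero
    by (intro summable_mult summable_synth_bounds[OF S])
  have wae: "AE x in lborel. summable (\<lambda>j. norm (w j x))"
    using AE_summable_synth[OF S] by eventually_elim (simp only: wn summable_mult)
  \<comment> \<open>Stated for every function dominated by the weight: it is applied to Schwartz
    functions and, for the second claim, to the weight itself.\<close>
  have key: "integrable lborel (\<lambda>x. synth S g x * \<phi> x) \<and> (LINT x|lborel. synth S g x * \<phi> x)
      = (\<Sum>j. LINT x|lborel. w j x * \<phi> x)"
    if [measurable]: "\<phi> \<in> borel_measurable borel"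
        and C: "C \<ge> 0" "\<And>x. norm (\<phi> x) \<le> C * inverse (1 + x\<^sup>2)" for \<phi> C
  proof -
    have le: "norm (w j x * \<phi> x) \<le> C * (norm (w j x) * inverse (1 + x\<^sup>2))" for j x
      using mult_left_mono[OF C(2)[of x], of "norm (w j x)"] by (simp add: norm_mult mult_ac)
    have 1: "integrable lborel (\<lambda>x. w j x * \<phi> x)" for j
    proof (rule Bochner_Integration.integrable_bound[OF integrable_mult_right[OF wi[of j], of C]])
      show "AE x in lborel. norm (w j x * \<phi> x) \<le> norm (C * (norm (w j x) * inverse (1 + x\<^sup>2)))"
        using le[of j] C(1) by (intro AE_I2) (simp add: abs_mult)
    qed measurable
    have 2: "AE x in lborel. summable (\<lambda>j. norm (w j x * \<phi> x))"
      using wae by eventually_elim (simp add: norm_mult summable_mult2)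
    have 3: "summable (\<lambda>j. LINT x|lborel. norm (w j x * \<phi> x))"
    proof (rule summable_comparison_test')
      show "summable (\<lambda>j. C * (LINT x|lborel. norm (w j x) * inverse (1 + x\<^sup>2)))"
        by (intro summable_mult ws)
      show "norm (LINT x|lborel. norm (w j x * \<phi> x))
          \<le> C * (LINT x|lborel. norm (w j x) * inverse (1 + x\<^sup>2))" for j
      proof -
        have "(LINT x|lborel. norm (w j x * \<phi> x))
            \<le> (LINT x|lborel. C * (norm (w j x) * inverse (1 + x\<^sup>2)))"
          by (rule integral_mono[OF integrable_norm[OF 1] integrable_mult_right[OF wi] le])
        then show ?thesis by simp
      qed
    qed
    have eq: "synth S g x * \<phi> x = (\<Sum>j. w j x * \<phi> x)" if "summable (\<lambda>j. norm (w j x))" for x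
      unfolding synth by (rule suminf_mult2[OF summable_norm_cancel[OF that]])
    have ae: "AE x in lborel. (\<Sum>j. w j x * \<phi> x) = synth S g x * \<phi> x"
      using wae by eventually_elim (simp only: eq)
    have mf: "(\<lambda>x. synth S g x * \<phi> x) \<in> borel_measurable lborel"
      using synth_measurable[OF S] by measurable
    have mh: "(\<lambda>x. \<Sum>j. w j x * \<phi> x) \<in> borel_measurable lborel"
      by measurable
    show ?thesis
      using integrable_suminf[OF 1 2 3] integral_suminf[OF 1 2 3] integrable_cong_AE[OF mh mf ae]
          integral_cong_AE[OF mh mf ae]
      by simp
  qed
  show "integrable lborel (\<lambda>x. synth S g x * of_real (inverse (1 + x\<^sup>2)))"
    using key[of "\<lambda>x. of_real (inverse (1 + x\<^sup>2))" 1] by (simp del: of_real_inverse)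
  show "represents (synth S g) (inv_fourier_dist (dist_of_fun g))"
    unfolding represents_def
  proof (intro conjI ballI synth_measurable[OF S])
    fix \<phi> assume \<phi>: "\<phi> \<in> schwartz"
    have [measurable]: "\<phi> \<in> borel_measurable borel" by (rule schwartz_measurable[OF \<phi>])
    obtain C where C: "C \<ge> 0" "\<And>x. norm (\<phi> x) \<le> C * inverse (1 + x\<^sup>2)"
      using schwartz_decay[OF \<phi>] by blast
    note key = key[OF \<open>\<phi> \<in> borel_measurable borel\<close> C]
    show "integrable lborel (\<lambda>x. synth S g x * \<phi> x)" using key by blast
    have \<psi>: "inv_fourier \<phi> \<in> schwartz" by (rule schwartz_inv_fourier[OF \<phi>])
    \<comment> \<open>The exchange of integrals is legitimate piece by piece, since a piece is
      integrable whereas \<open>g\<close> itself need not be.\<close>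
    have pair: "(LINT x|lborel. w j x * \<phi> x) = (LINT \<xi>|lborel. piece S g j \<xi> * inv_fourier \<phi> \<xi>)"
        for j
    proof -
      have "(LINT x|lborel. w j x * \<phi> x)
          = (LINT x|lborel. (LINT \<xi>|lborel. 1 / (2 * of_real pi)
          * (cis (x * \<xi>) * (\<phi> x * piece S g j \<xi>))))"
      proof (rule Bochner_Integration.integral_cong[OF refl])
        fix x
        have "(LINT \<xi>|lborel. 1 / (2 * of_real pi) * (cis (x * \<xi>) * (\<phi> x * piece S g j \<xi>)))
            = (LINT \<xi>|lborel. (1 / (2 * of_real pi) * \<phi> x) * (cis (x * \<xi>) * piece S g j \<xi>))"
          by (simp only: mult_ac)
        also have "\<dots> = (1 / (2 * of_real pi) * \<phi> x) * (LINT \<xi>|lborel. cis (x * \<xi>) * piece S g j \<xi>)"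
          by (rule integral_mult_right_zero)
        finally show "w j x * \<phi> x
            = (LINT \<xi>|lborel. 1 / (2 * of_real pi) * (cis (x * \<xi>) * (\<phi> x * piece S g j \<xi>)))"
          by (simp only: w_def mult_ac)
      qed
      also have "\<dots> = (LINT \<xi>|lborel. (LINT x|lborel. 1 / (2 * of_real pi)
          * (cis (x * \<xi>) * (\<phi> x * piece S g j \<xi>))))"
      proof (rule lborel_pair.Fubini_integral[symmetric])
        have "integrable (lborel \<Otimes>\<^sub>M lborel) (\<lambda>(x, \<xi>). cis (x * \<xi>) * (\<phi> x * piece S g j \<xi>))"
          by (rule lborel_pair.integrable_bounded_kernel[OF schwartz_integrable[OF \<phi>]
              L2_partition_piece(2)[OF S], where B = 1]) auto
        from integrable_mult_right[OF this, of "1 / (2 * of_real pi)"]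
        show "integrable (lborel \<Otimes>\<^sub>M lborel) (\<lambda>(x, \<xi>). 1 / (2 * of_real pi)
            * (cis (x * \<xi>) * (\<phi> x * piece S g j \<xi>)))"
          by (simp only: case_prod_beta')
      qed
      also have "\<dots> = (LINT \<xi>|lborel. piece S g j \<xi> * inv_fourier \<phi> \<xi>)"
      proof (rule Bochner_Integration.integral_cong[OF refl])
        fix \<xi>
        have "(LINT x|lborel. 1 / (2 * of_real pi) * (cis (x * \<xi>) * (\<phi> x * piece S g j \<xi>)))
            = (LINT x|lborel. piece S g j \<xi> * (1 / (2 * of_real pi) * (cis (\<xi> * x) * \<phi> x)))"
          by (simp only: mult_ac)
        then show "(LINT x|lborel. 1 / (2 * of_real pi) * (cis (x * \<xi>) * (\<phi> x * piece S g j \<xi>)))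
            = piece S g j \<xi> * inv_fourier \<phi> \<xi>"
          unfolding inv_fourier_def by (simp only: integral_mult_right_zero)
      qed
      finally show ?thesis .
    qed
    have gi: "integrable lborel (\<lambda>\<xi>. g \<xi> * inv_fourier \<phi> \<xi>)"
      by (rule L2_schwartz_integrable[OF gm g2 \<psi>])
    have "dist_of_fun (synth S g) \<phi> = (\<Sum>j. LINT \<xi>|lborel. piece S g j \<xi> * inv_fourier \<phi> \<xi>)"
      using key by (simp add: dist_of_fun_def pair)
    also have "\<dots> = (\<Sum>j. LINT \<xi>:S j|lborel. g \<xi> * inv_fourier \<phi> \<xi>)"
      by (simp add: piece_def set_lebesgue_integral_def)
    also have "\<dots> = (LINT \<xi>:(\<Union>j. S j)|lborel. g \<xi> * inv_fourier \<phi> \<xi>)"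
    proof (rule lebesgue_integral_countable_add[symmetric])
      show "i \<noteq> j \<Longrightarrow> S i \<inter> S j = {}" for i j using disj by (auto simp: disjoint_family_on_def)
      show "set_integrable lborel (\<Union>j. S j) (\<lambda>\<xi>. g \<xi> * inv_fourier \<phi> \<xi>)"
        unfolding set_integrable_def using gi by (intro integrable_mult_indicator) auto
    qed simp
    also have "\<dots> = (LINT \<xi>|lborel. g \<xi> * inv_fourier \<phi> \<xi>)"
      unfolding set_lebesgue_integral_def using cov
      by (intro Bochner_Integration.integral_cong) (auto simp: indicator_def)
    finally show "inv_fourier_dist (dist_of_fun g) \<phi> = dist_of_fun (synth S g) \<phi>"
      by (simp add: inv_fourier_dist_def dist_of_fun_def)
  qed
qed

section \<open>Sufficiency\<close>

text \<open>The shifted index gives \<open>dyadic j\<close> the upper bound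
  \<open>\<bar>\<xi>\<bar> < 2 ^ j\<close> for every \<open>j\<close>, including the ball around
  0.\<close>

definition dyadic :: "nat \<Rightarrow> real set" where
  "dyadic j = (case j of 0 \<Rightarrow> {\<xi>. \<bar>\<xi>\<bar> < 1} | Suc k \<Rightarrow> annulus (2 ^ k))"

lemma dyadic_sets [measurable]: "dyadic j \<in> sets borel"
  by (cases j) (auto simp: dyadic_def)

lemma dyadic_bounded: "bounded (dyadic j)"
proof (cases j)
  case 0
  then show ?thesis by (auto simp: dyadic_def bounded_iff intro!: exI[of _ 1])
next
  case (Suc k)
  then show ?thesis by (simp add: dyadic_def annulus_bounded)
qed

lemma dyadic_disjoint: "disjoint_family dyadic"
proof -
  have *: "dyadic i \<inter> dyadic j = {}" if ij: "i < j" for i j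
  proof -
    obtain k where k: "j = Suc k" using ij by (cases j) auto
    have up: "\<bar>\<xi>\<bar> < 2 ^ i" if "\<xi> \<in> dyadic i" for \<xi>
      using that by (cases i) (auto simp: dyadic_def annulus_def)
    have le: "(2::real) ^ i \<le> 2 ^ k" using ij k by (intro power_increasing) auto
    have low: "2 ^ k \<le> \<bar>\<xi>\<bar>" if "\<xi> \<in> dyadic j" for \<xi>
      using that k by (auto simp: dyadic_def annulus_def)
    have False if "\<xi> \<in> dyadic i" "\<xi> \<in> dyadic j" for \<xi>
      using up[OF that(1)] low[OF that(2)] le by linarith
    then show ?thesis by blast
  qed
  show ?thesis
    unfolding disjoint_family_on_def using * by (metis Int_commute linorder_neqE_nat)
qed

lemma dyadic_cover: "\<xi> \<in> (\<Union>j. dyadic j)"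
proof (cases "\<bar>\<xi>\<bar> < 1")
  case True
  then have "\<xi> \<in> dyadic 0" by (simp add: dyadic_def)
  then show ?thesis by blast
next
  case False
  define k where "k = nat \<lfloor>log 2 \<bar>\<xi>\<bar>\<rfloor>"
  have "0 \<le> log 2 \<bar>\<xi>\<bar>" using False by simp
  then have k: "real k \<le> log 2 \<bar>\<xi>\<bar>" "log 2 \<bar>\<xi>\<bar> < real k + 1"
    unfolding k_def by linarith+
  have eq: "2 powr (log 2 \<bar>\<xi>\<bar>) = \<bar>\<xi>\<bar>" using False by simp
  have "2 powr real k \<le> 2 powr (log 2 \<bar>\<xi>\<bar>)" "2 powr (log 2 \<bar>\<xi>\<bar>) < 2 powr (real k + 1)"
    using k by simp_all
  then have "\<xi> \<in> dyadic (Suc k)"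
    unfolding eq by (simp add: dyadic_def annulus_def powr_add powr_realpow mult.commute)
  then show ?thesis by blast
qed

lemma weight_ge_1: "s \<ge> 0 \<Longrightarrow> (1 + \<xi>\<^sup>2) powr s \<ge> (1::real)"
  by (rule ge_one_powr_ge_zero) auto

lemma integrable_of_weighted:
  fixes g :: "real \<Rightarrow> complex"
  assumes [measurable]: "g \<in> borel_measurable borel" and s: "s \<ge> 0"
    and w: "Hs_integrable s g"
  shows "square_integrable g"
proof (rule Bochner_Integration.integrable_bound[OF w])
  have "(norm (g \<xi>))\<^sup>2 \<le> (1 + \<xi>\<^sup>2) powr s * (norm (g \<xi>))\<^sup>2" for \<xi>
    using mult_right_mono[OF weight_ge_1[OF s, of \<xi>], of "(norm (g \<xi>))\<^sup>2"] by simp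
  then show "AE \<xi> in lborel. norm ((norm (g \<xi>))\<^sup>2) \<le> norm ((1 + \<xi>\<^sup>2) powr s * (norm (g \<xi>))\<^sup>2)"
    by (intro AE_I2) simp
qed measurable

lemma dyadic_piece_norm:
  fixes g :: "real \<Rightarrow> complex"
  assumes [measurable]: "g \<in> borel_measurable borel" and s: "s \<ge> 0"
    and w: "Hs_integrable s g"
  shows "(L2sq (piece dyadic g (Suc k))) \<le> 2 powr (- 2 * s * real k) * (Hs_sq s g)"
proof -
  have g2: "square_integrable g"
    by (rule integrable_of_weighted[OF _ s w]) simp
  have le: "(norm (piece dyadic g (Suc k) \<xi>))\<^sup>2
      \<le> 2 powr (- 2 * s * real k) * ((1 + \<xi>\<^sup>2) powr s * (norm (g \<xi>))\<^sup>2)" for \<xi>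
  proof (cases "\<xi> \<in> dyadic (Suc k)")
    case True
    then have "2 ^ k \<le> \<bar>\<xi>\<bar>" by (auto simp: dyadic_def annulus_def)
    then have "(2 ^ k)\<^sup>2 \<le> \<bar>\<xi>\<bar>\<^sup>2" by (intro power_mono) auto
    then have "(2 powr (2 * real k)) \<le> 1 + \<xi>\<^sup>2"
      by (simp add: powr_realpow[symmetric] powr_powr power2_eq_square flip: powr_add)
    then have "(2 powr (2 * real k)) powr s \<le> (1 + \<xi>\<^sup>2) powr s"
      using s by (intro powr_mono2) auto
    then have "2 powr (- 2 * s * real k) * (2 powr (2 * real k)) powr s
        \<le> 2 powr (- 2 * s * real k) * (1 + \<xi>\<^sup>2) powr s"
      by (intro mult_left_mono) auto
    moreover have "2 powr (- 2 * s * real k) * (2 powr (2 * real k)) powr s = 1"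
      by (simp add: powr_powr powr_add[symmetric])
    ultimately have "1 \<le> 2 powr (- 2 * s * real k) * (1 + \<xi>\<^sup>2) powr s"
      by linarith
    from mult_right_mono[OF this, of "(norm (g \<xi>))\<^sup>2"] show ?thesis
      using True by (simp add: piece_def mult.assoc)
  qed (simp add: piece_def)
  have "(L2sq (piece dyadic g (Suc k)))
      \<le> (LINT \<xi>|lborel. 2 powr (- 2 * s * real k) * ((1 + \<xi>\<^sup>2) powr s * (norm (g \<xi>))\<^sup>2))"
  proof (rule integral_mono[OF _ integrable_mult_right[OF w] le])
    show "square_integrable (piece dyadic g (Suc k))"
      by (rule Bochner_Integration.integrable_bound[OF g2]) (auto simp: piece_def indicator_def)
  qed
  then show ?thesis by simp
qed

lemma summable_powr_neg:
  assumes "r > 0"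
  shows "summable (\<lambda>k. 2 powr (- r * real k))"
proof -
  have "2 powr (- r * real k) = (2 powr (- r)) ^ k" for k
    by (simp add: powr_powr flip: powr_realpow)
  moreover have "2 powr (- r) < (1::real)" using assms by (simp add: powr_less_one)
  ultimately show ?thesis by (simp add: summable_geometric)
qed

text \<open>Here positivity of \<open>s\<close> enters: the L2 norm of the piece of size
  \<open>2 ^ k\<close> decays like \<open>2 powr (- s * k)\<close>, a geometric series.\<close>

lemma L2_partition_dyadic:
  fixes g :: "real \<Rightarrow> complex"
  assumes gm[measurable]: "g \<in> borel_measurable borel" and s: "s > 0"
    and w: "Hs_integrable s g"
  shows "L2_partition dyadic g"
proof -
  define A where "A = (Hs_sq s g)"
  have "summable (\<lambda>k. sqrt (L2sq (piece dyadic g (Suc k))))"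
  proof (rule summable_comparison_test')
    show "summable (\<lambda>k. 2 powr (- s * real k) * sqrt A)"
      by (intro summable_mult2 summable_powr_neg s)
    fix k
    have "sqrt (L2sq (piece dyadic g (Suc k))) \<le> sqrt (2 powr (- 2 * s * real k) * A)"
      unfolding A_def using s by (intro real_sqrt_le_mono dyadic_piece_norm w) auto
    also have "\<dots> = 2 powr (- s * real k) * sqrt A"
    proof -
      have "2 powr (- 2 * s * real k) = (2 powr (- s * real k))\<^sup>2"
        by (simp add: power2_eq_square powr_add[symmetric] mult.assoc)
      then show ?thesis by (simp add: real_sqrt_mult)
    qed
    finally show "norm (sqrt (L2sq (piece dyadic g (Suc k)))) \<le> 2 powr (- s * real k) * sqrt A"
      by simp
  qed
  then have "summable (\<lambda>k. sqrt (L2sq (piece dyadic g k)))"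
    by (subst (asm) summable_Suc_iff)
  then show ?thesis
    unfolding L2_partition_def
    using dyadic_bounded dyadic_disjoint dyadic_cover
        integrable_of_weighted[OF gm less_imp_le[OF s] w] by auto
qed

lemma norm_cis_diff_le: "norm (cis u - cis v) \<le> \<bar>u - v\<bar>"
proof -
  have "norm (cis u - cis v) \<le> 1 * norm (u - v)"
  proof (rule differentiable_bound[of UNIV cis "\<lambda>x z. z *\<^sub>R (\<i> * cis x)"])
    show "(cis has_derivative (\<lambda>z. z *\<^sub>R (\<i> * cis x))) (at x within UNIV)" for x
      using has_derivative_cis[OF has_derivative_ident, of x UNIV] by simp
    show "onorm (\<lambda>z. z *\<^sub>R (\<i> * cis x)) \<le> 1" for x
      by (intro onorm_le) (simp add: norm_mult)
  qed auto
  then show ?thesis by simp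
qed

text \<open>A crude bound whose constant depends on the frequency support. It is meant for a single
  fixed piece, where it beats the rate \<delta> < 1 as \<open>t\<close> tends to 0.\<close>

lemma evol_lipschitz:
  assumes g: "integrable lborel g" and b: "\<And>\<xi>. g \<xi> \<noteq> 0 \<Longrightarrow> \<bar>\<xi>\<bar> powr a \<le> B"
  shows "norm (evol a g t x - evol a g r x) \<le> \<bar>t - r\<bar> * (B * (LINT \<xi>|lborel. norm (g \<xi>)))"
proof -
  have [measurable]: "g \<in> borel_measurable borel"
    using g by (auto dest: borel_measurable_integrable)
  have i: "integrable lborel (\<lambda>\<xi>. cis (x * \<xi> + t * \<bar>\<xi>\<bar> powr a) * g \<xi>)" for t
    by (intro integrable_cis_mult g) measurable
  have "evol a g t x - evol a g r x
      = (LINT \<xi>|lborel. cis (x * \<xi> + t * \<bar>\<xi>\<bar> powr a) * g \<xi> - cis (x * \<xi> + r * \<bar>\<xi>\<bar> powr a) * g \<xi>)"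
    unfolding evol_def by (rule Bochner_Integration.integral_diff[symmetric, OF i i])
  then have "norm (evol a g t x - evol a g r x)
      \<le> (LINT \<xi>|lborel. norm (cis (x * \<xi> + t * \<bar>\<xi>\<bar> powr a) * g \<xi> - cis (x * \<xi> + r * \<bar>\<xi>\<bar> powr a)
      * g \<xi>))"
    by simp
  also have "\<dots> \<le> (LINT \<xi>|lborel. (\<bar>t - r\<bar> * B) * norm (g \<xi>))"
  proof (rule integral_mono)
    fix \<xi>
    show "norm (cis (x * \<xi> + t * \<bar>\<xi>\<bar> powr a) * g \<xi> - cis (x * \<xi> + r * \<bar>\<xi>\<bar> powr a) * g \<xi>)
        \<le> (\<bar>t - r\<bar> * B) * norm (g \<xi>)"
    proof (cases "g \<xi> = 0")
      case False
      have "norm (cis (x * \<xi> + t * \<bar>\<xi>\<bar> powr a) - cis (x * \<xi> + r * \<bar>\<xi>\<bar> powr a))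
          \<le> \<bar>(t - r) * \<bar>\<xi>\<bar> powr a\<bar>"
        using norm_cis_diff_le[of "x * \<xi> + t * \<bar>\<xi>\<bar> powr a" "x * \<xi> + r * \<bar>\<xi>\<bar> powr a"]
        by (simp add: left_diff_distrib)
      also have "\<dots> \<le> \<bar>t - r\<bar> * B"
        using b[OF False] by (simp add: abs_mult mult_left_mono)
      finally show ?thesis
        by (simp add: norm_mult mult_right_mono flip: left_diff_distrib)
    qed simp
  qed (use i g in auto)
  finally show ?thesis by (simp add: mult.assoc)
qed

lemma sqrt_le_add_div:
  fixes r l :: real
  assumes "r \<ge> 0" "l > 0"
  shows "sqrt r \<le> l + r / l"
proof -
  have "0 \<le> (sqrt r - l)\<^sup>2 + l * sqrt r" using assms by simp
  also have "\<dots> = r + l\<^sup>2 - l * sqrt r" using assms by (simp add: power2_diff)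
  finally have "l * sqrt r \<le> r + l * l" by (simp add: power2_eq_square)
  then show ?thesis using assms by (simp add: field_simps)
qed

lemma dyadic_powr_bounded:
  assumes "a \<ge> 0" "piece dyadic g j \<xi> \<noteq> 0"
  shows "\<bar>\<xi>\<bar> powr a \<le> (2 ^ j) powr a"
proof -
  have "\<xi> \<in> dyadic j" using assms by (auto simp: piece_def indicator_def split: if_splits)
  then have "\<bar>\<xi>\<bar> \<le> 2 ^ j" by (cases j) (auto simp: dyadic_def annulus_def)
  then show ?thesis using assms by (intro powr_mono2) auto
qed

theorem ae_convergence_rate_of_sobolev:
  assumes a: "a > 1" and \<delta>: "0 \<le> \<delta>" "\<delta> < 1" and s: "(a - 1) * \<delta> + max \<delta> (1/4) < s"
    and f: "f \<in> sobolev s"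
  shows "ae_convergence_rate a \<delta> f"
proof -
  define \<sigma> where "\<sigma> = (a - 1) * \<delta> + max \<delta> (1/4)"
  have "\<sigma> > 0" using a \<delta> by (simp add: \<sigma>_def add_nonneg_pos)
  then have s0: "s > 0" using s by (simp add: \<sigma>_def)
  \<comment> \<open>The annuli satisfy the maximal bound with exponent \<open>p\<close>; the
    remaining \<open>s - p\<close> produces the geometric decay that allows them to be
    summed.\<close>
  define p where "p = (\<sigma> + s) / 2"
  have p: "(a - 1) * \<delta> + max \<delta> (1/4) < p" "p < s"
    using s unfolding \<sigma>_def[symmetric] by (auto simp: p_def)
  define g where "g = fourier_fun f"
  \<comment> \<open>\<open>sobolev\<close> provides some transform \<open>g'\<close>, while
    \<open>schroedinger\<close> is built from the choice \<open>fourier_fun f\<close>. Uniqueness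
    transfers the weighted bound from one to the other.\<close>
  obtain g' where g': "represents g' (fourier_dist f)" "Hs_integrable s g'"
    using f by (auto simp: sobolev_def)
  have rg: "represents g (fourier_dist f)"
    unfolding g_def fourier_fun_def using g'(1)
    by (rule someI[where P = "\<lambda>g. represents g (fourier_dist f)"])
  then have gm[measurable]: "g \<in> borel_measurable borel" by (simp add: represents_def)
  have [measurable]: "g' \<in> borel_measurable borel" using g' by (simp add: represents_def)
  have ae: "AE \<xi> in lborel. (1 + \<xi>\<^sup>2) powr s * (norm (g' \<xi>))\<^sup>2 = (1 + \<xi>\<^sup>2) powr s * (norm (g \<xi>))\<^sup>2"
    using represents_unique[OF g'(1) rg] by eventually_elim simp
  have w: "Hs_integrable s g"
    using integrable_cong_AE[OF _ _ ae] g'(2) by simp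
  define A where "A = (Hs_sq s g)"
  have A: "A \<ge> 0" by (simp add: A_def)
  have S: "L2_partition dyadic g" by (rule L2_partition_dyadic[OF gm s0 w])
  \<comment> \<open>The representatives demanded by \<open>ae_convergence_rate\<close> are fixed
    here as pointwise series, for all \<open>t\<close> at once.\<close>
  define u where "u t = synth dyadic (\<lambda>\<xi>. cis (t * \<bar>\<xi>\<bar> powr a) * g \<xi>)" for t
  define f\<^sub>0 where "f\<^sub>0 = synth dyadic g"
  have St: "L2_partition dyadic (\<lambda>\<xi>. cis (t * \<bar>\<xi>\<bar> powr a) * g \<xi>)" for t
    by (rule L2_partition_modulate[OF S]) measurable
  have ru: "represents (u t) (schroedinger a t f)" for t
    unfolding u_def schroedinger_def g_def[symmetric] by (rule represents_synth(1)[OF St])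
  have rf: "represents f\<^sub>0 f"
  proof -
    have "f \<phi> = inv_fourier_dist (dist_of_fun g) \<phi>" if \<phi>: "\<phi> \<in> schwartz" for \<phi>
    proof -
      have "f \<phi> = fourier_dist f (inv_fourier \<phi>)"
        by (simp add: fourier_dist_def fourier_inv_fourier[OF \<phi>])
      also have "\<dots> = dist_of_fun g (inv_fourier \<phi>)"
        using rg schwartz_inv_fourier[OF \<phi>] by (simp add: represents_def)
      finally show ?thesis by (simp add: inv_fourier_dist_def)
    qed
    then show ?thesis
      using represents_synth(1)[OF S] unfolding f\<^sub>0_def represents_def by auto
  qed
  define e where "e j t x = evol a (piece dyadic g j) t x" for j t x
  have ue: "u t x = (\<Sum>j. 1 / (2 * of_real pi) * e j t x)" for t x
    by (simp only: u_def synth_def e_def evol_piece_eq)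
  have fe: "f\<^sub>0 x = (\<Sum>j. 1 / (2 * of_real pi) * e j 0 x)" for x
    by (simp add: f\<^sub>0_def synth_def e_def evol_def)
  obtain C where C: "C > 0"
      and rate: "\<And>j g. g \<in> borel_measurable borel \<Longrightarrow> (\<forall>\<xi>. \<xi> \<notin> annulus (2 ^ j) \<longrightarrow> g \<xi> = 0) \<Longrightarrow>
      square_integrable g \<Longrightarrow>
      (\<exists>W. rate_majorant a \<delta> g (C * (2 ^ j) powr (2 * p) * (L2sq g)) W)"
    by (rule annulus_rate_bound[OF a \<delta> p(1)]) (rule that)
  define Z where "Z k = C * (2 ^ k) powr (2 * p) * (L2sq (piece dyadic g (Suc k)))" for k
  have "\<exists>W. rate_majorant a \<delta> (piece dyadic g (Suc k)) (Z k) W" for k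
    unfolding Z_def using L2_partition_piece(1,3)[OF S, of "Suc k"]
    by (intro rate) (auto simp: piece_def dyadic_def)
  then have "\<exists>W. \<forall>k. rate_majorant a \<delta> (piece dyadic g (Suc k)) (Z k) (W k)"
    by (intro choice allI)
  then obtain W where W: "rate_majorant a \<delta> (piece dyadic g (Suc k)) (Z k) (W k)" for k
    by blast
  have Wm[measurable]: "\<And>k. W k \<in> borel_measurable borel"
    and We: "\<And>k x t. t \<noteq> 0 \<Longrightarrow> \<bar>t\<bar> \<le> 1 \<Longrightarrow> ennreal ((norm (e (Suc k) t x - e (Suc k) 0 x))\<^sup>2)
        \<le> ennreal (\<bar>t\<bar> powr (2 * \<delta>)) * W k x"
    and Wi: "\<And>k c. (\<integral>\<^sup>+x. W k x * indicator {c..c+1} x \<partial>lborel) \<le> ennreal (Z k)"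
    using W unfolding rate_majorant_def e_def by blast+
  \<comment> \<open>The integral of \<open>W k\<close> over a unit interval is of order \<open>(l k)\<^sup>2\<close>, hence \<open>\<Sum>k. W k x / l k\<close> converges a.e.,
     and \<open>sqrt (W k x) \<le> l k + W k x / l k\<close>.\<close>
  define l where "l k = 2 powr (- (s - p) * real k)" for k
  have l: "l k > 0" for k by (simp add: l_def)
  have ls: "summable l" unfolding l_def[abs_def] using p by (intro summable_powr_neg) simp
  have Wint: "(\<integral>\<^sup>+x. (ennreal (1 / l k) * W k x) * indicator {c..c+1} x \<partial>lborel)
      \<le> ennreal (C * A * l k)" for k c
  proof -
    have "(\<integral>\<^sup>+x. (ennreal (1 / l k) * W k x) * indicator {c..c+1} x \<partial>lborel)
        = ennreal (1 / l k) * (\<integral>\<^sup>+x. W k x * indicator {c..c+1} x \<partial>lborel)"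
      by (simp add: mult.assoc nn_integral_cmult)
    also have "\<dots> \<le> ennreal (1 / l k)
        * ennreal (C * (2 ^ k) powr (2 * p) * (2 powr (- 2 * s * real k) * A))"
    proof (intro mult_left_mono order_trans[OF Wi[unfolded Z_def]] ennreal_leI)
      show "(L2sq (piece dyadic g (Suc k))) \<le> 2 powr (- 2 * s * real k) * A"
        unfolding A_def using s0 by (intro dyadic_piece_norm w) auto
    qed (use C in auto)
    also have "\<dots> = ennreal (1 / l k * (C * (2 ^ k) powr (2 * p) * (2 powr (- 2 * s * real k) * A)))"
      using C A l[of k] by (intro ennreal_mult[symmetric]) auto
    also have "1 / l k * (C * (2 ^ k) powr (2 * p) * (2 powr (- 2 * s * real k) * A)) = C * A * l k"
    proof -
      have "(2 ^ k) powr (2 * p) * 2 powr (- 2 * s * real k) = l k * l k"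
        by (simp add: l_def powr_powr powr_add[symmetric] algebra_simps flip: powr_realpow)
      then have "1 / l k * (C * (2 ^ k) powr (2 * p) * (2 powr (- 2 * s * real k) * A))
          = 1 / l k * (C * A * (l k * l k))"
        by (simp add: mult_ac)
      then show ?thesis using l[of k] by simp
    qed
    finally show ?thesis .
  qed
  have aeW: "AE x in lborel. x \<in> {c..c+1} \<longrightarrow> (\<Sum>k. ennreal (1 / l k) * W k x) \<noteq> \<infinity>" for c
  proof -
    have "(\<integral>\<^sup>+x. (\<Sum>k. (ennreal (1 / l k) * W k x) * indicator {c..c+1} x) \<partial>lborel)
        = (\<Sum>k. \<integral>\<^sup>+x. (ennreal (1 / l k) * W k x) * indicator {c..c+1} x \<partial>lborel)"
      by (rule nn_integral_suminf) measurable
    also have "\<dots> \<le> (\<Sum>k. ennreal (C * A * l k))"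
      by (intro suminf_le Wint) auto
    also have "\<dots> = ennreal (\<Sum>k. C * A * l k)"
      using C A l ls by (intro suminf_ennreal2 summable_mult) (auto simp: less_imp_le)
    also have "\<dots> < \<infinity>" by simp
    finally have "AE x in lborel. (\<Sum>k. (ennreal (1 / l k) * W k x) * indicator {c..c+1} x) \<noteq> \<infinity>"
      by (intro nn_integral_noteq_infinite) auto
    then show ?thesis
      by eventually_elim (auto simp: indicator_def)
  qed
  \<comment> \<open>Countably many unit intervals with integer endpoints cover the line.\<close>
  have aeW': "AE x in lborel. \<forall>c::int. x \<in> {of_int c..of_int c+1} \<longrightarrow>
      (\<Sum>k. ennreal (1 / l k) * W k x) \<noteq> \<infinity>"
    unfolding AE_all_countable using aeW by blast
  have "AE x in lborel. ((\<lambda>t. \<bar>t\<bar> powr (- \<delta>) *\<^sub>R (u t x - f\<^sub>0 x)) \<longlongrightarrow> 0) (at 0)"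
    using aeW' AE_summable_synth[OF S]
  proof eventually_elim
    case (elim x)
    have "x \<in> {of_int \<lfloor>x\<rfloor>..of_int \<lfloor>x\<rfloor>+1}" by (simp add: less_imp_le)
    with elim(1) have fin: "(\<Sum>k. ennreal (1 / l k) * W k x) \<noteq> \<infinity>" by blast
    have e0s: "summable (\<lambda>j. e j 0 x)"
    proof -
      have e0: "e j 0 x = (LINT \<xi>|lborel. cis (x * \<xi>) * piece dyadic g j \<xi>)" for j
        by (simp add: e_def evol_def)
      show ?thesis unfolding e0 by (rule summable_norm_cancel[OF elim(2)])
    qed
    define r where "r k = enn2real (W k x)" for k
    have Wr: "W k x = ennreal (r k)" for k
    proof -
      have "ennreal (1 / l k) * W k x \<noteq> \<infinity>"
        using fin ennreal_suminf_lessD[of "\<lambda>k. ennreal (1 / l k) * W k x" \<infinity> k]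
        by (simp add: less_top)
      then have "W k x \<noteq> \<infinity>" using l[of k] by (auto simp: ennreal_mult_eq_top_iff)
      then show ?thesis by (simp add: r_def less_top)
    qed
    have r0: "r k \<ge> 0" for k by (simp add: r_def)
    have "summable (\<lambda>k. 1 / l k * r k)"
    proof (rule summable_suminf_not_top)
      show "0 \<le> 1 / l k * r k" for k using r0 l[of k] by simp
      show "(\<Sum>k. ennreal (1 / l k * r k)) \<noteq> \<top>"
      proof -
        have e: "ennreal (1 / l k * r k) = ennreal (1 / l k) * W k x" for k
          unfolding Wr using l[of k] r0[of k] by (intro ennreal_mult) auto
        show ?thesis unfolding e using fin by simp
      qed
    qed
    then have ms: "summable (\<lambda>k. l k + r k / l k)"
      using ls by (intro summable_add) auto
    have gp: "integrable lborel (piece dyadic g j)" for j by (rule L2_partition_piece(2)[OF S])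
    define B where "B j = (2 ^ j) powr a * (LINT \<xi>|lborel. norm (piece dyadic g j \<xi>))" for j
    have B0: "B j \<ge> 0" for j by (simp add: B_def)
    have lip: "norm (e j t x - e j 0 x) \<le> \<bar>t\<bar> * B j" for j t
    proof -
      have "norm (e j t x - e j 0 x) \<le> \<bar>t - 0\<bar> * B j"
        unfolding e_def B_def by (rule evol_lipschitz[OF gp])
            (rule dyadic_powr_bounded; use a in simp)
      then show ?thesis by simp
    qed
    \<comment> \<open>A summable majorant uniform in \<open>t\<close>: for the low frequencies from
      the Lipschitz bound and \<delta> < 1, for the annuli from \<open>W\<close>.\<close>
    define M where "M j = (case j of 0 \<Rightarrow> B 0 | Suc k \<Rightarrow> l k + r k / l k)" for j
    have Ms: "summable M"
      using ms by (subst summable_Suc_iff[symmetric]) (simp add: M_def)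
    define d where "d j t = \<bar>t\<bar> powr (- \<delta>) *\<^sub>R (e j t x - e j 0 x)" for j t
    have dM: "norm (d j t) \<le> M j" if t: "t \<noteq> 0" "\<bar>t\<bar> \<le> 1" for j t
    proof (cases j)
      case 0
      have "norm (d 0 t) \<le> \<bar>t\<bar> powr (- \<delta>) * (\<bar>t\<bar> * B 0)"
        unfolding d_def norm_scaleR using lip[of 0 t] by (simp add: mult_left_mono)
      also have "\<dots> = \<bar>t\<bar> powr (1 - \<delta>) * B 0"
        using t by (simp add: powr_diff powr_minus field_simps)
      also have "\<dots> \<le> 1 * B 0"
        using t \<delta> B0[of 0] by (intro mult_right_mono powr_le1) auto
      finally show ?thesis using 0 by (simp add: M_def)
    next
      case (Suc k)
      have "ennreal ((norm (e (Suc k) t x - e (Suc k) 0 x))\<^sup>2) \<le> ennreal (\<bar>t\<bar> powr (2 * \<delta>) * r k)"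
        using We[OF t, of k x] r0 by (simp add: Wr ennreal_mult)
      then have "(norm (e (Suc k) t x - e (Suc k) 0 x))\<^sup>2 \<le> \<bar>t\<bar> powr (2 * \<delta>) * r k"
        using r0 by (subst (asm) ennreal_le_iff) auto
      then have "norm (e (Suc k) t x - e (Suc k) 0 x) \<le> sqrt (\<bar>t\<bar> powr (2 * \<delta>) * r k)"
        by (rule real_le_rsqrt)
      also have "\<dots> = \<bar>t\<bar> powr \<delta> * sqrt (r k)"
      proof -
        have "\<bar>t\<bar> powr (2 * \<delta>) = (\<bar>t\<bar> powr \<delta>)\<^sup>2" by (simp add: power2_eq_square powr_add[symmetric])
        then show ?thesis by (simp add: real_sqrt_mult)
      qed
      finally have "norm (d (Suc k) t) \<le> \<bar>t\<bar> powr (- \<delta>) * (\<bar>t\<bar> powr \<delta> * sqrt (r k))"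
        unfolding d_def norm_scaleR by (simp add: mult_left_mono)
      also have "\<dots> = sqrt (r k)" using t by (simp add: powr_minus)
      also have "\<dots> \<le> l k + r k / l k" by (rule sqrt_le_add_div[OF r0 l])
      finally show ?thesis using Suc by (simp add: M_def)
    qed
    have ev: "\<forall>\<^sub>F t in at 0. t \<noteq> 0 \<and> \<bar>t\<bar> \<le> (1::real)"
      unfolding eventually_at by (rule exI[of _ 1]) (auto simp: dist_real_def)
    have lim: "((\<lambda>t. d j t) \<longlongrightarrow> 0) (at 0)" for j
    proof (rule Lim_null_comparison)
      show "\<forall>\<^sub>F t in at 0. norm (d j t) \<le> \<bar>t\<bar> powr (1 - \<delta>) * B j"
        using ev
      proof eventually_elim
        case (elim t)
        have "norm (d j t) \<le> \<bar>t\<bar> powr (- \<delta>) * (\<bar>t\<bar> * B j)"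
          unfolding d_def norm_scaleR using lip[of j t] by (simp add: mult_left_mono)
        then show ?case using elim by (simp add: powr_diff powr_minus field_simps)
      qed
      have "((\<lambda>t. \<bar>t\<bar> powr (1 - \<delta>)) \<longlongrightarrow> 0) (at (0::real))"
        using \<delta> by (intro tendsto_eq_intros | simp)+
      then show "((\<lambda>t. \<bar>t\<bar> powr (1 - \<delta>) * B j) \<longlongrightarrow> 0) (at (0::real))"
        by (rule tendsto_mult_left_zero)
    qed
    \<comment> \<open>Dominated convergence for series: each term tends to 0 by the Lipschitz bound,
      and \<open>M\<close> is the majorant.\<close>
    have "((\<lambda>t. \<Sum>j. d j t) \<longlongrightarrow> (\<Sum>j. 0)) (at 0)"
    proof (rule tannerys_theorem[THEN conjunct2, THEN conjunct2])
      have "\<forall>\<^sub>F p in sequentially \<times>\<^sub>F at 0. True \<and> (snd p \<noteq> 0 \<and> \<bar>snd p\<bar> \<le> (1::real))"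
        by (rule eventually_prodI[OF _ ev]) simp
      then show "\<forall>\<^sub>F (j, t) in sequentially \<times>\<^sub>F at 0. norm (d j t) \<le> M j"
        by eventually_elim (use dM in auto)
    qed (use lim Ms in auto)
    then have "((\<lambda>t. 1 / (2 * of_real pi) * (\<Sum>j. d j t)) \<longlongrightarrow> 0) (at 0)"
      by (intro tendsto_mult_right_zero) simp
    moreover have "\<forall>\<^sub>F t in at 0. 1 / (2 * of_real pi) * (\<Sum>j. d j t)
        = \<bar>t\<bar> powr (- \<delta>) *\<^sub>R (u t x - f\<^sub>0 x)"
      using ev
    proof eventually_elim
      case (elim t)
      \<comment> \<open>Convergence of the series at time \<open>t\<close> is deduced from that at
        time 0 and the majorant, not from the a.e. statement at time \<open>t\<close>; so the
        exceptional set does not depend on \<open>t\<close>.\<close>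
      have ds: "summable (\<lambda>j. d j t)"
        by (rule summable_comparison_test'[OF Ms, of 0]) (use elim dM in auto)
      then have "summable (\<lambda>j. \<bar>t\<bar> powr \<delta> *\<^sub>R d j t)" by (rule summable_scaleR_right)
      moreover have "\<bar>t\<bar> powr \<delta> *\<^sub>R d j t = e j t x - e j 0 x" for j
        using elim by (simp add: d_def powr_minus)
      ultimately have des: "summable (\<lambda>j. e j t x - e j 0 x)" by simp
      have ets: "summable (\<lambda>j. e j t x)" using summable_add[OF des e0s] by simp
      have "u t x - f\<^sub>0 x = 1 / (2 * of_real pi) * (\<Sum>j. e j t x - e j 0 x)"
        unfolding ue fe suminf_mult[OF ets] suminf_mult[OF e0s] suminf_diff[OF ets e0s, symmetric]
        by (simp only: right_diff_distrib)
      moreover have "(\<Sum>j. d j t) = \<bar>t\<bar> powr (- \<delta>) *\<^sub>R (\<Sum>j. e j t x - e j 0 x)"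
        unfolding d_def by (rule suminf_scaleR_right[OF des, symmetric])
      ultimately show ?case by simp
    qed
    ultimately show ?case
      by (rule Lim_transform_eventually)
  qed
  then show ?thesis
    unfolding ae_convergence_rate_def using ru rf by blast
qed

section \<open>Necessity\<close>

text \<open>When \<open>k j\<close> is chosen there are only finitely many earlier indices, so
  finitely many eventual conditions have to hold at once. In \<open>P\<close> the first two
  arguments are positions in the subsequence, the last two the selected indices.\<close>

lemma subsequence_selection:
  fixes P :: "nat \<Rightarrow> nat \<Rightarrow> nat \<Rightarrow> nat \<Rightarrow> bool" and Q :: "nat \<Rightarrow> nat \<Rightarrow> bool"
  assumes P: "\<And>i j m. \<forall>\<^sub>F n in sequentially. P i j m n" and Q: "\<And>j. \<forall>\<^sub>F n in sequentially. Q j n"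
  shows "\<exists>k. strict_mono k \<and> (\<forall>j. Q j (k j)) \<and> (\<forall>i j. i < j \<longrightarrow> P i j (k i) (k j))"
proof -
  define R where "R j ks n \<longleftrightarrow> Q j n \<and> (\<forall>i<j. ks i < n \<and> P i j (ks i) n)" for j n
      and ks :: "nat \<Rightarrow> nat"
  have ev: "\<forall>\<^sub>F n in sequentially. R j ks n" for j ks
    unfolding R_def
  proof (intro eventually_conj Q)
    have "\<forall>\<^sub>F n in sequentially. \<forall>i\<in>{..<j}. ks i < n \<and> P i j (ks i) n"
      by (intro eventually_ball_finite ballI eventually_conj P eventually_gt_at_top) simp
    then show "\<forall>\<^sub>F n in sequentially. \<forall>i<j. ks i < n \<and> P i j (ks i) n"
      by (rule eventually_mono) auto
  qed
  have "\<exists>k. \<forall>j. R j k (k j)"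
  proof (rule dependent_wellorder_choice)
    show "R j f r = R j g r" if "\<And>i. i < j \<Longrightarrow> f i = g i" for j f g r
      using that by (auto simp: R_def)
    show "\<exists>n. R j f n" for j f
      using ev[of j f] by (auto simp: eventually_sequentially)
  qed
  then obtain k where k: "\<And>j. R j k (k j)" by blast
  then have "i < j \<Longrightarrow> k i < k j" for i j by (auto simp: R_def)
  then have "strict_mono k" by (rule strict_monoI)
  then show ?thesis using k by (auto simp: R_def)
qed

section \<open>Distributions with prescribed Fourier transform\<close>

lemma schwartz_seminorm_upper:
  assumes "\<phi> \<in> schwartz"
  shows "\<bar>x\<bar> ^ k * norm (nth_deriv n \<phi> x) \<le> schwartz_seminorm k n \<phi>"
  unfolding schwartz_seminorm_def
proof (rule cSUP_upper)
  obtain C where "\<forall>x. \<bar>x\<bar> ^ k * norm (nth_deriv n \<phi> x) \<le> C"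
    using schwartz_bound[OF assms] by blast
  then show "bdd_above (range (\<lambda>x. \<bar>x\<bar> ^ k * norm (nth_deriv n \<phi> x)))"
    by (intro bdd_aboveI[of _ C]) auto
qed simp

text \<open>Continuity is read off from the representative \<open>synth S g\<close>: it is
  integrable against \<open>inverse (1 + x\<^sup>2)\<close>, and
  \<open>(1 + x\<^sup>2) * norm (\<phi> x)\<close> is controlled by the two seminorms with
  \<open>k = 0\<close> and \<open>k = 2\<close>, without derivatives.\<close>

lemma tempered_inv_fourier_dist:
  assumes S: "L2_partition S g"
  shows "tempered (inv_fourier_dist (dist_of_fun g))"
proof -
  have gm: "g \<in> borel_measurable borel" and g2: "square_integrable g"
    using S by (auto simp: L2_partition_def)
  have gi: "integrable lborel (\<lambda>\<xi>. g \<xi> * inv_fourier \<phi> \<xi>)" if "\<phi> \<in> schwartz" for \<phi>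
    by (intro L2_schwartz_integrable gm g2 schwartz_inv_fourier that)
  have ci: "integrable lborel (\<lambda>x. cis (\<xi> * x) * \<phi> x)" if "\<phi> \<in> schwartz" for \<phi> \<xi>
    by (intro integrable_cis_mult schwartz_integrable that) measurable
  define K where "K = (LINT x|lborel. norm (synth S g x * of_real (inverse (1 + x\<^sup>2))))"
  have K: "K \<ge> 0" by (simp add: K_def)
  have bound: "norm (inv_fourier_dist (dist_of_fun g) \<phi>)
      \<le> K * (\<Sum>k\<le>2. \<Sum>n\<le>2. schwartz_seminorm k n \<phi>)"
    if \<phi>: "\<phi> \<in> schwartz" for \<phi>
  proof -
    define N where "N = schwartz_seminorm 0 0 \<phi> + schwartz_seminorm 2 0 \<phi>"
    have N: "norm (\<phi> x) * (1 + x\<^sup>2) \<le> N" for x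
      using schwartz_seminorm_upper[OF \<phi>, of x 0 0] schwartz_seminorm_upper[OF \<phi>, of x 2 0]
      by (simp add: N_def distrib_left mult.commute)
    have sn: "0 \<le> schwartz_seminorm k n \<phi>" for k n
      using schwartz_seminorm_upper[OF \<phi>, of 0 k n] by (rule order_trans[rotated]) simp
    have "inv_fourier_dist (dist_of_fun g) \<phi> = (LINT x|lborel. synth S g x * \<phi> x)"
        and i: "integrable lborel (\<lambda>x. synth S g x * \<phi> x)"
      using represents_synth(1)[OF S] \<phi> by (auto simp: represents_def dist_of_fun_def)
    then have "norm (inv_fourier_dist (dist_of_fun g) \<phi>)
        \<le> (LINT x|lborel. norm (synth S g x * \<phi> x))"
      by simp
    also have "\<dots> \<le> (LINT x|lborel. norm (synth S g x * of_real (inverse (1 + x\<^sup>2))) * N)"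
    proof (rule integral_mono)
      fix x :: real
      have p: "1 + x\<^sup>2 > 0" by (simp add: add_pos_nonneg)
      have "norm (\<phi> x) \<le> inverse (1 + x\<^sup>2) * N"
        using N[of x] p by (simp add: field_simps)
      then have "norm (synth S g x) * norm (\<phi> x) \<le> norm (synth S g x) * (inverse (1 + x\<^sup>2) * N)"
        by (rule mult_left_mono) simp
      then show "norm (synth S g x * \<phi> x) \<le> norm (synth S g x * of_real (inverse (1 + x\<^sup>2))) * N"
        using p by (simp add: norm_mult mult.assoc del: of_real_inverse)
    qed (use i represents_synth(2)[OF S] in \<open>auto simp del: of_real_inverse\<close>)
    also have "\<dots> = K * N" by (simp add: K_def)
    also have "\<dots> \<le> K * (\<Sum>k\<le>2. \<Sum>n\<le>2. schwartz_seminorm k n \<phi>)"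
    proof (rule mult_left_mono[OF _ K])
      have "schwartz_seminorm k 0 \<phi> \<le> (\<Sum>n\<le>2. schwartz_seminorm k n \<phi>)" for k
        by (rule member_le_sum) (use sn in auto)
      then have "N \<le> (\<Sum>n\<le>2. schwartz_seminorm 0 n \<phi>) + (\<Sum>n\<le>2. schwartz_seminorm 2 n \<phi>)"
        unfolding N_def by (intro add_mono)
      also have "\<dots> = (\<Sum>k\<in>{0, 2::nat}. \<Sum>n\<le>2. schwartz_seminorm k n \<phi>)" by simp
      also have "\<dots> \<le> (\<Sum>k\<le>2. \<Sum>n\<le>2. schwartz_seminorm k n \<phi>)"
        by (rule sum_mono2) (use sn in \<open>auto intro: sum_nonneg\<close>)
      finally show "N \<le> (\<Sum>k\<le>2. \<Sum>n\<le>2. schwartz_seminorm k n \<phi>)" .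
    qed
    finally show ?thesis .
  qed
  have add: "inv_fourier (\<lambda>x. \<phi> x + \<psi> x) \<xi> = inv_fourier \<phi> \<xi> + inv_fourier \<psi> \<xi>"
      if "\<phi> \<in> schwartz" "\<psi> \<in> schwartz" for \<phi> \<psi> \<xi>
    using ci[OF that(1), of \<xi>] ci[OF that(2), of \<xi>] by (simp add: inv_fourier_def distrib_left)
  have cm: "inv_fourier (\<lambda>x. c * \<phi> x) \<xi> = c * inv_fourier \<phi> \<xi>" for c \<phi> \<xi>
    unfolding inv_fourier_def mult.left_commute[of _ c] integral_mult_right_zero
    by (simp only: mult_ac)
  show ?thesis
    unfolding tempered_def
  proof (intro conjI ballI allI)
    fix \<phi> \<psi> assume \<phi>: "\<phi> \<in> schwartz" and \<psi>: "\<psi> \<in> schwartz"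
    show "inv_fourier_dist (dist_of_fun g) (\<lambda>x. \<phi> x + \<psi> x)
        = inv_fourier_dist (dist_of_fun g) \<phi> + inv_fourier_dist (dist_of_fun g) \<psi>"
      using gi[OF \<phi>] gi[OF \<psi>] by
          (simp add: inv_fourier_dist_def dist_of_fun_def add[OF \<phi> \<psi>] distrib_left)
  next
    fix c \<phi>
    show "inv_fourier_dist (dist_of_fun g) (\<lambda>x. c * \<phi> x) = c * inv_fourier_dist (dist_of_fun g) \<phi>"
      unfolding inv_fourier_dist_def dist_of_fun_def cm mult.left_commute[of _ c]
      by (rule integral_mult_right_zero)
  next
    show "\<exists>C N. \<forall>\<phi>\<in>schwartz. norm (inv_fourier_dist (dist_of_fun g) \<phi>)
        \<le> C * (\<Sum>k\<le>N. \<Sum>n\<le>N. schwartz_seminorm k n \<phi>)"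
      using bound by blast
  qed
qed

lemma represents_fourier_dist_inv:
  assumes S: "L2_partition S g"
  shows "represents g (fourier_dist (inv_fourier_dist (dist_of_fun g)))"
proof -
  have gm: "g \<in> borel_measurable borel" and g2: "square_integrable g"
    using S by (auto simp: L2_partition_def)
  show ?thesis
    unfolding represents_def
    by (auto simp: gm fourier_dist_def inv_fourier_dist_def inv_fourier_fourier intro:
        L2_schwartz_integrable[OF gm g2])
qed

lemma sobolev_inv_fourier_dist:
  assumes S: "L2_partition S g" and w: "Hs_integrable s g"
  shows "inv_fourier_dist (dist_of_fun g) \<in> sobolev s"
  using tempered_inv_fourier_dist[OF S] represents_fourier_dist_inv[OF S] w
  by (auto simp: sobolev_def)

text \<open>\<open>fourier_fun\<close> is a choice and need not return \<open>g\<close>; the two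
  agree a.e., hence as distributions also after modulation.\<close>

lemma represents_schroedinger:
  assumes S: "L2_partition S g"
  shows "represents (synth S (\<lambda>\<xi>. cis (t * \<bar>\<xi>\<bar> powr a)
      * g \<xi>)) (schroedinger a t (inv_fourier_dist (dist_of_fun g)))"
proof -
  define f where "f = inv_fourier_dist (dist_of_fun g)"
  have rg: "represents g (fourier_dist f)" unfolding f_def
      by (rule represents_fourier_dist_inv[OF S])
  have rf: "represents (fourier_fun f) (fourier_dist f)"
    unfolding fourier_fun_def using rg
    by (rule someI[where P = "\<lambda>g. represents g (fourier_dist f)"])
  have ae: "AE \<xi> in lborel. fourier_fun f \<xi> = g \<xi>" by (rule represents_unique[OF rf rg])
  have [measurable]: "g \<in> borel_measurable borel" "fourier_fun f \<in> borel_measurable borel"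
    using rg rf by (auto simp: represents_def)
  have St: "L2_partition S (\<lambda>\<xi>. cis (t * \<bar>\<xi>\<bar> powr a) * g \<xi>)"
    by (rule L2_partition_modulate[OF S]) measurable
  have "schroedinger a t f \<phi> = inv_fourier_dist (dist_of_fun (\<lambda>\<xi>. cis (t * \<bar>\<xi>\<bar> powr a) * g \<xi>)) \<phi>"
      if "\<phi> \<in> schwartz" for \<phi>
  proof -
    have [measurable]: "inv_fourier \<phi> \<in> borel_measurable borel"
      by (intro schwartz_measurable schwartz_inv_fourier that)
    show ?thesis
      unfolding schroedinger_def inv_fourier_dist_def dist_of_fun_def
      by (rule integral_cong_AE) (use ae in \<open>auto elim: eventually_mono\<close>)
  qed
  then show ?thesis
    using represents_synth(1)[OF St] unfolding represents_def f_def[symmetric] by auto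
qed

text \<open>A representative of \<open>S\<^sup>a f(\<cdot>,t)\<close> is determined only almost everywhere, with a null set depending on
  \<open>t\<close>. Therefore only the countably many times in the sets \<open>T n\<close> may be used.\<close>

theorem gliding_hump:
  fixes G :: "nat \<Rightarrow> real \<Rightarrow> complex" and T :: "nat \<Rightarrow> real set"
  assumes a: "a > 1" and \<delta>: "0 \<le> \<delta>" "\<delta> < 1" and s: "s > 0"
    and Gm[measurable]: "\<And>n. G n \<in> borel_measurable borel"
        and supp: "\<And>n \<xi>. G n \<xi> \<noteq> 0 \<Longrightarrow> \<xi> \<in> annulus (2 ^ n)"
    and Gi: "\<And>n. Hs_integrable s (G n)"
    and Glim: "(\<lambda>n. Hs_sq s (G n)) \<longlonglongrightarrow> 0"
    and T: "\<And>n. countable (T n)" "\<And>n t. t \<in> T n \<Longrightarrow> t \<noteq> 0" "\<And>n t. t \<in> T n \<Longrightarrow> \<bar>t\<bar> \<le> \<tau> n" and \<tau>: "\<tau> \<longlonglongrightarrow> 0"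
    and lower: "\<forall>\<^sub>F n in sequentially. \<forall>x\<in>{1/2..1}. \<exists>t\<in>T n. norm (evol a (G n) t x - evol a (G n) 0 x) \<ge> 2 * \<bar>t\<bar> powr \<delta>"
    and cross: "\<And>n \<eta>. \<eta> > 0 \<Longrightarrow>
        \<forall>\<^sub>F m in sequentially. \<forall>t\<in>T n. \<forall>x\<in>{1/2..1}. norm (evol a (G m) t x - evol a (G m) 0 x)
        \<le> \<eta> * \<bar>t\<bar> powr \<delta>"
  shows "\<exists>f\<in>sobolev s. \<not> ae_convergence_rate a \<delta> f"
proof -
  define D where "D n t x = evol a (G n) t x - evol a (G n) 0 x" for n t x
  define H where "H n = (Hs_sq s (G n))" for n
  have H0: "H n \<ge> 0" for n by (simp add: H_def)
  have G2: "square_integrable (G n)" for n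
    by (rule integrable_of_weighted[OF Gm less_imp_le[OF s] Gi])
  have G1: "integrable lborel (G n)" for n
    by (rule integrable_of_square_integrable[OF _ annulus_bounded _ _ G2]) (use supp in auto)
  \<comment> \<open>An earlier packet at the much smaller times of a later one: its change is at
    most a multiple of \<open>\<bar>t\<bar>\<close>, which is negligible against
    \<open>\<bar>t\<bar> powr \<delta>\<close> because \<delta> < 1.\<close>
  have past: "\<forall>\<^sub>F n in sequentially. \<forall>t\<in>T n. \<forall>x\<in>{1/2..1}. norm (D m t x) \<le> \<eta> * \<bar>t\<bar> powr \<delta>"
      if \<eta>: "\<eta> > 0" for m \<eta>
  proof -
    define B where "B = (2 * 2 ^ m) powr a * (LINT \<xi>|lborel. norm (G m \<xi>))"
    have B: "B \<ge> 0" by (simp add: B_def)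
    have lip: "norm (D m t x) \<le> \<bar>t\<bar> * B" for t x
    proof -
      have "norm (D m t x) \<le> \<bar>t - 0\<bar> * B"
        unfolding D_def B_def
      proof (rule evol_lipschitz[OF G1])
        fix \<xi> assume "G m \<xi> \<noteq> 0"
        from supp[OF this] show "\<bar>\<xi>\<bar> powr a \<le> (2 * 2 ^ m) powr a"
          using a by (intro powr_mono2) (auto simp: annulus_def)
      qed
      then show ?thesis by simp
    qed
    have "(\<lambda>n. \<bar>\<tau> n\<bar> powr (1 - \<delta>) * B) \<longlonglongrightarrow> \<bar>0\<bar> powr (1 - \<delta>) * B"
      using \<delta> by (intro tendsto_intros \<tau>) auto
    then have "\<forall>\<^sub>F n in sequentially. \<bar>\<tau> n\<bar> powr (1 - \<delta>) * B < \<eta>"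
      using \<eta> \<delta> by (intro order_tendstoD(2)) auto
    then show ?thesis
    proof eventually_elim
      case (elim n)
      show ?case
      proof (intro ballI)
        fix t x assume t: "t \<in> T n"
        have "\<bar>t\<bar> powr (1 - \<delta>) * B \<le> \<bar>\<tau> n\<bar> powr (1 - \<delta>) * B"
          using T(3)[OF t] \<delta> B by (intro mult_right_mono powr_mono2) auto
        then have le: "\<bar>t\<bar> powr (1 - \<delta>) * B \<le> \<eta>" using elim by simp
        have "norm (D m t x) \<le> \<bar>t\<bar> powr \<delta> * (\<bar>t\<bar> powr (1 - \<delta>) * B)"
          using lip[of t x] T(2)[OF t] by (simp add: powr_add[symmetric] flip: mult.assoc)
        also have "\<dots> \<le> \<bar>t\<bar> powr \<delta> * \<eta>" using le by (intro mult_left_mono) auto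
        finally show "norm (D m t x) \<le> \<eta> * \<bar>t\<bar> powr \<delta>" by (simp add: mult.commute)
      qed
    qed
  qed
  \<comment> \<open>The total 1/4 leaves the chosen packet, of size at least
    \<open>2 * \<bar>t\<bar> powr \<delta>\<close>, dominant over all the others together.\<close>
  define q where "q j = (1/2::real) ^ (j + 3)" for j :: nat
  have q: "q j > 0" for j by (simp add: q_def)
  have qs: "summable q" and qsum: "(\<Sum>j. q j) = 1/4"
  proof -
    have "(\<lambda>j. (1/2::real) ^ 3 * (1/2) ^ j) sums ((1/2) ^ 3 * (1 / (1 - 1/2)))"
      by (intro sums_mult geometric_sums) auto
    then have "q sums (1/4)" by (simp add: q_def[abs_def] power_add mult.commute power3_eq_cube)
    then show "summable q" "(\<Sum>j. q j) = 1/4" by (auto simp: sums_iff)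
  qed
  \<comment> \<open>The interaction of two packets in both orders: the later one at the times of the
    earlier one (\<open>cross\<close>), and the earlier one at the times of the later one
    (\<open>past\<close>).\<close>
  define P where "P i j m n \<longleftrightarrow> (\<forall>t\<in>T m. \<forall>x\<in>{1/2..1}. norm (D n t x) \<le> q j * \<bar>t\<bar> powr \<delta>) \<and>
      (\<forall>t\<in>T n. \<forall>x\<in>{1/2..1}. norm (D m t x) \<le> q i * \<bar>t\<bar> powr \<delta>)" for i j m n :: nat
  \<comment> \<open>The square makes the norms themselves, and not only their squares, summable, as
    \<open>L2_partition\<close> requires.\<close>
  define Q where "Q j n \<longleftrightarrow> H n \<le> ((1/2) ^ j)\<^sup>2 \<and>
      (\<forall>x\<in>{1/2..1}. \<exists>t\<in>T n. norm (D n t x) \<ge> 2 * \<bar>t\<bar> powr \<delta>)" for j n :: nat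
  have "\<exists>k. strict_mono k \<and> (\<forall>j. Q j (k j)) \<and> (\<forall>i j. i < j \<longrightarrow> P i j (k i) (k j))"
  proof (rule subsequence_selection)
    show "\<forall>\<^sub>F n in sequentially. P i j m n" for i j m
      unfolding P_def using cross[OF q, of m j] past[OF q, of m i]
      by (auto simp: D_def eventually_conj_iff)
    have Hl: "\<forall>\<^sub>F n in sequentially. H n < ((1/2) ^ j)\<^sup>2" for j :: nat
      using Glim unfolding H_def[symmetric] by (intro order_tendstoD(2)) auto
    have "\<forall>\<^sub>F n in sequentially. H n \<le> ((1/2) ^ j)\<^sup>2" for j :: nat
      by (rule eventually_mono[OF Hl[of j]]) simp
    then show "\<forall>\<^sub>F n in sequentially. Q j n" for j
      unfolding Q_def using lower by (auto simp: D_def eventually_conj_iff)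
  qed
  then obtain k where mono: "strict_mono k" and kQ: "\<And>j. Q j (k j)"
      and kP: "\<And>i j. i < j \<Longrightarrow> P i j (k i) (k j)"
    by blast
  define S where "S j = annulus (2 ^ k j)" for j
  define g where "g \<xi> = (\<Sum>j. G (k j) \<xi>)" for \<xi>
  have Sd: "S j = dyadic (Suc (k j))" for j by (simp add: S_def dyadic_def)
  have disj: "disjoint_family S"
    using dyadic_disjoint strict_mono_eq[OF mono] unfolding disjoint_family_on_def Sd by auto
  have g_on: "g \<xi> = G (k j) \<xi>" if "\<xi> \<in> S j" for j \<xi>
  proof -
    have z: "G (k i) \<xi> = 0" if "i \<noteq> j" for i
      using supp[of "k i" \<xi>] disj that \<open>\<xi> \<in> S j\<close> unfolding S_def disjoint_family_on_def by blast
    show ?thesis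
      unfolding g_def using suminf_finite[of "{j}" "\<lambda>i. G (k i) \<xi>"] z by auto
  qed
  have g_off: "g \<xi> = 0" if "\<xi> \<notin> (\<Union>j. S j)" for \<xi>
  proof -
    have "G (k i) \<xi> = 0" for i using supp[of "k i" \<xi>] that by (auto simp: S_def)
    then show ?thesis by (simp add: g_def)
  qed
  have pieceG: "piece S g j = G (k j)" for j
  proof
    fix \<xi>
    show "piece S g j \<xi> = G (k j) \<xi>"
      using g_on[of \<xi> j] supp[of "k j" \<xi>] by (auto simp: piece_def S_def indicator_def)
  qed
  have gm[measurable]: "g \<in> borel_measurable borel"
    unfolding g_def[abs_def] by measurable
  have w: "Hs_integrable s g"
  proof (rule integrableI_bounded)
    have pt: "ennreal ((1 + \<xi>\<^sup>2) powr s * (norm (g \<xi>))\<^sup>2)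
        \<le> (\<Sum>j. ennreal ((1 + \<xi>\<^sup>2) powr s * (norm (G (k j) \<xi>))\<^sup>2))" for \<xi>
    proof (cases "\<xi> \<in> (\<Union>j. S j)")
      case True
      then obtain j where "\<xi> \<in> S j" by blast
      then have "ennreal ((1 + \<xi>\<^sup>2) powr s * (norm (g \<xi>))\<^sup>2)
          = (\<Sum>i\<in>{j}. ennreal ((1 + \<xi>\<^sup>2) powr s * (norm (G (k i) \<xi>))\<^sup>2))"
        by (simp add: g_on)
      also have "\<dots> \<le> (\<Sum>j. ennreal ((1 + \<xi>\<^sup>2) powr s * (norm (G (k j) \<xi>))\<^sup>2))"
        by (rule sum_le_suminf) auto
      finally show ?thesis .
    qed (simp add: g_off)
    have "(\<integral>\<^sup>+\<xi>. ennreal (norm ((1 + \<xi>\<^sup>2) powr s * (norm (g \<xi>))\<^sup>2)) \<partial>lborel)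
        \<le> (\<integral>\<^sup>+\<xi>. (\<Sum>j. ennreal ((1 + \<xi>\<^sup>2) powr s * (norm (G (k j) \<xi>))\<^sup>2)) \<partial>lborel)"
    proof (rule nn_integral_mono)
      fix \<xi>
      have nn: "norm ((1 + \<xi>\<^sup>2) powr s * (norm (g \<xi>))\<^sup>2) = (1 + \<xi>\<^sup>2) powr s * (norm (g \<xi>))\<^sup>2"
        by (simp add: abs_mult)
      show "ennreal (norm ((1 + \<xi>\<^sup>2) powr s * (norm (g \<xi>))\<^sup>2))
          \<le> (\<Sum>j. ennreal ((1 + \<xi>\<^sup>2) powr s * (norm (G (k j) \<xi>))\<^sup>2))"
        unfolding nn by (rule pt)
    qed
    also have "\<dots> = (\<Sum>j. \<integral>\<^sup>+\<xi>. ennreal ((1 + \<xi>\<^sup>2) powr s * (norm (G (k j) \<xi>))\<^sup>2) \<partial>lborel)"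
      by (rule nn_integral_suminf) measurable
    also have "\<dots> = (\<Sum>j. ennreal (H (k j)))"
      unfolding H_def by (intro arg_cong[where f = suminf] ext nn_integral_eq_integral Gi) auto
    also have "\<dots> \<le> (\<Sum>j. ennreal (((1/2) ^ j)\<^sup>2))"
      using kQ by (intro suminf_le ennreal_leI) (auto simp: Q_def)
    also have "\<dots> = ennreal (\<Sum>j. ((1/2) ^ j)\<^sup>2)"
    proof (rule suminf_ennreal2)
      have "summable (\<lambda>j. (1/4::real) ^ j)" by (rule summable_geometric) simp
      moreover have "((1/2::real) ^ j)\<^sup>2 = (1/4) ^ j" for j :: nat
        by (simp add: power2_eq_square flip: power_mult_distrib)
      ultimately show "summable (\<lambda>j. ((1/2::real) ^ j)\<^sup>2)" by simp
    qed simp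
    also have "\<dots> < \<infinity>" by simp
    finally show "(\<integral>\<^sup>+\<xi>. ennreal (norm ((1 + \<xi>\<^sup>2) powr s * (norm (g \<xi>))\<^sup>2)) \<partial>lborel) < \<infinity>" .
  qed measurable
  have LS: "L2_partition S g"
  proof -
    have "summable (\<lambda>j. sqrt (L2sq (G (k j))))"
    proof (rule summable_comparison_test')
      show "summable (\<lambda>j. (1/2::real) ^ j)" by (rule summable_geometric) simp
      fix j
      have "(L2sq (G (k j))) \<le> H (k j)"
        unfolding H_def
      proof (rule integral_mono[OF G2 Gi])
        show "(norm (G (k j) \<xi>))\<^sup>2 \<le> (1 + \<xi>\<^sup>2) powr s * (norm (G (k j) \<xi>))\<^sup>2" for \<xi>
          using mult_right_mono[OF weight_ge_1[OF less_imp_le[OF s], of \<xi>], of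
              "(norm (G (k j) \<xi>))\<^sup>2"] by simp
      qed
      also have "\<dots> \<le> ((1/2) ^ j)\<^sup>2" using kQ[of j] by (simp add: Q_def)
      finally have "sqrt (L2sq (G (k j))) \<le> (1/2) ^ j"
        by (intro real_le_lsqrt) auto
      then show "norm (sqrt (L2sq (G (k j)))) \<le> (1/2) ^ j" by simp
    qed
    then show ?thesis
      unfolding L2_partition_def pieceG
      using disj g_off integrable_of_weighted[OF gm less_imp_le[OF s] w]
      by (auto simp: S_def annulus_bounded)
  qed
  define f where "f = inv_fourier_dist (dist_of_fun g)"
  have fS: "f \<in> sobolev s" unfolding f_def by (rule sobolev_inv_fourier_dist[OF LS w])
  have "\<not> ae_convergence_rate a \<delta> f"
  proof
    assume "ae_convergence_rate a \<delta> f"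
    then obtain f\<^sub>0 u where r0: "represents f\<^sub>0 f"
        and ru: "\<And>t. represents (u t) (schroedinger a t f)"
      and lim: "AE x in lborel. ((\<lambda>t. \<bar>t\<bar> powr (- \<delta>) *\<^sub>R (u t x - f\<^sub>0 x)) \<longlongrightarrow> 0) (at 0)"
      by (auto simp: ae_convergence_rate_def)
    define e where "e j t x = evol a (G (k j)) t x" for j t x
    have syn: "synth S (\<lambda>\<xi>. cis (t * \<bar>\<xi>\<bar> powr a) * g \<xi>) x = (\<Sum>j. 1 / (2 * of_real pi) * e j t x)"
        for t x
      by (simp only: synth_def e_def pieceG[symmetric] evol_piece_eq)
    have syn0: "synth S g x = (\<Sum>j. 1 / (2 * of_real pi) * e j 0 x)" for x
      by (simp add: synth_def e_def evol_def pieceG)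
    have aeu: "AE x in lborel. u t x = (\<Sum>j. 1 / (2 * of_real pi) * e j t x) \<and>
        summable (\<lambda>j. e j t x)" for t
    proof -
      have St: "L2_partition S (\<lambda>\<xi>. cis (t * \<bar>\<xi>\<bar> powr a) * g \<xi>)"
        by (rule L2_partition_modulate[OF LS]) measurable
      show ?thesis
        using represents_unique[OF ru represents_schroedinger[OF LS, of t a, folded f_def]]
            AE_summable_synth[OF St]
      proof eventually_elim
        case (elim x)
        have "e j t x = (LINT \<xi>|lborel. cis (x * \<xi>) * piece S (\<lambda>\<xi>. cis (t * \<bar>\<xi>\<bar> powr a) * g \<xi>) j \<xi>)"
            for j
          unfolding e_def pieceG[symmetric] by (rule evol_piece_eq)
        then show ?case
          using elim(1) summable_norm_cancel[OF elim(2)] syn[of t x] by simp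
      qed
    qed
    have ae0: "AE x in lborel. f\<^sub>0 x = (\<Sum>j. 1 / (2 * of_real pi) * e j 0 x) \<and>
        summable (\<lambda>j. e j 0 x)"
      using represents_unique[OF r0 represents_synth(1)[OF LS, folded f_def]] aeu[of 0]
      by eventually_elim (simp add: syn0)
    \<comment> \<open>For each single time \<open>u\<close> equals the series off a null set;
      countability of all test times merges these null sets into one.\<close>
    define TT where "TT = (\<Union>n. T n)"
    have "countable TT" unfolding TT_def using T(1) by auto
    then have aeT: "AE x in lborel. \<forall>t\<in>TT. u t x = (\<Sum>j. 1 / (2 * of_real pi) * e j t x) \<and>
        summable (\<lambda>j. e j t x)"
      using aeu by (subst AE_ball_countable) auto
    have "AE x in lborel. x \<notin> {1/2..1::real}"
      using lim ae0 aeT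
    proof eventually_elim
      case (elim x)
      show ?case
      proof
        assume x: "x \<in> {1/2..1}"
        \<comment> \<open>The bound \<open>1 / (2 * pi)\<close> is the normalization that
          \<open>evol\<close> omits.\<close>
        have "\<forall>\<^sub>F t in at 0. norm (\<bar>t\<bar> powr (- \<delta>) *\<^sub>R (u t x - f\<^sub>0 x)) < 1 / (2 * pi)"
          using tendsto_norm[OF elim(1)] by (rule order_tendstoD(2)) simp
        then obtain d where d: "d > 0"
            "\<And>t. t \<noteq> 0 \<Longrightarrow> \<bar>t\<bar> < d \<Longrightarrow> norm (\<bar>t\<bar> powr (- \<delta>) *\<^sub>R (u t x - f\<^sub>0 x)) < 1 / (2 * pi)"
          unfolding eventually_at by (auto simp: dist_real_def)
        have "(\<lambda>j. \<tau> (k j)) \<longlonglongrightarrow> 0"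
          using LIMSEQ_subseq_LIMSEQ[OF \<tau> mono] by (simp add: o_def)
        then have "\<forall>\<^sub>F j in sequentially. \<tau> (k j) < d"
          using d(1) by (rule order_tendstoD(2))
        then obtain j where j: "\<tau> (k j) < d" by (auto simp: eventually_sequentially)
        obtain t where t: "t \<in> T (k j)" and big: "2 * \<bar>t\<bar> powr \<delta> \<le> norm (D (k j) t x)"
          using kQ[of j] x unfolding Q_def by blast
        have tTT: "t \<in> TT" using t by (auto simp: TT_def)
        have t0: "t \<noteq> 0" "\<bar>t\<bar> < d" using T(2,3)[OF t] j by auto
        have et: "summable (\<lambda>i. e i t x)" "u t x = (\<Sum>i. 1 / (2 * of_real pi) * e i t x)"
            using elim(3) tTT by auto
        have e0: "summable (\<lambda>i. e i 0 x)" "f\<^sub>0 x = (\<Sum>i. 1 / (2 * of_real pi) * e i 0 x)"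
            using elim(2) by auto
        have De: "D (k i) t x = e i t x - e i 0 x" for i by (simp add: D_def e_def)
        have Ds: "summable (\<lambda>i. D (k i) t x)"
          unfolding De by (rule summable_diff[OF et(1) e0(1)])
        have diff: "u t x - f\<^sub>0 x = 1 / (2 * of_real pi) * (\<Sum>i. D (k i) t x)"
          unfolding et(2) e0(2) De suminf_mult[OF et(1)] suminf_mult[OF e0(1)]
              suminf_diff[OF et(1) e0(1), symmetric]
          by (simp only: right_diff_distrib)
        have small: "norm (D (k i) t x) \<le> q i * \<bar>t\<bar> powr \<delta>" if "i \<noteq> j" for i
        proof (cases "i < j")
          case True
          then show ?thesis using kP[OF True] t x by (auto simp: P_def)
        next
          case False
          then have "j < i" using that by simp
          then show ?thesis using kP[OF \<open>j < i\<close>] t x by (auto simp: P_def)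
        qed
        define R where "R i = (if i = j then 0 else D (k i) t x)" for i
        have Rle: "norm (R i) \<le> q i * \<bar>t\<bar> powr \<delta>" for i
          using small[of i] q[of i] by (auto simp: R_def)
        have Rs: "summable (\<lambda>i. norm (R i))"
          by (rule summable_comparison_test'[OF summable_mult2[OF qs, of
              "\<bar>t\<bar> powr \<delta>"], of 0]) (use Rle in auto)
        have "norm (\<Sum>i. R i) \<le> (\<Sum>i. norm (R i))" by (rule summable_norm[OF Rs])
        also have "\<dots> \<le> (\<Sum>i. q i * \<bar>t\<bar> powr \<delta>)"
          by (rule suminf_le[OF Rle Rs summable_mult2[OF qs]])
        also have "\<dots> = 1/4 * \<bar>t\<bar> powr \<delta>" by (simp add: suminf_mult2[OF qs, symmetric] qsum)
        finally have Rsum: "norm (\<Sum>i. R i) \<le> 1/4 * \<bar>t\<bar> powr \<delta>" .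
        have "(\<Sum>i. D (k i) t x) = (\<Sum>i. (if i = j then D (k j) t x else 0) + R i)"
          by (intro arg_cong[where f = suminf]) (auto simp: R_def)
        also have "\<dots> = D (k j) t x + (\<Sum>i. R i)"
          using suminf_add[OF sums_summable[OF sums_single[of j
              "\<lambda>_. D (k j) t x"]] summable_norm_cancel[OF Rs]]
            sums_unique[OF sums_single[of j "\<lambda>_. D (k j) t x"]] by simp
        finally have "norm (\<Sum>i. D (k i) t x) \<ge> norm (D (k j) t x) - norm (\<Sum>i. R i)"
          by (simp add: norm_diff_ineq)
        with big Rsum have "norm (\<Sum>i. D (k i) t x) \<ge> \<bar>t\<bar> powr \<delta>"
          using powr_ge_zero[of "\<bar>t\<bar>" \<delta>] by linarith
        then have "\<bar>t\<bar> powr (- \<delta>) * (1 / (2 * pi) * \<bar>t\<bar> powr \<delta>)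
            \<le> norm (\<bar>t\<bar> powr (- \<delta>) *\<^sub>R (u t x - f\<^sub>0 x))"
          unfolding diff norm_scaleR norm_mult
          by (intro mult_mono) (auto simp: norm_divide norm_mult)
        moreover have "\<bar>t\<bar> powr (- \<delta>) * (1 / (2 * pi) * \<bar>t\<bar> powr \<delta>) = 1 / (2 * pi)"
          using t0 by (simp add: powr_minus)
        ultimately show False using d(2)[OF t0] by linarith
      qed
    qed
    then have "emeasure lborel {1/2..1::real} = 0"
      by (subst (asm) AE_iff_measurable[of "{1/2..1}"]) auto
    then show False by simp
  qed
  then show ?thesis using fS by blast
qed

section \<open>Frequency packets and the two counterexamples\<close>

definition box :: "real \<Rightarrow> real \<Rightarrow> real \<Rightarrow> real \<Rightarrow> complex" where
  "box A N L \<xi> = of_real (A * indicator {N..N+L} \<xi>)"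

lemma box_measurable [measurable]: "box A N L \<in> borel_measurable borel"
  unfolding box_def[abs_def] by measurable

lemma box_support:
  assumes "0 \<le> L" "L < N" "box A N L \<xi> \<noteq> 0"
  shows "\<xi> \<in> annulus N"
  using assms by (auto simp: box_def annulus_def indicator_def split: if_splits)

lemma evol_box:
  assumes N: "N > 0" and L: "L \<ge> 0"
  shows "evol a (box A N L) t x = of_real A * integral {N..N+L} (\<lambda>\<xi>. cis (x * \<xi> + t * \<xi> powr a))"
proof -
  have c: "continuous_on {N..N+L} (\<lambda>\<xi>. cis (x * \<xi> + t * \<xi> powr a))"
    using N by (intro continuous_intros) auto
  have "set_integrable lborel {N..N+L} (\<lambda>\<xi>. cis (x * \<xi> + t * \<xi> powr a))"
    using borel_integrable_atLeastAtMost'[OF c] .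
  then have "(LINT \<xi>:{N..N+L}|lborel. cis (x * \<xi> + t * \<xi> powr a))
      = integral {N..N+L} (\<lambda>\<xi>. cis (x * \<xi> + t * \<xi> powr a))"
    by (rule set_borel_integral_eq_integral(2))
  moreover have "evol a (box A N L) t x
      = (LINT \<xi>|lborel. of_real A * (indicator {N..N+L} \<xi> *\<^sub>R cis (x * \<xi> + t * \<xi> powr a)))"
    unfolding evol_def using N
    by (intro Bochner_Integration.integral_cong) (auto simp: box_def indicator_def)
  ultimately show ?thesis
    unfolding set_lebesgue_integral_def by (simp only: integral_mult_right_zero)
qed

lemma box_weighted:
  assumes N: "N \<ge> 1" and L: "0 \<le> L" "L \<le> N" and s: "s \<ge> 0"
  shows "Hs_integrable s (box A N L)"
    and "(Hs_sq s (box A N L)) \<le> 5 powr s * (A\<^sup>2 * L * N powr (2 * s))"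
proof -
  define K where "K = 5 powr s * (A\<^sup>2 * N powr (2 * s))"
  have le: "(1 + \<xi>\<^sup>2) powr s * (norm (box A N L \<xi>))\<^sup>2 \<le> K * indicator {N..N+L} \<xi>" for \<xi>
  proof (cases "\<xi> \<in> {N..N+L}")
    case True
    have "\<xi>\<^sup>2 \<le> (2 * N)\<^sup>2" using True N L by (intro power_mono) auto
    moreover have "1 \<le> N\<^sup>2" using N by simp
    ultimately have "1 + \<xi>\<^sup>2 \<le> 5 * N\<^sup>2" by (simp add: power_mult_distrib)
    then have "(1 + \<xi>\<^sup>2) powr s \<le> (5 * N\<^sup>2) powr s" using s by (intro powr_mono2) auto
    also have "\<dots> = 5 powr s * N powr (2 * s)"
      using N by (simp add: powr_mult powr_powr flip: powr_numeral)
    finally have "(1 + \<xi>\<^sup>2) powr s * A\<^sup>2 \<le> 5 powr s * N powr (2 * s) * A\<^sup>2"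
      by (rule mult_right_mono) simp
    then show ?thesis using True by (simp add: box_def K_def mult_ac)
  qed (simp add: box_def)
  have i: "integrable lborel (\<lambda>\<xi>. K * indicator {N..N+L} \<xi>)"
    using L by (intro integrable_mult_right integrable_real_indicator)
        (auto simp: emeasure_lborel_Icc_eq)
  show w: "Hs_integrable s (box A N L)"
    by (rule Bochner_Integration.integrable_bound[OF i])
        (use le in \<open>auto intro!: AE_I2 order_trans[OF _ abs_ge_self]\<close>)
  have "(Hs_sq s (box A N L)) \<le> (LINT \<xi>|lborel. K * indicator {N..N+L} \<xi>)"
    by (rule integral_mono[OF w i le])
  also have "\<dots> = K * L" using L by simp
  finally show "(Hs_sq s (box A N L)) \<le> 5 powr s * (A\<^sup>2 * L * N powr (2 * s))"
    by (simp add: K_def mult_ac)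
qed

lemma cos_ge_half:
  fixes u :: real
  assumes "\<bar>u\<bar> \<le> 1"
  shows "cos u \<ge> 1 / 2"
proof -
  have "cos (pi / 3) \<le> cos \<bar>u\<bar>"
    using assms pi_gt3 by (intro cos_monotone_0_pi_le) auto
  then show ?thesis by (simp add: cos_60)
qed

text \<open>If the phase stays within 1 of a constant \<open>c\<close>, then after multiplication by
  \<open>cis (- c)\<close> the real part of the integrand keeps at least half its size, so nothing
  cancels.\<close>

lemma norm_integral_cis_ge:
  fixes p m :: "real \<Rightarrow> real"
  assumes L: "L \<ge> 0" and p: "continuous_on {N..N+L} p" and m: "continuous_on {N..N+L} m"
    and near: "\<And>\<xi>. \<xi> \<in> {N..N+L} \<Longrightarrow> \<bar>p \<xi> - c\<bar> \<le> 1" and lower: "\<And>\<xi>. \<xi> \<in> {N..N+L} \<Longrightarrow> m \<xi> \<ge> \<mu>"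
        and \<mu>: "\<mu> \<ge> 0"
  shows "norm (integral {N..N+L} (\<lambda>\<xi>. of_real (m \<xi>) * cis (p \<xi>))) \<ge> \<mu> * L / 2"
proof -
  have ci: "(\<lambda>\<xi>. of_real (m \<xi>) * cis (p \<xi> - c)) integrable_on {N..N+L}"
    by (intro integrable_continuous_real continuous_intros p m)
  have "\<mu> * L / 2 = integral {N..N+L} (\<lambda>_. \<mu> / 2)" using L by simp
  also have "\<dots> \<le> integral {N..N+L} (\<lambda>\<xi>. Re (of_real (m \<xi>) * cis (p \<xi> - c)))"
  proof (rule integral_le)
    show "(\<lambda>\<xi>. Re (of_real (m \<xi>) * cis (p \<xi> - c))) integrable_on {N..N+L}"
      by (intro integrable_continuous_real continuous_intros p m)
    fix \<xi> assume \<xi>: "\<xi> \<in> {N..N+L}"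
    have "\<mu> * (1/2) \<le> m \<xi> * cos (p \<xi> - c)"
      using \<mu> lower[OF \<xi>] cos_ge_half[OF near[OF \<xi>]] by (intro mult_mono) auto
    then show "\<mu> / 2 \<le> Re (of_real (m \<xi>) * cis (p \<xi> - c))" by simp
  qed (rule integrable_const_ivl)
  also have "\<dots> = Re (integral {N..N+L} (\<lambda>\<xi>. of_real (m \<xi>) * cis (p \<xi> - c)))"
    using integral_linear[OF ci bounded_linear_Re] by (simp add: o_def)
  also have "\<dots> \<le> norm (integral {N..N+L} (\<lambda>\<xi>. of_real (m \<xi>) * cis (p \<xi> - c)))"
    by (rule complex_Re_le_cmod)
  also have "integral {N..N+L} (\<lambda>\<xi>. of_real (m \<xi>) * cis (p \<xi> - c))
      = cis (- c) * integral {N..N+L} (\<lambda>\<xi>. of_real (m \<xi>) * cis (p \<xi>))"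
  proof -
    have "(\<lambda>\<xi>. of_real (m \<xi>) * cis (p \<xi> - c)) = (\<lambda>\<xi>. cis (- c) * (of_real (m \<xi>) * cis (p \<xi>)))"
      by (rule ext) (simp add: cis_mult algebra_simps)
    then show ?thesis by simp
  qed
  finally show ?thesis by (simp add: norm_mult)
qed

lemma tendsto_two_powr:
  assumes "r < 0"
  shows "(\<lambda>n. (2 ^ n) powr r) \<longlonglongrightarrow> (0::real)"
proof -
  have "(2 ^ n) powr r = (2 powr r) ^ n" for n :: nat
    by (simp add: powr_powr mult.commute flip: powr_realpow)
  moreover have "2 powr r < 1" using assms by (simp add: powr_less_one)
  ultimately show ?thesis by (simp add: LIMSEQ_realpow_zero)
qed

text \<open>\<open>N powr (- a)\<close> is the time at which the factor
  \<open>cis (t * \<xi> powr a)\<close> first departs from 1 by a fixed amount, and a frequency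
  interval of fixed length keeps the packet coherent on all of \<open>{1/2..1}\<close>.\<close>

lemma fixed_time_counterexample:
  assumes a: "a > 1" and \<delta>: "0 < \<delta>" "\<delta> < 1" and s: "0 < s" "s < a * \<delta>"
  shows "\<exists>f\<in>sobolev s. \<not> ae_convergence_rate a \<delta> f"
proof -
  define s0 where "s0 = sin (1/2 :: real)"
  have s0: "s0 > 0" unfolding s0_def using pi_gt3 by (intro sin_gt_zero) auto
  define N :: "nat \<Rightarrow> real" where "N n = 2 ^ n" for n
  have N: "N n \<ge> 1" for n by (simp add: N_def)
  \<comment> \<open>Normalized so that the lower bound \<open>s0 * L * A n\<close> for the change of
    the packet is exactly \<open>2 * \<bar>t n\<bar> powr \<delta>\<close>. The square of its
    Sobolev norm is then of order \<open>N powr (2 * s - 2 * a * \<delta>)\<close>.\<close>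
  define A where "A n = 4 / s0 * N n powr (- a * \<delta>)" for n
  have A: "A n \<ge> 0" for n using s0 by (simp add: A_def)
  define L where "L = (1/2 :: real)"
  let ?G = "\<lambda>n. box (A n) (N n) L"
  define t where "t n = N n powr (- a)" for n
  have t: "t n > 0" for n using N[of n] by (simp add: t_def)
  have t\<delta>: "\<bar>t n\<bar> powr \<delta> = N n powr (- a * \<delta>)" for n
    using N[of n] by (simp add: t_def powr_powr)
  show ?thesis
  proof (rule gliding_hump[where G = ?G and T = "\<lambda>n. {t n}" and \<tau> = t])
    show "\<xi> \<in> annulus (2 ^ n)" if "?G n \<xi> \<noteq> 0" for n \<xi>
    proof -
      have "0 \<le> L" "L < N n" using N[of n] by (auto simp: L_def)
      from box_support[OF this that] show ?thesis by (simp add: N_def)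
    qed
    show "Hs_integrable s (?G n)" for n
      using N[of n] s by (intro box_weighted) (auto simp: L_def)
    show "(\<lambda>n. Hs_sq s (?G n)) \<longlonglongrightarrow> 0"
    proof (rule tendsto_sandwich[OF _ _ tendsto_const])
      show "\<forall>\<^sub>F n in sequentially. (Hs_sq s (?G n))
          \<le> 5 powr s * ((4 / s0)\<^sup>2 * L) * N n powr (2 * s - 2 * a * \<delta>)"
      proof (intro always_eventually allI)
        fix n
        have "(A n)\<^sup>2 * N n powr (2 * s)
            = (4 / s0)\<^sup>2 * (N n powr (- a * \<delta>) * N n powr (- a * \<delta>) * N n powr (2 * s))"
          by (simp add: A_def power2_eq_square)
        also have "N n powr (- a * \<delta>) * N n powr (- a * \<delta>) * N n powr (2 * s)
            = N n powr (2 * s - 2 * a * \<delta>)"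
          by (simp add: powr_add[symmetric] algebra_simps)
        finally have e: "5 powr s * ((A n)\<^sup>2 * L * N n powr (2 * s))
            = 5 powr s * ((4 / s0)\<^sup>2 * L) * N n powr (2 * s - 2 * a * \<delta>)"
          by (simp add: mult_ac)
        show "(Hs_sq s (?G n)) \<le> 5 powr s * ((4 / s0)\<^sup>2 * L) * N n powr (2 * s - 2 * a * \<delta>)"
          unfolding e[symmetric] using N[of n] s by (intro box_weighted) (auto simp: L_def)
      qed
      show "(\<lambda>n. 5 powr s * ((4 / s0)\<^sup>2 * L) * N n powr (2 * s - 2 * a * \<delta>)) \<longlonglongrightarrow> 0"
        unfolding N_def using s by (intro tendsto_mult_right_zero tendsto_two_powr) simp
    qed (auto intro!: always_eventually)
    show "t \<longlonglongrightarrow> 0" unfolding t_def[abs_def] N_def using a by (intro tendsto_two_powr) simp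
    \<comment> \<open>For large \<open>n\<close> this places \<open>t n * \<xi> powr a\<close>
      between 1 and 2 on the whole packet.\<close>
    have "(\<lambda>n. (1 + (1/2) * N n powr (- 1)) powr a) \<longlonglongrightarrow> (1 + 1/2 * 0) powr a"
      unfolding N_def by (intro tendsto_intros tendsto_two_powr) auto
    then have "\<forall>\<^sub>F n in sequentially. (1 + (1/2) * N n powr (- 1)) powr a < 2"
      by (rule order_tendstoD(2)) simp
    then show "\<forall>\<^sub>F n in sequentially. \<forall>x\<in>{1/2..1}. \<exists>r\<in>{t n}. norm (evol a (?G n) r x - evol a (?G n) 0 x) \<ge> 2 * \<bar>r\<bar> powr \<delta>"
    proof eventually_elim
      case (elim n)
      have N0: "N n > 0" using N[of n] by simp
      show ?case
      proof (intro ballI bexI[of _ "t n"])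
        fix x :: real assume x: "x \<in> {1/2..1}"
        \<comment> \<open>Half the dispersive phase, in view of \<open>cis (2 * \<theta>) - 1 = 2 *
          \<i> * sin \<theta> * cis \<theta>\<close>. The sine is at least \<open>s0\<close>, and
          the remaining phase \<open>x * \<xi> + \<theta> \<xi>\<close> varies by at most 1/2 from
          each of its terms.\<close>
        define \<theta> where "\<theta> \<xi> = t n * \<xi> powr a / 2" for \<xi>
        have \<theta>: "1/2 \<le> \<theta> \<xi>" "\<theta> \<xi> \<le> 1" if \<xi>: "\<xi> \<in> {N n..N n+L}" for \<xi>
        proof -
          have e: "\<theta> \<xi> = (\<xi> / N n) powr a / 2"
            using \<xi> N0 by (simp add: \<theta>_def t_def powr_divide powr_minus field_simps)
          have "1 powr a \<le> (\<xi> / N n) powr a" using \<xi> N0 a by (intro powr_mono2) auto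
          then show "1/2 \<le> \<theta> \<xi>" by (simp add: e)
          have "\<xi> / N n \<le> (N n + L) / N n" using \<xi> N0 by (intro divide_right_mono) auto
          also have "\<dots> = 1 + (1/2) * N n powr (- 1)"
            using N0 by (simp add: L_def powr_minus field_simps)
          finally have "(\<xi> / N n) powr a \<le> (1 + (1/2) * N n powr (- 1)) powr a"
            using \<xi> N0 a by (intro powr_mono2) auto
          then show "\<theta> \<xi> \<le> 1" using elim by (simp add: e)
        qed
        have c\<theta>: "continuous_on {N n..N n+L} \<theta>"
          unfolding \<theta>_def using N0 by (intro continuous_intros) auto
        have ci: "(\<lambda>\<xi>. cis (x * \<xi> + r * \<xi> powr a)) integrable_on {N n..N n+L}" for r
          using N0 by (intro integrable_continuous_real continuous_intros) auto
        have "evol a (?G n) (t n) x - evol a (?G n) 0 x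
            = of_real (A n) * (integral {N n..N n+L} (\<lambda>\<xi>. cis (x * \<xi>
                + t n * \<xi> powr a)) - integral {N n..N n+L} (\<lambda>\<xi>. cis (x * \<xi> + 0 * \<xi> powr a)))"
          using N0 by (simp only: evol_box[OF N0, of L] L_def right_diff_distrib)
              (subst evol_box[OF N0], simp, subst evol_box[OF N0], simp, simp)
        also have "integral {N n..N n+L} (\<lambda>\<xi>. cis (x * \<xi>
            + t n * \<xi> powr a)) - integral {N n..N n+L} (\<lambda>\<xi>. cis (x * \<xi> + 0 * \<xi> powr a))
            = integral {N n..N n+L} (\<lambda>\<xi>. cis (x * \<xi> + t n * \<xi> powr a) - cis (x * \<xi> + 0 * \<xi> powr a))"
          by (rule Henstock_Kurzweil_Integration.integral_diff[OF ci ci, symmetric])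
        also have "\<dots> = integral {N n..N n+L} (\<lambda>\<xi>. (2 * \<i>)
            * (of_real (sin (\<theta> \<xi>)) * cis (x * \<xi> + \<theta> \<xi>)))"
        proof (rule Henstock_Kurzweil_Integration.integral_cong)
          fix \<xi>
          have "2 * \<i> * of_real (sin (\<theta> \<xi>)) = cis (\<theta> \<xi>) - cis (- \<theta> \<xi>)"
            by (simp add: complex_eq_iff)
          then have "(2 * \<i>) * (of_real (sin (\<theta> \<xi>)) * cis (x * \<xi> + \<theta> \<xi>))
              = (cis (\<theta> \<xi>) - cis (- \<theta> \<xi>)) * cis (x * \<xi> + \<theta> \<xi>)"
            by (simp only: mult.assoc[symmetric])
          also have "\<dots> = cis (x * \<xi> + t n * \<xi> powr a) - cis (x * \<xi> + 0 * \<xi> powr a)"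
            by (simp add: left_diff_distrib cis_mult \<theta>_def algebra_simps)
          finally show "cis (x * \<xi> + t n * \<xi> powr a) - cis (x * \<xi> + 0 * \<xi> powr a)
              = (2 * \<i>) * (of_real (sin (\<theta> \<xi>)) * cis (x * \<xi> + \<theta> \<xi>))" ..
        qed
        also have "\<dots> = (2 * \<i>) * integral {N n..N n+L} (\<lambda>\<xi>. of_real (sin (\<theta> \<xi>))
            * cis (x * \<xi> + \<theta> \<xi>))"
          by (rule integral_mult_right)
        finally have e: "norm (evol a (?G n) (t n) x - evol a (?G n) 0 x)
            = A n * (2 * norm (integral {N n..N n+L} (\<lambda>\<xi>. of_real (sin (\<theta> \<xi>))
                * cis (x * \<xi> + \<theta> \<xi>))))"
          using A[of n] by (simp add: norm_mult)
        have "s0 * L / 2 \<le> norm (integral {N n..N n+L} (\<lambda>\<xi>. of_real (sin (\<theta> \<xi>))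
            * cis (x * \<xi> + \<theta> \<xi>)))"
        proof (rule norm_integral_cis_ge[where c = "x * N n + 1/2"])
          fix \<xi> assume \<xi>: "\<xi> \<in> {N n..N n+L}"
          have "0 \<le> x * (\<xi> - N n)" "x * (\<xi> - N n) \<le> 1 * (1/2)"
            using x \<xi> by (simp, intro mult_mono) (auto simp: L_def)
          then show "\<bar>x * \<xi> + \<theta> \<xi> - (x * N n + 1/2)\<bar> \<le> 1"
            using \<theta>[OF \<xi>] by (simp add: right_diff_distrib abs_le_iff)
          show "s0 \<le> sin (\<theta> \<xi>)"
            unfolding s0_def using \<theta>[OF \<xi>] pi_gt3 by (intro sin_monotone_2pi_le) auto
        qed (use s0 c\<theta> in \<open>auto simp: L_def intro!: continuous_intros\<close>)
        then have "A n * (2 * (s0 * L / 2)) \<le> norm (evol a (?G n) (t n) x - evol a (?G n) 0 x)"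
          unfolding e using A[of n] by (intro mult_left_mono) auto
        moreover have "A n * (2 * (s0 * L / 2)) = 2 * \<bar>t n\<bar> powr \<delta>"
          unfolding t\<delta> using s0 by (simp add: A_def L_def)
        ultimately show "2 * \<bar>t n\<bar> powr \<delta> \<le> norm (evol a (?G n) (t n) x - evol a (?G n) 0 x)"
          by simp
      qed simp
    qed
    show "\<forall>\<^sub>F m in sequentially. \<forall>r\<in>{t n}. \<forall>x\<in>{1/2..1}. norm (evol a (?G m) r x - evol a (?G m) 0 x)
        \<le> \<eta> * \<bar>r\<bar> powr \<delta>"
      if \<eta>: "\<eta> > 0" for n \<eta>
    proof -
      \<comment> \<open>The times of packet \<open>n\<close> are fixed, so it suffices that later
        packets become uniformly small; this uses \<delta> > 0.\<close>
      have "A \<longlonglongrightarrow> 0"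
        unfolding A_def[abs_def] N_def using a \<delta>
        by (intro tendsto_mult_right_zero tendsto_two_powr) simp
      then have "\<forall>\<^sub>F m in sequentially. A m < \<eta> * \<bar>t n\<bar> powr \<delta>"
        using \<eta> t[of n] by (intro order_tendstoD(2)) auto
      then show ?thesis
      proof eventually_elim
        case (elim m)
        have N0: "N m > 0" using N[of m] by simp
        have b: "norm (evol a (?G m) r x) \<le> A m * L" for r x
        proof -
          have "norm (integral {N m..N m+L} (\<lambda>\<xi>. cis (x * \<xi> + r * \<xi> powr a))) \<le> (N m + L) - N m"
            using N0 by (intro norm_integral_cis_le continuous_intros) (auto simp: L_def)
          then have "A m * norm (integral {N m..N m+L} (\<lambda>\<xi>. cis (x * \<xi> + r * \<xi> powr a))) \<le> A m * L"
            using A[of m] by (intro mult_left_mono) auto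
          then show ?thesis
            using A[of m] by (subst evol_box[OF N0]) (simp_all add: L_def norm_mult)
        qed
        have "norm (evol a (?G m) r x - evol a (?G m) 0 x) \<le> A m" for r x
          using norm_triangle_ineq4[of "evol a (?G m) r x" "evol a (?G m) 0 x"] b[of r x] b[of 0 x]
          by (simp add: L_def)
        then show ?case
          using elim by (auto intro: order_trans[OF _ less_imp_le])
      qed
    qed
    show "r \<noteq> 0" "\<bar>r\<bar> \<le> t n" if "r \<in> {t n}" for n r
      using that t[of n] by auto
  qed (use a \<delta> s in auto)
qed

text \<open>At times of order \<open>N powr (1 - a)\<close> the phase has curvature of order
  \<open>1 / N\<close>; a frequency width of order \<open>sqrt N\<close> is therefore the largest
  over which the packet travels without dispersing. The largest width gives the sharpest
  concentration at time 0.\<close>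

lemma moving_time_counterexample:
  assumes a: "a > 1" and \<delta>: "0 \<le> \<delta>" "\<delta> < 1" and s: "0 < s" "s < (a - 1) * \<delta> + 1/4"
  shows "\<exists>f\<in>sobolev s. \<not> ae_convergence_rate a \<delta> f"
proof -
  \<comment> \<open>\<open>C / N\<close> bounds the second derivative of the phase on the packet for
    the times in \<open>T n\<close>. With \<open>\<kappa> = 1 / C\<close> the curvature contributes
    at most \<open>(L n)\<^sup>2 * C / N n \<le> 1/2\<close> to the phase; the summand 8 ensures
    \<open>L n < N n\<close>.\<close>
  define C where "C = 2 powr (a + 1) * a * (a - 1) + 8"
  have C: "C \<ge> 8" using a by (simp add: C_def)
  define \<kappa> where "\<kappa> = 1 / C"
  have \<kappa>: "0 < \<kappa>" "\<kappa> \<le> 1/8" "\<kappa>\<^sup>2 * C \<le> 1/2"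
  proof -
    show "0 < \<kappa>" using C by (simp add: \<kappa>_def)
    show "\<kappa> \<le> 1/8" using C by (simp add: \<kappa>_def frac_le)
    then show "\<kappa>\<^sup>2 * C \<le> 1/2" using C by (simp add: \<kappa>_def power2_eq_square)
  qed
  define N :: "nat \<Rightarrow> real" where "N n = 2 ^ n" for n
  have N: "N n \<ge> 1" and N0: "N n > 0" for n by (simp_all add: N_def)
  define L where "L n = \<kappa> * sqrt (N n)" for n
  have L0: "L n > 0" for n using \<kappa> N0 by (simp add: L_def)
  have LN: "L n < N n" for n
  proof -
    have "sqrt (N n) \<le> N n" using N[of n] by (intro real_le_lsqrt) (auto simp: power2_eq_square)
    then have "\<kappa> * sqrt (N n) \<le> 1/8 * N n" using \<kappa> N0[of n] by (intro mult_mono) auto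
    then show ?thesis using N0[of n] by (simp add: L_def)
  qed
  have L2: "(L n)\<^sup>2 * C \<le> 1/2 * N n" for n
  proof -
    have "(L n)\<^sup>2 * C = (\<kappa>\<^sup>2 * C) * N n" using N0[of n] by (simp add: L_def power_mult_distrib)
    also have "\<dots> \<le> 1/2 * N n" using \<kappa> N0[of n] by (intro mult_right_mono) auto
    finally show ?thesis .
  qed
  \<comment> \<open>Coherence yields \<open>A n * L n / 2\<close>, of which one half is sacrificed
    to the value at time 0. The remaining quarter is
    \<open>4 * N n powr (- (a - 1) * \<delta>)\<close>, at least
    \<open>2 * \<bar>t\<bar> powr \<delta>\<close> for the times in \<open>T n\<close>.\<close>
  define A where "A n = 16 / \<kappa> * N n powr (- (a - 1) * \<delta> - 1/2)" for n
  have A: "A n \<ge> 0" for n using \<kappa> by (simp add: A_def)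
  have AL: "A n * L n = 16 * N n powr (- (a - 1) * \<delta>)" for n
  proof -
    have "A n * L n = 16 * (N n powr (- (a - 1) * \<delta> - 1/2) * N n powr (1/2))"
      using \<kappa> N0[of n] by (simp add: A_def L_def powr_half_sqrt)
    then show ?thesis by (simp add: powr_add[symmetric])
  qed
  let ?G = "\<lambda>n. box (A n) (N n) (L n)"
  \<comment> \<open>\<open>- (a * t * N n powr (a - 1))\<close> is the position of the packet at
    time \<open>t\<close>. The interval \<open>{1/2..1}\<close> is enlarged by 1/4 on either side,
    which leaves room for rational approximations of the arrival times.\<close>
  define T where "T n = \<rat> \<inter> {t. 1/4 \<le> - (a * t * N n powr (a - 1)) \<and> - (a * t * N n powr (a - 1))
      \<le> 5/4}" for n
  have Tneg: "t < 0" and Tup: "\<bar>t\<bar> \<le> 2 * N n powr (1 - a)"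
      and Tlow: "- t * a * N n powr (a - 1) \<ge> 1/4" if t: "t \<in> T n" for t n
  proof -
    have p: "N n powr (a - 1) > 0" using N0[of n] by simp
    show low: "- t * a * N n powr (a - 1) \<ge> 1/4" using t by (simp add: T_def mult_ac)
    then have "- t * (a * N n powr (a - 1)) > 0" by (simp add: mult_ac)
    then show neg: "t < 0" using a p by (simp add: zero_less_mult_iff mult_less_0_iff)
    have "\<bar>t\<bar> * (1 * N n powr (a - 1)) \<le> \<bar>t\<bar> * (a * N n powr (a - 1))"
      using a p by (intro mult_left_mono mult_right_mono) auto
    also have "\<dots> \<le> 2" using t neg by (simp add: T_def mult_ac)
    finally have "\<bar>t\<bar> * N n powr (a - 1) * N n powr (1 - a) \<le> 2 * N n powr (1 - a)"
      by (intro mult_right_mono) auto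
    moreover have "N n powr (a - 1) * N n powr (1 - a) = 1" using N0[of n]
        by (simp add: powr_add[symmetric])
    ultimately show "\<bar>t\<bar> \<le> 2 * N n powr (1 - a)" by (simp add: mult.assoc)
  qed
  \<comment> \<open>At time 0 the phase has slope \<open>x \<ge> 1/2\<close>, so on
    \<open>{1/2..1}\<close> the packet is bounded by a multiple of \<open>A n\<close>, without the
    factor \<open>L n\<close> of its peak.\<close>
  have free: "norm (evol a (?G n) 0 x) \<le> 6 * A n" if x: "x \<in> {1/2..1}" for n x
  proof -
    have "norm (integral {N n..N n + L n} (\<lambda>\<xi>. cis (x * \<xi>))) \<le> 3 / x"
      by (rule van_der_Corput_first[where p' = "\<lambda>_. x" and p'' = "\<lambda>_. 0"])
         (use L0[of n] x in \<open>auto intro!: derivative_eq_intros\<close>)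
    also have "\<dots> \<le> 6" using x by (simp add: field_simps)
    finally have "A n * norm (integral {N n..N n + L n} (\<lambda>\<xi>. cis (x * \<xi>))) \<le> A n * 6"
      using A[of n] by (intro mult_left_mono)
    then show ?thesis
      using A[of n] L0[of n] by (subst evol_box[OF N0]) (auto simp: norm_mult mult.commute)
  qed
  show ?thesis
  proof (rule gliding_hump[where G = ?G and T = T and \<tau> = "\<lambda>n. 2 * N n powr (1 - a)"])
    show "\<xi> \<in> annulus (2 ^ n)" if "?G n \<xi> \<noteq> 0" for n \<xi>
      using box_support[OF less_imp_le[OF L0] LN that] by (simp add: N_def)
    show "Hs_integrable s (?G n)" for n
      using N[of n] L0[of n] LN[of n] s by (intro box_weighted) auto
    show "(\<lambda>n. Hs_sq s (?G n)) \<longlonglongrightarrow> 0"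
    proof (rule tendsto_sandwich[OF _ _ tendsto_const])
      show "\<forall>\<^sub>F n in sequentially. (Hs_sq s (?G n))
          \<le> 5 powr s * (256 / \<kappa>) * N n powr (2 * s - 2 * (a - 1) * \<delta> - 1/2)"
      proof (intro always_eventually allI)
        fix n
        have "(A n)\<^sup>2 * L n * N n powr (2 * s) = A n * (A n * L n) * N n powr (2 * s)"
          by (simp add: power2_eq_square)
        also have "\<dots> = 256 / \<kappa> * (N n powr (- (a - 1) * \<delta> - 1/2) * N n powr (- (a - 1) * \<delta>)
            * N n powr (2 * s))"
          unfolding AL by (simp add: A_def)
        also have "N n powr (- (a - 1) * \<delta> - 1/2) * N n powr (- (a - 1) * \<delta>) * N n powr (2 * s)
            = N n powr (2 * s - 2 * (a - 1) * \<delta> - 1/2)"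
          by (simp add: powr_add[symmetric] algebra_simps)
        finally have e: "5 powr s * ((A n)\<^sup>2 * L n * N n powr (2 * s))
            = 5 powr s * (256 / \<kappa>) * N n powr (2 * s - 2 * (a - 1) * \<delta> - 1/2)"
          by simp
        show "(Hs_sq s (?G n)) \<le> 5 powr s * (256 / \<kappa>) * N n powr (2 * s - 2 * (a - 1) * \<delta> - 1/2)"
          unfolding e[symmetric] using N[of n] L0[of n] LN[of n] s by (intro box_weighted) auto
      qed
      show "(\<lambda>n. 5 powr s * (256 / \<kappa>) * N n powr (2 * s - 2 * (a - 1) * \<delta> - 1/2)) \<longlonglongrightarrow> 0"
        unfolding N_def using s by (intro tendsto_mult_right_zero tendsto_two_powr)
            (simp add: algebra_simps)
    qed (auto intro!: always_eventually)
    show "countable (T n)" for n unfolding T_def using countable_rat by auto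
    show "t \<noteq> 0" if "t \<in> T n" for n t using Tneg[OF that] by simp
    show "\<bar>t\<bar> \<le> 2 * N n powr (1 - a)" if "t \<in> T n" for n t by (rule Tup[OF that])
    show "(\<lambda>n. 2 * N n powr (1 - a)) \<longlonglongrightarrow> 0"
      unfolding N_def using a by (intro tendsto_mult_right_zero tendsto_two_powr) simp
    \<comment> \<open>This makes the value at time 0 at most
      \<open>6 * A n \<le> A n * (L n / 4)\<close>.\<close>
    have "\<forall>\<^sub>F n in sequentially. L n \<ge> 24"
    proof -
      have "filterlim (\<lambda>n. \<kappa> * sqrt (2 ^ n)) at_top sequentially"
        using \<kappa>(1) by real_asymp
      then show ?thesis unfolding L_def N_def by (simp add: filterlim_at_top)
    qed
    then show "\<forall>\<^sub>F n in sequentially. \<forall>x\<in>{1/2..1}. \<exists>t\<in>T n. norm (evol a (?G n) t x - evol a (?G n) 0 x) \<ge> 2 * \<bar>t\<bar> powr \<delta>"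
    proof eventually_elim
      case (elim n)
      show ?case
      proof
        fix x :: real assume x: "x \<in> {1/2..1}"
        define b where "b = a * N n powr (a - 1)"
        have b: "b > 0" using a N0[of n] by (simp add: b_def)
        \<comment> \<open>A rational time meets the arrival time only approximately. An error
          \<epsilon> in the slope of the phase costs at most 1/4 over the length
          \<open>L n\<close>.\<close>
        define \<epsilon> where "\<epsilon> = 1 / (4 * L n)"
        have "1 / (4 * L n) \<le> 1 / (4 * 24)" using elim by (intro frac_le) auto
        then have \<epsilon>: "\<epsilon> > 0" "\<epsilon> \<le> 1/4" using L0[of n] by (auto simp: \<epsilon>_def)
        have "(- x - \<epsilon>) / b < (- x + \<epsilon>) / b" using b \<epsilon> by (simp add: divide_strict_right_mono)
        then obtain t where t: "t \<in> \<rat>" "(- x - \<epsilon>) / b < t" "t < (- x + \<epsilon>) / b"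
          using Rats_dense_in_real by blast
        then have tb: "- x - \<epsilon> < t * b" "t * b < - x + \<epsilon>"
          using b by (simp_all add: field_simps)
        have tT: "t \<in> T n"
          using t(1) tb x \<epsilon> by (auto simp: T_def b_def mult_ac)
        have tneg: "t < 0" by (rule Tneg[OF tT])
        define \<Phi> where "\<Phi> \<xi> = x * \<xi> + t * \<xi> powr a" for \<xi>
        define \<Phi>' where "\<Phi>' \<xi> = x + t * a * \<xi> powr (a - 1)" for \<xi>
        have d1: "\<bar>\<Phi>' \<xi>\<bar> \<le> 1 / (4 * L n) + C / N n * L n" if \<xi>: "\<xi> \<in> {N n..N n + L n}" for \<xi>
        proof -
          have "\<bar>\<Phi>' \<xi> - \<Phi>' (N n)\<bar> \<le> C / N n * L n"
          proof -
            have "norm (\<Phi>' \<xi> - \<Phi>' (N n)) \<le> C / N n * norm (\<xi> - N n)"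
            proof (rule field_differentiable_bound[of "{N n..N n + L n}" \<Phi>'
                "\<lambda>\<xi>. t * a * (a - 1) * \<xi> powr (a - 2)"])
              fix z assume z: "z \<in> {N n..N n + L n}"
              have z0: "z > 0" using z N0[of n] by simp
              show "(\<Phi>' has_field_derivative t * a * (a - 1)
                  * z powr (a - 2)) (at z within {N n..N n + L n})"
                unfolding \<Phi>'_def[abs_def]
                by (rule has_field_derivative_at_within[OF phase_deriv(2)[OF z0]])
              have "z powr (a - 2) = z powr a / z\<^sup>2" using z0 by (simp add: powr_diff)
              also have "\<dots> \<le> (2 * N n) powr a / (N n)\<^sup>2"
                using z z0 a N0[of n] LN[of n] by (intro frac_le powr_mono2 power_mono) auto
              also have "\<dots> = 2 powr a * N n powr (a - 2)" using N0[of n]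
                  by (simp add: powr_mult powr_diff)
              finally have zz: "z powr (a - 2) \<le> 2 powr a * N n powr (a - 2)" .
              have "norm (t * a * (a - 1) * z powr (a - 2)) = \<bar>t\<bar> * (a * (a - 1) * z powr (a - 2))"
                using a by (simp add: abs_mult)
              also have "\<dots> \<le> (2 * N n powr (1 - a)) * (a * (a - 1) * (2 powr a * N n powr (a - 2)))"
                using a by (intro mult_mono Tup[OF tT] mult_left_mono zz) auto
              also have "\<dots> = (2 powr (a + 1) * a * (a - 1)) * (N n powr (1 - a) * N n powr (a - 2))"
                by (simp add: powr_add)
              also have "N n powr (1 - a) * N n powr (a - 2) = 1 / N n"
                using N0[of n] by (simp add: powr_add[symmetric] powr_minus inverse_eq_divide)
              also have "(2 powr (a + 1) * a * (a - 1)) * (1 / N n) \<le> C * (1 / N n)"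
                using N0[of n] by (intro mult_right_mono) (auto simp: C_def)
              finally show "norm (t * a * (a - 1) * z powr (a - 2)) \<le> C / N n" by simp
            qed (use \<xi> L0[of n] in auto)
            also have "\<dots> \<le> C / N n * L n"
              using \<xi> C N0[of n] by (intro mult_left_mono) auto
            finally show ?thesis by simp
          qed
          moreover have "\<bar>\<Phi>' (N n)\<bar> \<le> \<epsilon>"
            using tb by (simp add: \<Phi>'_def b_def mult_ac abs_le_iff)
          ultimately show ?thesis unfolding \<epsilon>_def by linarith
        qed
        \<comment> \<open>The slope at \<open>N n\<close> contributes 1/4 and the curvature
          1/2.\<close>
        have near: "\<bar>\<Phi> \<xi> - \<Phi> (N n)\<bar> \<le> 1" if \<xi>: "\<xi> \<in> {N n..N n + L n}" for \<xi>
        proof -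
          have "norm (\<Phi> \<xi> - \<Phi> (N n)) \<le> (1 / (4 * L n) + C / N n * L n) * norm (\<xi> - N n)"
          proof (rule field_differentiable_bound[of "{N n..N n + L n}" \<Phi> \<Phi>'])
            fix z assume z: "z \<in> {N n..N n + L n}"
            have z0: "z > 0" using z N0[of n] by simp
            show "(\<Phi> has_field_derivative \<Phi>' z) (at z within {N n..N n + L n})"
              unfolding \<Phi>_def[abs_def] \<Phi>'_def
              by (rule has_field_derivative_at_within[OF phase_deriv(1)[OF z0]])
            show "norm (\<Phi>' z) \<le> 1 / (4 * L n) + C / N n * L n" using d1[OF z] by simp
          qed (use \<xi> L0[of n] in auto)
          also have "\<dots> \<le> (1 / (4 * L n) + C / N n * L n) * L n"
            using \<xi> C N0[of n] L0[of n] by (intro mult_left_mono) auto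
          also have "\<dots> = 1/4 + (L n)\<^sup>2 * C / N n"
            using L0[of n] by (simp add: distrib_right power2_eq_square)
          also have "(L n)\<^sup>2 * C / N n \<le> (1/2 * N n) / N n"
            using N0[of n] by (intro divide_right_mono L2) auto
          finally show ?thesis using N0[of n] by simp
        qed
        have "1 * L n / 2 \<le> norm (integral {N n..N n + L n} (\<lambda>\<xi>. of_real 1 * cis (\<Phi> \<xi>)))"
        proof (rule norm_integral_cis_ge[where c = "\<Phi> (N n)" and m = "\<lambda>_. 1"])
          show "continuous_on {N n..N n + L n} \<Phi>"
            unfolding \<Phi>_def[abs_def] using N0[of n] by (intro continuous_intros) auto
        qed (use L0[of n] near in auto)
        then have "A n * (L n / 2) \<le> A n * norm (integral {N n..N n + L n} (\<lambda>\<xi>. cis (\<Phi> \<xi>)))"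
          using A[of n] by (intro mult_left_mono) auto
        also have "\<dots> = norm (evol a (?G n) t x)"
          using A[of n] L0[of n] by (subst evol_box[OF N0]) (auto simp: norm_mult \<Phi>_def)
        finally have big: "A n * (L n / 2) \<le> norm (evol a (?G n) t x)" .
        have "6 * A n \<le> A n * (L n / 4)"
          using A[of n] elim mult_left_mono[of 6 "L n / 4" "A n"] by simp
        then have "A n * (L n / 4) \<le> norm (evol a (?G n) t x - evol a (?G n) 0 x)"
          using big free[OF x, of n] norm_triangle_ineq2[of "evol a (?G n) t x" "evol a (?G n) 0 x"]
          by (simp add: algebra_simps)
        moreover have "A n * (L n / 4) = 4 * N n powr (- (a - 1) * \<delta>)"
          using AL[of n] by simp
        moreover have "2 * \<bar>t\<bar> powr \<delta> \<le> 4 * N n powr (- (a - 1) * \<delta>)"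
        proof -
          have "\<bar>t\<bar> powr \<delta> \<le> (2 * N n powr (1 - a)) powr \<delta>"
            using \<delta> by (intro powr_mono2 Tup[OF tT]) auto
          also have "\<dots> = 2 powr \<delta> * N n powr (- (a - 1) * \<delta>)"
            by (simp add: powr_mult powr_powr)
          also have "\<dots> \<le> 2 powr 1 * N n powr (- (a - 1) * \<delta>)"
            using \<delta> by (intro mult_right_mono powr_mono) auto
          finally show ?thesis by simp
        qed
        ultimately show "\<exists>t\<in>T n. 2 * \<bar>t\<bar> powr \<delta> \<le> norm (evol a (?G n) t x - evol a (?G n) 0 x)"
          using tT by (intro bexI[of _ t]) auto
      qed
    qed
    show "\<forall>\<^sub>F m in sequentially. \<forall>t\<in>T n. \<forall>x\<in>{1/2..1}. norm (evol a (?G m) t x - evol a (?G m) 0 x)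
        \<le> \<eta> * \<bar>t\<bar> powr \<delta>"
      if \<eta>: "\<eta> > 0" for n \<eta>
    proof -
      \<comment> \<open>A positive lower bound for \<open>\<bar>t\<bar>\<close> on the infinite set
        \<open>T n\<close>, which makes the choice of \<open>m\<close> uniform in
        \<open>t\<close>.\<close>
      define c where "c = 1 / (4 * a * N n powr (a - 1))"
      have c: "c > 0" using a N0[of n] by (simp add: c_def)
      have tc: "c \<le> \<bar>t\<bar>" if t: "t \<in> T n" for t
        using Tlow[OF t] Tneg[OF t] a N0[of n] by (simp add: c_def field_simps)
      have "A \<longlonglongrightarrow> 0"
        unfolding A_def[abs_def] N_def
      proof (intro tendsto_mult_right_zero tendsto_two_powr)
        have "1 * \<delta> \<le> a * \<delta>" using a \<delta> by (intro mult_right_mono) auto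
        then show "- (a - 1) * \<delta> - 1/2 < 0" by (simp add: algebra_simps)
      qed
      then have lim9: "(\<lambda>m. 9 * A m) \<longlonglongrightarrow> 0" by (rule tendsto_mult_right_zero)
      have e1: "\<forall>\<^sub>F m in sequentially. 9 * A m < \<eta> * c powr \<delta>"
        by (rule order_tendstoD(2)[OF lim9]) (use \<eta> c in auto)
      have "(\<lambda>m. N m powr (- (a - 1))) \<longlonglongrightarrow> 0"
        unfolding N_def using a by (intro tendsto_two_powr) simp
      then have e2: "\<forall>\<^sub>F m in sequentially. N m powr (- (a - 1)) < c * a / 2"
        using c a by (intro order_tendstoD(2)) auto
      show ?thesis
        using e1 e2
      proof eventually_elim
        case (elim m)
        have big: "2 < c * a * N m powr (a - 1)"
        proof -
          have "N m powr (- (a - 1)) * N m powr (a - 1) < c * a / 2 * N m powr (a - 1)"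
            using N0[of m] by (intro mult_strict_right_mono elim(2)) simp
          moreover have "N m powr (- (a - 1)) * N m powr (a - 1) = 1"
            using N0[of m] by (simp add: powr_add[symmetric])
          ultimately show ?thesis by simp
        qed
        show ?case
        proof (intro ballI)
          fix t x :: real assume t: "t \<in> T n" and x: "x \<in> {1/2..1}"
          have tneg: "t < 0" by (rule Tneg[OF t])
          \<comment> \<open>By time \<open>t\<close> the later packet has already moved past
            position 2, beyond all \<open>x\<close> in \<open>{1/2..1}\<close>. The signs are
            reversed because \<open>t < 0\<close>: the conjugate phase is the convex one.\<close>
          have p1: "- x - t * a * \<xi> powr (a - 1) \<ge> 1" if \<xi>: "\<xi> \<in> {N m..N m + L m}" for \<xi>
          proof -
            have "c * a * N m powr (a - 1) \<le> - t * a * \<xi> powr (a - 1)"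
              using tc[OF t] tneg a \<xi> N0[of m] c mult_nonpos_nonneg[of t a]
              by (intro mult_mono powr_mono2) auto
            then show ?thesis using big x by simp
          qed
          have "norm (integral {N m..N m + L m} (\<lambda>\<xi>. cis (- x * \<xi> + - t * \<xi> powr a))) \<le> 3 / 1"
          proof (rule van_der_Corput_first[where p' = "\<lambda>\<xi>. - x + - t * a * \<xi> powr (a - 1)"
              and p'' = "\<lambda>\<xi>. - t * a * (a - 1) * \<xi> powr (a - 2)"])
            show "continuous_on {N m..N m + L m} (\<lambda>\<xi>. - t * a * (a - 1) * \<xi> powr (a - 2))"
              using N0[of m] by (intro continuous_intros) auto
            show "0 \<le> - t * a * (a - 1) * \<xi> powr (a - 2)" for \<xi>
              using tneg a by (intro mult_nonneg_nonneg) auto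
            fix \<xi> assume \<xi>: "\<xi> \<in> {N m..N m + L m}"
            then have "\<xi> > 0" using N0[of m] by simp
            then show "((\<lambda>\<xi>. - x * \<xi> + - t * \<xi> powr a) has_real_derivative - x
                + - t * a * \<xi> powr (a - 1)) (at \<xi>)"
              "((\<lambda>\<xi>. - x + - t * a * \<xi> powr (a - 1)) has_real_derivative - t * a * (a - 1)
                  * \<xi> powr (a - 2)) (at \<xi>)"
              by (rule phase_deriv)+
          next
            show "(\<forall>\<xi>\<in>{N m..N m + L m}. 1
                \<le> - x + - t * a * \<xi> powr (a - 1)) \<or> (\<forall>\<xi>\<in>{N m..N m + L m}. - x
                + - t * a * \<xi> powr (a - 1) \<le> - 1)"
              using p1 by (intro disjI1 ballI) simp
          qed (use L0[of m] in auto)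
          also have "integral {N m..N m + L m} (\<lambda>\<xi>. cis (- x * \<xi> + - t * \<xi> powr a))
              = cnj (integral {N m..N m + L m} (\<lambda>\<xi>. cis (x * \<xi> + t * \<xi> powr a)))"
            unfolding Henstock_Kurzweil_Integration.integral_cnj
            by (simp add: cis_cnj algebra_simps)
          finally have "A m * norm (integral {N m..N m + L m} (\<lambda>\<xi>. cis (x * \<xi> + t * \<xi> powr a)))
              \<le> A m * 3"
            using A[of m] by (intro mult_left_mono) auto
          then have "norm (evol a (?G m) t x) \<le> 3 * A m"
            using A[of m] L0[of m] by (subst evol_box[OF N0]) (auto simp: norm_mult mult.commute)
          then have "norm (evol a (?G m) t x - evol a (?G m) 0 x) \<le> 9 * A m"
            using free[OF x, of m] norm_triangle_ineq4[of "evol a (?G m) t x" "evol a (?G m) 0 x"]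
            by simp
          also have "\<dots> \<le> \<eta> * c powr \<delta>" using elim(1) by simp
          also have "\<dots> \<le> \<eta> * \<bar>t\<bar> powr \<delta>"
            using \<eta> \<delta> c tc[OF t] by (intro mult_left_mono powr_mono2) auto
          finally show "norm (evol a (?G m) t x - evol a (?G m) 0 x) \<le> \<eta> * \<bar>t\<bar> powr \<delta>" .
        qed
      qed
    qed
  qed (use a \<delta> s in auto)
qed

lemma sobolev_antimono:
  assumes "s \<le> r"
  shows "sobolev r \<subseteq> sobolev s"
proof
  fix f assume "f \<in> sobolev r"
  then obtain g where t: "tempered f" and g: "represents g (fourier_dist f)"
      and i: "integrable lborel (\<lambda>\<xi>. (1 + \<xi>\<^sup>2) powr r * (norm (g \<xi>))\<^sup>2)"
    by (auto simp: sobolev_def)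
  have [measurable]: "g \<in> borel_measurable borel" using g by (simp add: represents_def)
  have "(1 + \<xi>\<^sup>2) powr s * (norm (g \<xi>))\<^sup>2 \<le> (1 + \<xi>\<^sup>2) powr r * (norm (g \<xi>))\<^sup>2" for \<xi>
    using assms by (intro mult_right_mono powr_mono) auto
  then have "Hs_integrable s g"
    by (intro Bochner_Integration.integrable_bound[OF i]) auto
  then show "f \<in> sobolev s" using t g by (auto simp: sobolev_def)
qed

theorem theorem1p3:
  fixes a \<delta> s :: real
  assumes "a > 1" and "0 \<le> \<delta>" and "\<delta> < 1"
  shows "((a - 1) * \<delta> + max \<delta> (1/4) < s \<longrightarrow> (\<forall>f\<in>sobolev s. ae_convergence_rate a \<delta> f)) \<and>
         ((\<forall>f\<in>sobolev s. ae_convergence_rate a \<delta> f) \<longrightarrow> (a - 1) * \<delta> + max \<delta> (1/4) \<le> s)"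
proof (intro conjI impI ballI)
  fix f assume "(a - 1) * \<delta> + max \<delta> (1/4) < s" "f \<in> sobolev s"
  then show "ae_convergence_rate a \<delta> f"
    using ae_convergence_rate_of_sobolev[OF assms] by blast
next
  assume all: "\<forall>f\<in>sobolev s. ae_convergence_rate a \<delta> f"
  show "(a - 1) * \<delta> + max \<delta> (1/4) \<le> s"
  proof (rule ccontr)
    define \<sigma> where "\<sigma> = (a - 1) * \<delta> + max \<delta> (1/4)"
    assume "\<not> ?thesis"
    then have s\<sigma>: "s < \<sigma>" by (simp add: \<sigma>_def)
    have "0 \<le> (a - 1) * \<delta>" using assms by simp
    then have \<sigma>0: "\<sigma> > 0" by (simp add: \<sigma>_def max_def)
    \<comment> \<open>The counterexamples require a positive order, whereas \<open>s\<close> may be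
      negative; since \<open>\<sigma> > 0\<close> there is room for \<open>r\<close>, and the
      function found in \<open>sobolev r\<close> also lies in \<open>sobolev s\<close>.\<close>
    obtain r where r: "max s 0 < r" "r < \<sigma>" using dense[of "max s 0" \<sigma>] s\<sigma> \<sigma>0 by auto
    have "\<exists>f\<in>sobolev r. \<not> ae_convergence_rate a \<delta> f"
    proof (cases "\<delta> \<le> 1/4")
      case True
      then show ?thesis
        using moving_time_counterexample[OF assms, of r] r
        by (simp add: \<sigma>_def max_def split: if_splits)
    next
      case False
      then have "\<sigma> = a * \<delta>" by (simp add: \<sigma>_def max_def algebra_simps)
      then show ?thesis
        using fixed_time_counterexample[of a \<delta> r] assms r False by simp
    qed
    then show False using all sobolev_antimono[of s r] r by auto
  qed
qed

end
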